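(* Let $F$ be a field of characteristic $2$, let $\varphi$ and $\psi$ be quadratic forms over $F$ of dimension at least two, and let $\pi$ be a bilinear Pfister form over $F$. (i) We have $\mathfrak{i}_d\big((\pi\otimes\varphi)_{F(\pi\otimes\psi)}\big)\geq(\dim\pi)\,\mathfrak{i}_d\big(\varphi_{F(\psi)}\big)$. (ii) If moreover $\varphi$ is nonsingular and $\psi$ is not totally singular, then $\mathfrak{i}_W\big((\pi\otimes\varphi)_{F(\pi\otimes\psi)}\big)\geq(\dim\pi)\,\mathfrak{i}_W\big(\varphi_{F(\psi)}\big)$.
   Context: Quadratic forms over a field $F$ of characteristic $2$: every quadratic form is isometric to $[a_1,b_1]\perp\dots\perp[a_r,b_r]\perp\langle c_1,\dots,c_s\rangle$, where $[a,b]$ denotes $ax^2+xy+by^2$ and $\langle c\rangle$ denotes $cz^2$; $(r,s)$ is the type; the form is nonsingular if $s=0$ and totally singular if $r=0$. Every $\varphi$ decomposes as $\varphi\cong i\times\mathbb{H}\perp\varphi_{\mathrm{an}}\perp j\times\langle 0\rangle$ with $\mathbb{H}=[0,0]$, $\varphi_{\mathrm{an}}$ anisotropic and $i,j$ unique; $\mathfrak{i}_W(\varphi)=i$ is the Witt index and $\mathfrak{i}_d(\varphi)=j$ the defect. For a diagonal bilinear form $\mathfrak{b}\cong\langle a_1,\dots,a_k\rangle_b$, $\mathfrak{b}\otimes\varphi:=a_1\varphi\perp\dots\perp a_k\varphi$. A bilinear Pfister form is $\langle\langle a_1,\dots,a_n\rangle\rangle=\langle 1,a_1\rangle_b\otimes\dots\otimes\langle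 1,a_n\rangle_b$ with $a_i\in F^*$ ($n\ge 0$). Function field: if the polynomial $\psi(X_1,\dots,X_n)$ is irreducible, $F(\psi)$ is the fraction field of $F[X_2,\dots,X_n]/(\psi(1,X_2,\dots,X_n))$; if $\psi\cong\langle a\rangle$ or $\psi\cong\mathbb{H}$, $F(\psi)=F$. Function fields occurring are understood to be defined. *)

theory Defs
  imports
    "HOL-Library.Poly_Mapping"
    "HOL-Algebra.QuotRing"
    "HOL-Computational_Algebra.Factorial_Ring"
    "Jordan_Normal_Form.Ring_Hom_Matrix"
    "Jordan_Normal_Form.VS_Connect"
begin

section \<open>Quadratic forms\<close>

text \<open>
  A quadratic form of dimension $n$ over a field is given by an $n \times n$ matrix $M$, standing
  for the homogeneous polynomial $\sum_{i,j} M_{ij} X_i X_j$.  Neither symmetry nor triangularity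
  of $M$ is required (symmetric matrices would not suffice in characteristic 2); different
  matrices may represent the same form.  Extension of scalars along a field embedding \<open>h\<close> is
  \<open>map_mat h\<close>, scaling by \<open>a\<close> is \<open>a \<cdot>\<^sub>m M\<close>, and the orthogonal sum of a list of forms is
  \<open>diag_block_mat\<close>.
\<close>

definition qf_eval :: "'a::comm_ring_1 mat \<Rightarrow> 'a vec \<Rightarrow> 'a" where
  "qf_eval \<phi> v = v \<bullet> (\<phi> *\<^sub>v v)"

definition isometric :: "'a::field mat \<Rightarrow> 'a mat \<Rightarrow> bool" (infix \<open>\<cong>\<^sub>q\<close> 50) where
  "\<phi> \<cong>\<^sub>q \<psi> \<longleftrightarrow> (\<exists>n. \<phi> \<in> carrier_mat n n \<and> \<psi> \<in> carrier_mat n n \<and>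
     (\<exists>P \<in> carrier_mat n n. invertible_mat P \<and>
        (\<forall>v \<in> carrier_vec n. qf_eval \<phi> (P *\<^sub>v v) = qf_eval \<psi> v)))"

definition binary_form :: "'a::comm_ring_1 \<Rightarrow> 'a \<Rightarrow> 'a mat" where
  "binary_form a b = mat_of_rows_list 2 [[a, 1], [0, b]]"

definition unary_form :: "'a::comm_ring_1 \<Rightarrow> 'a mat" where
  "unary_form c = mat_of_rows_list 1 [[c]]"

definition hyperbolic_plane :: "'a::comm_ring_1 mat" where
  "hyperbolic_plane = binary_form 0 0"

definition nonsingular :: "'a::field mat \<Rightarrow> bool" where
  "nonsingular \<phi> \<longleftrightarrow> (\<exists>abs. \<phi> \<cong>\<^sub>q diag_block_mat (map (\<lambda>(a, b). binary_form a b) abs))"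

definition totally_singular :: "'a::field mat \<Rightarrow> bool" where
  "totally_singular \<phi> \<longleftrightarrow> (\<exists>cs. \<phi> \<cong>\<^sub>q diag_block_mat (map unary_form cs))"

definition anisotropic :: "'a::field mat \<Rightarrow> bool" where
  "anisotropic \<phi> \<longleftrightarrow>
     square_mat \<phi> \<and> (\<forall>v \<in> carrier_vec (dim_row \<phi>). qf_eval \<phi> v = 0 \<longrightarrow> v = 0\<^sub>v (dim_row \<phi>))"

definition witt_decomposition :: "'a::field mat \<Rightarrow> nat \<Rightarrow> 'a mat \<Rightarrow> nat \<Rightarrow> bool" where
  "witt_decomposition \<phi> i \<phi>\<^sub>a\<^sub>n j \<longleftrightarrow> anisotropic \<phi>\<^sub>a\<^sub>n \<and>
     \<phi> \<cong>\<^sub>q diag_block_mat (replicate i hyperbolic_plane @ [\<phi>\<^sub>a\<^sub>n] @ replicate j (unary_form 0))"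

definition witt_index :: "'a::field mat \<Rightarrow> nat" where
  "witt_index \<phi> = (THE i. \<exists>\<phi>\<^sub>a\<^sub>n j. witt_decomposition \<phi> i \<phi>\<^sub>a\<^sub>n j)"

definition defect :: "'a::field mat \<Rightarrow> nat" where
  "defect \<phi> = (THE j. \<exists>i \<phi>\<^sub>a\<^sub>n. witt_decomposition \<phi> i \<phi>\<^sub>a\<^sub>n j)"

section \<open>Bilinear Pfister forms\<close>

text \<open>
  A diagonal bilinear form $\langle a_1, \dots, a_k\rangle_b$ is given by the list of its
  coefficients; its dimension is the length of the list.
\<close>

definition bilinear_tensor :: "'a::field list \<Rightarrow> 'a list \<Rightarrow> 'a list" where
  "bilinear_tensor as bs = concat (map (\<lambda>a. map (\<lambda>b. a * b) bs) as)"

fun pfister :: "'a::field list \<Rightarrow> 'a list" where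
  "pfister [] = [1]"
| "pfister (a # as) = bilinear_tensor [1, a] (pfister as)"

definition bilinear_pfister :: "'a::field list \<Rightarrow> bool" where
  "bilinear_pfister \<pi> \<longleftrightarrow> (\<exists>as. 0 \<notin> set as \<and> \<pi> = pfister as)"

definition tensor_form :: "'a::field list \<Rightarrow> 'a mat \<Rightarrow> 'a mat" (infixr \<open>\<otimes>\<^sub>q\<close> 75) where
  "as \<otimes>\<^sub>q \<phi> = diag_block_mat (map (\<lambda>a. a \<cdot>\<^sub>m \<phi>) as)"

section \<open>Function fields of quadratic forms\<close>

text \<open>
  Polynomials live in the polynomial ring in countably many variables.  Variables are numbered
  from 0, so \<open>mpoly_var 0\<close> plays the role of $X_1$.
\<close>

type_synonym 'a mpoly = "(nat \<Rightarrow>\<^sub>0 nat) \<Rightarrow>\<^sub>0 'a"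

definition mpoly_const :: "'a::field \<Rightarrow> 'a mpoly" where
  "mpoly_const c = Poly_Mapping.single 0 c"

definition mpoly_var :: "nat \<Rightarrow> 'a::field mpoly" where
  "mpoly_var i = Poly_Mapping.single (Poly_Mapping.single i 1) 1"

definition form_poly :: "'a::field mat \<Rightarrow> 'a mpoly" where
  "form_poly \<psi> = qf_eval (map_mat mpoly_const \<psi>) (vec (dim_row \<psi>) mpoly_var)"

text \<open>$\psi(1, X_2, \dots, X_n)$:\<close>

definition dehomogenized_poly :: "'a::field mat \<Rightarrow> 'a mpoly" where
  "dehomogenized_poly \<psi> =
     qf_eval (map_mat mpoly_const \<psi>) (vec (dim_row \<psi>) (\<lambda>i. if i = 0 then 1 else mpoly_var i))"

definition mpoly_ring :: "nat set \<Rightarrow> 'a::field mpoly ring" where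
  "mpoly_ring V = class_ring\<lparr>carrier := {p. \<forall>m \<in> Poly_Mapping.keys p. Poly_Mapping.keys m \<subseteq> V}\<rparr>"

text \<open>The ideal by which $F[X_2, \dots, X_n]$ is divided in the construction of $F(\psi)$:\<close>

definition function_field_ideal :: "'a::field mat \<Rightarrow> 'a mpoly set" where
  "function_field_ideal \<psi> = PIdl\<^bsub>mpoly_ring {1..<dim_row \<psi>}\<^esub> (dehomogenized_poly \<psi>)"

definition affine_ring :: "'a::field mat \<Rightarrow> 'a mpoly set ring" where
  "affine_ring \<psi> = mpoly_ring {1..<dim_row \<psi>} Quot function_field_ideal \<psi>"

definition affine_ring_const :: "'a::field mat \<Rightarrow> 'a \<Rightarrow> 'a mpoly set" where
  "affine_ring_const \<psi> c =
     function_field_ideal \<psi> +>\<^bsub>mpoly_ring {1..<dim_row \<psi>}\<^esub> mpoly_const c"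

definition fraction_field_embedding :: "'r ring \<Rightarrow> ('r \<Rightarrow> 'k::field) \<Rightarrow> bool" where
  "fraction_field_embedding R \<iota> \<longleftrightarrow>
     \<iota> \<in> Ring.ring_hom R class_ring \<and>
     inj_on \<iota> (carrier R) \<and>
     (\<forall>z. \<exists>p \<in> carrier R. \<exists>q \<in> carrier R. \<iota> q \<noteq> 0 \<and> z = \<iota> p / \<iota> q)"

text \<open>
  Fraction fields are only determined up to isomorphism, so $F(\psi)$ enters as any field \<open>'k\<close>
  which, together with the embedding \<open>h\<close> of the base field, has the defining property of the
  function field.  The function field is defined only if $\psi$ is irreducible as a polynomial,
  or $\psi \cong \langle a\rangle$, or $\psi \cong \mathbb{H}$; in the last two cases it is the
  base field itself.  Irreducibility is stated in the ring with countably many variables, which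
  is the same as irreducibility in $F[X_1, \dots, X_n]$, because a factor of a nonzero polynomial
  involves no further variables.
\<close>

definition is_function_field :: "'a::field mat \<Rightarrow> ('a \<Rightarrow> 'k::field) \<Rightarrow> bool" where
  "is_function_field \<psi> h \<longleftrightarrow> field_hom h \<and>
     (Factorial_Ring.irreducible (form_poly \<psi>) \<and>
        (\<exists>\<iota>. fraction_field_embedding (affine_ring \<psi>) \<iota> \<and>
             (\<forall>c. \<iota> (affine_ring_const \<psi> c) = h c))
      \<or> ((\<exists>a. \<psi> \<cong>\<^sub>q unary_form a) \<or> \<psi> \<cong>\<^sub>q hyperbolic_plane) \<and> bij h)"

end

theory Submission
  imports Defs "HOL-Algebra.Algebraic_Closure_Type"
begin

text \<open>
  Write \<open>L\<close> for the function field of \<open>\<pi> \<otimes> \<psi>\<close>. Everything rests on one step for a single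
  slot \<open>\<langle>1, a\<rangle>\<close>. If \<open>t\<^sup>2 = \<beta> t + a\<close>, the functional on \<open>L(t) = L \<oplus> L t\<close> with \<open>1 \<mapsto> 1\<close>
  and \<open>t \<mapsto> 0\<close> transfers \<open>Q\<close> to \<open>Q \<bottom> a Q\<close>, so a totally isotropic space of dimension \<open>d\<close>
  over \<open>L(t)\<close> yields one of dimension \<open>2d\<close> for \<open>Q \<bottom> a Q\<close> over \<open>L\<close>, whatever \<open>\<beta>\<close> is. Given a
  zero \<open>(x, y)\<close> of \<open>q \<bottom> a q\<close> over \<open>L\<close>, take \<open>\<beta> = b\<^sub>q(x, y) / q(y)\<close>: then \<open>x + t y\<close> is a zero of
  \<open>q\<close> over \<open>L(t)\<close>. Iterating over the slots of \<open>\<pi>\<close> leads to a zero of \<open>\<psi>\<close> over a tower of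
  quadratic extensions of \<open>L\<close>.

  That zero is generic, so that \<open>F(\<psi>)\<close> embeds into the tower. To see this, specialize the generic
  zero of \<open>\<pi> \<otimes> \<psi>\<close> to a zero assembled from the generic zero \<open>w\<close> of \<open>\<psi>\<close> and an anisotropic vector
  \<open>u\<close> over the base field. The specialization extends along the tower, and it sends the constructed
  zero of \<open>\<psi>\<close> to \<open>w\<close> or to its mirror image under the reflection in \<open>u\<close>, which are both generic.
\<close>

section \<open>Quadratic maps and orthogonal doubling\<close>

text \<open>A zero of \<open>\<psi>\<close> in an extension only gives a homomorphism from the
  coordinate ring of the quadric. It extends to F(\<psi>) only when it is injective, and nothing in
  the construction of the zero forces this. Injectivity is therefore tested after specializing, and
  for that every division in the construction must make sense at the test point. The denominator at
  each level specializes to the same value q(u), nonzero by the choice of \<open>u\<close>, and the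
  quotient specializes to the same \<beta>, because b_q(u, u) = 0 in characteristic 2. So one pair
  u, \<beta> serves all slots. The dimension carried along the tower is not the Witt index i. A
  maximal totally isotropic subspace has dimension i + j, and the isotropic vectors of the radical
  form a subspace of dimension j, the defect. Both kinds are transferred by one argument, selected
  by the flag \<open>rad\<close>. For nonsingular \<phi> the polar form stays nondegenerate after
  the tensor product, so there j = 0 and i + j is the Witt index.\<close>

definition polar :: "((nat \<Rightarrow> 'f::field) \<Rightarrow> 'f) \<Rightarrow> (nat \<Rightarrow> 'f) \<Rightarrow> (nat \<Rightarrow> 'f) \<Rightarrow> 'f" where
  "polar Q x y = Q (\<lambda>i. x i + y i) - Q x - Q y"

text \<open>Vectors are functions on all naturals, and \<open>cong\<close> says that
  \<open>Q\<close> reads only the coordinates below \<open>M\<close>. Subspaces over different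
  intermediate fields and both halves of an orthogonal sum then live in one type.\<close>

locale quadratic_map =
  fixes M :: nat and Q :: "(nat \<Rightarrow> 'f::field) \<Rightarrow> 'f"
  assumes scale: "Q (\<lambda>i. c * x i) = c\<^sup>2 * Q x"
    and polar_add: "polar Q (\<lambda>i. x i + y i) z = polar Q x z + polar Q y z"
    and polar_scale: "polar Q (\<lambda>i. c * x i) z = c * polar Q x z"
    and cong: "(\<And>i. i < M \<Longrightarrow> x i = y i) \<Longrightarrow> Q x = Q y"
begin

lemma add: "Q (\<lambda>i. x i + y i) = Q x + Q y + polar Q x y"
  by (simp add: polar_def)

lemma polar_sym: "polar Q x y = polar Q y x"
  by (simp add: polar_def add.commute)

lemma polar_add_right: "polar Q z (\<lambda>i. x i + y i) = polar Q z x + polar Q z y"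
  by (simp only: polar_sym[of z x] polar_sym[of z y] polar_sym[of z "\<lambda>i. x i + y i"] polar_add)

lemma polar_scale_right: "polar Q z (\<lambda>i. c * x i) = c * polar Q z x"
  by (simp only: polar_sym[of z x] polar_sym[of z "\<lambda>i. c * x i"] polar_scale)

lemma zero: "Q (\<lambda>_. 0) = 0"
  using scale[of 0 "\<lambda>_. 0"] by simp

lemma polar_zero: "polar Q (\<lambda>_. 0) z = 0" "polar Q z (\<lambda>_. 0) = 0"
  using polar_scale[of 0 "\<lambda>_. 0" z] polar_scale_right[of z 0 "\<lambda>_. 0"] by simp_all

lemma polar_cong:
  assumes "\<And>i. i < M \<Longrightarrow> x i = x' i" and "\<And>i. i < M \<Longrightarrow> y i = y' i"
  shows "polar Q x y = polar Q x' y'"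
proof -
  have "Q x = Q x'" "Q y = Q y'" "Q (\<lambda>i. x i + y i) = Q (\<lambda>i. x' i + y' i)"
    using assms by (auto intro!: cong)
  then show ?thesis by (simp add: polar_def)
qed

lemma polar_self: "polar Q x x = 2 * Q x"
proof -
  have "(\<lambda>i. x i + x i) = (\<lambda>i. 2 * x i)" by (simp only: mult_2)
  then have "Q (\<lambda>i. x i + x i) = 4 * Q x" using scale[of 2 x] by simp
  then show ?thesis by (simp add: polar_def)
qed

end

text \<open>The product of \<open>Q\<close> with the bilinear form <1, a>_b; the second summand
  occupies the coordinates from \<open>M\<close> on.\<close>

definition double_map :: "'f::field \<Rightarrow> nat \<Rightarrow> ((nat \<Rightarrow> 'f) \<Rightarrow> 'f) \<Rightarrow> (nat \<Rightarrow> 'f) \<Rightarrow> 'f" where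
  "double_map a M Q x = Q x + a * Q (\<lambda>i. x (i + M))"

lemma polar_double_map:
  "polar (double_map a M Q) x y = polar Q x y + a * polar Q (\<lambda>i. x (i + M)) (\<lambda>i. y (i + M))"
  by (simp add: polar_def double_map_def algebra_simps)

lemma quadratic_map_double_map:
  assumes "quadratic_map M Q"
  shows "quadratic_map (2 * M) (double_map a M Q)"
proof -
  interpret quadratic_map M Q by fact
  show ?thesis
  proof
    fix c x show "double_map a M Q (\<lambda>i. c * x i) = c\<^sup>2 * double_map a M Q x"
      by (simp add: double_map_def scale algebra_simps)
  next
    fix x y z show "polar (double_map a M Q) (\<lambda>i. x i + y i) z = polar (double_map a M Q) x z + polar (double_map a M Q) y z"
      by (simp add: polar_double_map polar_add algebra_simps)
  next
    fix c x z show "polar (double_map a M Q) (\<lambda>i. c * x i) z = c * polar (double_map a M Q) x z"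
      by (simp add: polar_double_map polar_scale algebra_simps)
  next
    fix x y :: "nat \<Rightarrow> 'a" assume *: "\<And>i. i < 2 * M \<Longrightarrow> x i = y i"
    have "Q x = Q y" "Q (\<lambda>i. x (i + M)) = Q (\<lambda>i. y (i + M))"
      by (rule cong, simp add: *)+
    then show "double_map a M Q x = double_map a M Q y" by (simp add: double_map_def)
  qed
qed

text \<open>The product of \<open>Q\<close> with a Pfister form, as an iterated doubling. The first
  slot is outermost, so that an induction over the list strips off one quadratic extension at a
  time.\<close>

fun pfister_map :: "'f::field list \<Rightarrow> nat \<Rightarrow> ((nat \<Rightarrow> 'f) \<Rightarrow> 'f) \<Rightarrow> (nat \<Rightarrow> 'f) \<Rightarrow> 'f" where
  "pfister_map [] M Q = Q"
| "pfister_map (a # as) M Q = double_map a (M * 2 ^ length as) (pfister_map as M Q)"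

lemma quadratic_map_pfister_map:
  "quadratic_map M Q \<Longrightarrow> quadratic_map (M * 2 ^ length as) (pfister_map as M Q)"
proof (induction as)
  case (Cons a as)
  from quadratic_map_double_map[OF Cons.IH[OF Cons.prems], of a] show ?case
    by (simp add: mult.left_commute)
qed simp

definition quad :: "'f::field mat \<Rightarrow> nat \<Rightarrow> (nat \<Rightarrow> 'f) \<Rightarrow> 'f" where
  "quad A n x = (\<Sum>i<n. \<Sum>j<n. A $$ (i, j) * x i * x j)"

lemma polar_quad:
  "polar (quad A n) x y = (\<Sum>i<n. \<Sum>j<n. A $$ (i, j) * (x i * y j + y i * x j))"
  by (simp add: polar_def quad_def sum.distrib algebra_simps)

lemma quadratic_map_quad: "quadratic_map n (quad A n)"
proof
  fix c x show "quad A n (\<lambda>i. c * x i) = c\<^sup>2 * quad A n x"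
    by (simp add: quad_def sum_distrib_left power2_eq_square algebra_simps)
next
  fix x y z show "polar (quad A n) (\<lambda>i. x i + y i) z = polar (quad A n) x z + polar (quad A n) y z"
    by (simp add: polar_quad sum.distrib algebra_simps)
next
  fix c x z show "polar (quad A n) (\<lambda>i. c * x i) z = c * polar (quad A n) x z"
    by (simp add: polar_quad sum_distrib_left algebra_simps)
next
  fix x y :: "nat \<Rightarrow> 'a" assume "\<And>i. i < n \<Longrightarrow> x i = y i"
  then show "quad A n x = quad A n y" by (simp add: quad_def)
qed

section \<open>Isotropic families over subfields\<close>

text \<open>Intermediate fields are sets inside one large field, because the height of the tower
  depends on the number of slots and its members cannot be separate types.\<close>

definition subfield_set :: "'f::field set \<Rightarrow> bool" where
  "subfield_set S \<longleftrightarrow> 0 \<in> S \<and> 1 \<in> S \<and> (\<forall>x\<in>S. \<forall>y\<in>S. x - y \<in> S \<and> x * y \<in> S) \<and> (\<forall>x\<in>S. inverse x \<in> S)"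

lemma subfield_setD:
  assumes "subfield_set S"
  shows "0 \<in> S" "1 \<in> S" "\<And>x y. x \<in> S \<Longrightarrow> y \<in> S \<Longrightarrow> x - y \<in> S"
    "\<And>x y. x \<in> S \<Longrightarrow> y \<in> S \<Longrightarrow> x * y \<in> S" "\<And>x. x \<in> S \<Longrightarrow> inverse x \<in> S"
    "\<And>x. x \<in> S \<Longrightarrow> - x \<in> S"
    "\<And>x y. x \<in> S \<Longrightarrow> y \<in> S \<Longrightarrow> x + y \<in> S"
    "\<And>x y. x \<in> S \<Longrightarrow> y \<in> S \<Longrightarrow> x / y \<in> S"
proof -
  note * = assms[unfolded subfield_set_def]
  show "0 \<in> S" "1 \<in> S" "\<And>x y. x \<in> S \<Longrightarrow> y \<in> S \<Longrightarrow> x - y \<in> S"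
    "\<And>x y. x \<in> S \<Longrightarrow> y \<in> S \<Longrightarrow> x * y \<in> S" "\<And>x. x \<in> S \<Longrightarrow> inverse x \<in> S"
    using * by auto
  show m: "- x \<in> S" if "x \<in> S" for x using * that by (metis diff_0)
  show "x + y \<in> S" if "x \<in> S" "y \<in> S" for x y using * that m by (metis diff_minus_eq_add)
  show "x / y \<in> S" if "x \<in> S" "y \<in> S" for x y using * that by (simp add: divide_inverse)
qed

lemma subfield_set_sum:
  assumes "subfield_set S" "\<And>i. i \<in> I \<Longrightarrow> f i \<in> S"
  shows "sum f I \<in> S"
  using assms(2) by (induction I rule: infinite_finite_induct) (auto simp: subfield_setD[OF assms(1)])

text \<open>
  With \<open>rad\<close> the vectors span a subspace of the radical on which \<open>Q\<close> vanishes, as measured by the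
  defect; without it they span a totally isotropic subspace.
\<close>

definition isotropic_vectors ::
    "'f::field set \<Rightarrow> nat \<Rightarrow> ((nat \<Rightarrow> 'f) \<Rightarrow> 'f) \<Rightarrow> bool \<Rightarrow> nat \<Rightarrow> (nat \<Rightarrow> nat \<Rightarrow> 'f) \<Rightarrow> bool" where
  "isotropic_vectors S M Q rad d V \<longleftrightarrow> (\<forall>k i. V k i \<in> S) \<and>
     (\<forall>c. (\<forall>k. c k \<in> S) \<longrightarrow> (\<forall>i<M. (\<Sum>k<d. c k * V k i) = 0) \<longrightarrow> (\<forall>k<d. c k = 0)) \<and>
     (\<forall>k<d. Q (V k) = 0) \<and>
     (\<forall>k<d. \<forall>y. (\<forall>i. y i \<in> S) \<longrightarrow> rad \<or> (\<exists>l<d. y = V l) \<longrightarrow> polar Q (V k) y = 0)"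

lemma isotropic_vectorsD:
  assumes "isotropic_vectors S M Q rad d V"
  shows "\<And>k i. V k i \<in> S"
    and "\<And>c k. \<forall>k. c k \<in> S \<Longrightarrow> \<forall>i<M. (\<Sum>k<d. c k * V k i) = 0 \<Longrightarrow> k < d \<Longrightarrow> c k = 0"
    and "\<And>k. k < d \<Longrightarrow> Q (V k) = 0"
    and "\<And>k y. k < d \<Longrightarrow> \<forall>i. y i \<in> S \<Longrightarrow> rad \<or> (\<exists>l<d. y = V l) \<Longrightarrow> polar Q (V k) y = 0"
proof -
  note * = assms[unfolded isotropic_vectors_def]
  show "\<And>k i. V k i \<in> S" using * by blast
  show "\<And>c k. \<forall>k. c k \<in> S \<Longrightarrow> \<forall>i<M. (\<Sum>k<d. c k * V k i) = 0 \<Longrightarrow> k < d \<Longrightarrow> c k = 0"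
    using conjunct1[OF conjunct2[OF *]] by blast
  show "\<And>k. k < d \<Longrightarrow> Q (V k) = 0" using * by blast
  show "\<And>k y. k < d \<Longrightarrow> \<forall>i. y i \<in> S \<Longrightarrow> rad \<or> (\<exists>l<d. y = V l) \<Longrightarrow> polar Q (V k) y = 0"
    using conjunct2[OF conjunct2[OF conjunct2[OF *]]] by blast
qed

definition isotropic_family ::
    "'f::field set \<Rightarrow> nat \<Rightarrow> ((nat \<Rightarrow> 'f) \<Rightarrow> 'f) \<Rightarrow> bool \<Rightarrow> nat \<Rightarrow> bool" where
  "isotropic_family S M Q rad d \<longleftrightarrow> (\<exists>V. isotropic_vectors S M Q rad d V)"

lemma sum_lessThan_add:
  fixes f :: "nat \<Rightarrow> 'a::comm_monoid_add"
  shows "sum f {..<a + b} = (\<Sum>k<a. f k) + (\<Sum>k<b. f (k + a))"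
proof -
  have "sum f {..<a + b} = sum f {..<a} + sum f {a..<a + b}"
    by (subst sum.union_disjoint[symmetric]) (auto intro!: sum.cong)
  also have "sum f {a..<a + b} = (\<Sum>k<b. f (k + a))"
    using sum.shift_bounds_nat_ivl[of f 0 a b] by (simp add: atLeast0LessThan add.commute)
  finally show ?thesis .
qed

lemma sum_lessThan_double:
  fixes f :: "nat \<Rightarrow> 'a::comm_monoid_add"
  shows "sum f {..<2 * d} = (\<Sum>k<d. f k) + (\<Sum>k<d. f (k + d))"
  unfolding mult_2 by (rule sum_lessThan_add)

text \<open>Two copies of the family, one in each summand. This serves the levels of the tower at
  which \<open>t\<close> already lies in \<open>S\<close>, so that there is no proper extension to
  transfer from.\<close>

lemma isotropic_family_double_map:
  assumes S: "subfield_set S" and "quadratic_map M Q" and fam: "isotropic_family S M Q rad d"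
  shows "isotropic_family S (2 * M) (double_map a M Q) rad (2 * d)"
proof -
  interpret quadratic_map M Q by fact
  from fam obtain V where "isotropic_vectors S M Q rad d V"
    unfolding isotropic_family_def ..
  note V = isotropic_vectorsD(1)[OF this] and ind = isotropic_vectorsD(2)[OF this]
    and Q0 = isotropic_vectorsD(3)[OF this] and pol = isotropic_vectorsD(4)[OF this]
  define W where "W k i = (if k < d then if i < M then V k i else 0
     else if i < M then 0 else V (k - d) (i - M))" for k i
  have W0: "k < d \<Longrightarrow> i < M \<Longrightarrow> W k i = V k i" "k < d \<Longrightarrow> W k (i + M) = 0"
    "\<not> k < d \<Longrightarrow> i < M \<Longrightarrow> W k i = 0" "\<not> k < d \<Longrightarrow> W k (i + M) = V (k - d) i" for k i
    by (simp_all add: W_def)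
  have WQ: "Q (W k) = (if k < d then Q (V k) else 0)"
    "Q (\<lambda>i. W k (i + M)) = (if k < d then 0 else Q (V (k - d)))" for k
    using cong[of "W k" "V k"] cong[of "W k" "\<lambda>_. 0"] zero by (auto simp: W0)
  have WP: "polar Q (W k) y = (if k < d then polar Q (V k) y else 0)"
    "polar Q (\<lambda>i. W k (i + M)) y = (if k < d then 0 else polar Q (V (k - d)) y)" for k y
    using polar_cong[of "W k" "V k" y y] polar_cong[of "W k" "\<lambda>_. 0" y y] polar_zero by (auto simp: W0)
  show ?thesis
    unfolding isotropic_family_def isotropic_vectors_def
  proof (intro exI[of _ W] conjI allI impI)
    fix k i show "W k i \<in> S" by (simp add: W_def V subfield_setD[OF S])
  next
    fix c k assume c: "\<forall>k. c k \<in> S" and z: "\<forall>i<2 * M. (\<Sum>k<2 * d. c k * W k i) = 0" and k: "k < 2 * d"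
    have "\<forall>i<M. (\<Sum>k<d. c k * V k i) = 0"
    proof (intro allI impI)
      fix i assume "i < M"
      then show "(\<Sum>k<d. c k * V k i) = 0" using z[rule_format, of i] by (simp add: sum_lessThan_double W0)
    qed
    then have 1: "c k = 0" if "k < d" for k using ind[of c k] c that by blast
    have "\<forall>i<M. (\<Sum>k<d. c (k + d) * V k i) = 0"
    proof (intro allI impI)
      fix i assume "i < M"
      then show "(\<Sum>k<d. c (k + d) * V k i) = 0" using z[rule_format, of "i + M"]
        by (simp add: sum_lessThan_double W0)
    qed
    then have 2: "c (k + d) = 0" if "k < d" for k using ind[of "\<lambda>k. c (k + d)" k] c that by blast
    show "c k = 0" using 1[of k] 2[of "k - d"] k by (cases "k < d") auto
  next
    fix k assume "k < 2 * d" then show "double_map a M Q (W k) = 0" by (auto simp: double_map_def WQ Q0)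
  next
    fix k y assume k: "k < 2 * d" and y: "\<forall>i. y i \<in> S" and r: "rad \<or> (\<exists>l<2 * d. y = W l)"
    have y0: "polar Q (V k) y = 0" if "k < d"
    proof (cases rad)
      case True then show ?thesis using pol that y by blast
    next
      case False
      with r obtain l where l: "l < 2 * d" "y = W l" by blast
      have "polar Q (V l) (V k) = 0" if "l < d" using pol[of l "V k"] V that \<open>k < d\<close> by blast
      then show ?thesis unfolding l(2) polar_sym[of "V k" "W l"] by (simp add: WP)
    qed
    have y1: "polar Q (V (k - d)) (\<lambda>i. y (i + M)) = 0" if "\<not> k < d"
    proof (cases rad)
      case True then show ?thesis using pol[of "k - d" "\<lambda>i. y (i + M)"] that y k by auto
    next
      case False
      with r obtain l where l: "l < 2 * d" "y = W l" by blast
      have "polar Q (V (l - d)) (V (k - d)) = 0" if "\<not> l < d"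
      proof -
        have "l - d < d" "k - d < d" using that \<open>\<not> k < d\<close> k l by auto
        then show ?thesis using pol[of "l - d" "V (k - d)"] V by blast
      qed
      then show ?thesis
        unfolding l(2) polar_sym[of "V (k - d)" "\<lambda>i. W l (i + M)"] by (simp add: WP)
    qed
    show "polar (double_map a M Q) (W k) y = 0" by (simp add: polar_double_map WP y0 y1)
  qed
qed

text \<open>The coefficient of 1 in Q(x0 + x1 t) is \<open>Q x0 + a * Q x1\<close>, likewise for the
  polar form, and coefficients are unique because \<open>t \<notin> S\<close>. A basis
  \<open>R\<close> over S(t) gives the basis R, t R over \<open>S\<close>, which doubles the
  dimension.\<close>

lemma isotropic_family_double_extension:
  assumes S: "subfield_set S" and "quadratic_map M Q"
    and QS: "\<And>x. (\<And>i. x i \<in> S) \<Longrightarrow> Q x \<in> S"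
    and t: "t \<notin> S" "t\<^sup>2 = \<beta> * t + a" and \<beta>: "\<beta> \<in> S" and a: "a \<in> S"
    and fam: "isotropic_family {e + f * t |e f. e \<in> S \<and> f \<in> S} M Q rad d"
  shows "isotropic_family S (2 * M) (double_map a M Q) rad (2 * d)"
proof -
  interpret quadratic_map M Q by fact
  note S_simps = subfield_setD[OF S]
  define E where "E = {e + f * t |e f. e \<in> S \<and> f \<in> S}"
  have EI: "e + f * t \<in> E" if "e \<in> S" "f \<in> S" for e f using that E_def by blast
  have E0: "e = 0 \<and> f = 0" if "e + f * t = 0" "e \<in> S" "f \<in> S" for e f
  proof -
    have "f = 0"
    proof (rule ccontr)
      assume "f \<noteq> 0"
      with that(1) have "t = - e / f" by (simp add: field_simps add_eq_0_iff)
      with that t(1) show False using S_simps by simp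
    qed
    with that(1) show ?thesis by simp
  qed
  from fam obtain R where "isotropic_vectors E M Q rad d R"
    unfolding isotropic_family_def E_def ..
  note R = isotropic_vectorsD(1)[OF this] and ind = isotropic_vectorsD(2)[OF this]
    and Q0 = isotropic_vectorsD(3)[OF this] and pol = isotropic_vectorsD(4)[OF this]
  have "\<forall>k i. \<exists>e f. e \<in> S \<and> f \<in> S \<and> R k i = e + f * t" using R unfolding E_def by blast
  then obtain u v where u: "\<And>k i. u k i \<in> S" and v: "\<And>k i. v k i \<in> S"
    and Ruv: "\<And>k i. R k i = u k i + v k i * t" by metis
  \<comment> \<open>Indices \<open>k < d\<close> hold the coordinates of \<open>R k\<close> with
    respect to 1, t; the others hold those of \<open>t * R (k - d)\<close>, by t (u + v t) = a v +
    (u + \<beta> v) t.\<close>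
  define U where "U k i = (if k < d then u k i else a * v (k - d) i)" for k i
  define V where "V k i = (if k < d then v k i else u (k - d) i + \<beta> * v (k - d) i)" for k i
  define W where "W k i = (if i < M then U k i else V k (i - M))" for k i
  define R' where "R' k = (if k < d then R k else (\<lambda>i. t * R (k - d) i))" for k
  have US: "U k i \<in> S" and VS: "V k i \<in> S" and WS: "W k i \<in> S" for k i
    by (simp_all add: U_def V_def W_def u v a \<beta> S_simps)
  have tt: "t * (x + y * t) = a * y + (x + \<beta> * y) * t" for x y
  proof -
    have "t * (x + y * t) = x * t + y * t\<^sup>2" by (simp add: power2_eq_square algebra_simps)
    then show ?thesis by (simp add: t(2) algebra_simps)
  qed
  have R': "R' k i = U k i + V k i * t" for k i
    by (simp add: R'_def U_def V_def Ruv tt)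
  have R'E: "R' k i \<in> E" for k i by (simp add: R' EI US VS)
  have QR': "Q (R' k) = 0" if "k < 2 * d" for k using that by (auto simp: R'_def scale Q0)
  have polR': "polar Q (R' k) y = 0"
    if k2: "k < 2 * d" and yE: "\<forall>i. y i \<in> E" and yR: "rad \<or> (\<exists>l<2 * d. y = R' l)" for k y
  proof -
    have *: "polar Q (R k) y = 0" if k: "k < d" for k
    proof (cases rad)
      case True then show ?thesis using pol k yE by blast
    next
      case False
      with yR obtain l where l: "l < 2 * d" "y = R' l" by blast
      have "polar Q (R k) (R l) = 0" if "l < d" for l using pol[of k "R l"] R k that by blast
      then show ?thesis using l by (auto simp: R'_def polar_scale_right)
    qed
    show ?thesis using *[of k] *[of "k - d"] k2 by (auto simp: R'_def polar_scale)
  qed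
  have split: "polar Q (\<lambda>i. x0 i + x1 i * t) (\<lambda>i. y0 i + y1 i * t) =
      (polar Q x0 y0 + a * polar Q x1 y1)
      + (polar Q x0 y1 + polar Q x1 y0 + \<beta> * polar Q x1 y1) * t" for x0 x1 y0 y1
  proof -
    have "polar Q (\<lambda>i. x0 i + x1 i * t) (\<lambda>i. y0 i + y1 i * t)
      = polar Q (\<lambda>i. x0 i + t * x1 i) (\<lambda>i. y0 i + t * y1 i)" by (simp only: mult.commute)
    also have "\<dots> = polar Q x0 y0 + (polar Q x0 y1 + polar Q x1 y0) * t + t\<^sup>2 * polar Q x1 y1"
      by (simp add: polar_add polar_add_right polar_scale polar_scale_right power2_eq_square algebra_simps)
    finally show ?thesis by (simp add: t(2) algebra_simps)
  qed
  have splitQ: "Q (\<lambda>i. x0 i + x1 i * t) = (Q x0 + a * Q x1) + (polar Q x0 x1 + \<beta> * Q x1) * t" for x0 x1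
  proof -
    have "Q (\<lambda>i. x0 i + x1 i * t) = Q (\<lambda>i. x0 i + t * x1 i)" by (simp only: mult.commute)
    also have "\<dots> = Q x0 + polar Q x0 x1 * t + t\<^sup>2 * Q x1"
      by (simp add: add scale polar_scale_right algebra_simps)
    finally show ?thesis by (simp add: t(2) algebra_simps)
  qed
  have PS: "polar Q x y \<in> S" if "\<And>i. x i \<in> S" "\<And>i. y i \<in> S" for x y
    unfolding polar_def by (intro S_simps QS that)
  have WU: "Q (W k) = Q (U k)" "Q (\<lambda>i. W k (i + M)) = Q (V k)"
    "polar Q (W k) y = polar Q (U k) y" "polar Q (\<lambda>i. W k (i + M)) y = polar Q (V k) y" for k y
    by (rule cong polar_cong; simp add: W_def)+
  show ?thesis
    unfolding isotropic_family_def isotropic_vectors_def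
  proof (intro exI[of _ W] conjI allI impI)
    fix k i show "W k i \<in> S" by (rule WS)
  next
    fix c k assume c: "\<forall>k. c k \<in> S" and z: "\<forall>i<2 * M. (\<Sum>k<2 * d. c k * W k i) = 0" and k: "k < 2 * d"
    \<comment> \<open>An \<open>S\<close>-relation among the \<open>2 * d\<close> vectors is an
      \<open>E\<close>-relation among the \<open>d\<close> vectors \<open>R k\<close>, with
      coefficients \<open>c k + c (k + d) * t\<close>.\<close>
    have "\<forall>i<M. (\<Sum>k<d. (c k + c (k + d) * t) * R k i) = 0"
    proof (intro allI impI)
      fix i assume i: "i < M"
      have "(\<Sum>k<d. (c k + c (k + d) * t) * R k i) = (\<Sum>k<d. c k * R k i + c (k + d) * (t * R k i))"
        by (simp add: algebra_simps)
      also have "\<dots> = (\<Sum>k<2 * d. c k * R' k i)"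
        by (simp add: sum_lessThan_double R'_def sum.distrib)
      also have "\<dots> = (\<Sum>k<2 * d. c k * W k i) + (\<Sum>k<2 * d. c k * W k (i + M)) * t"
        using i by (simp add: R' W_def sum_distrib_right sum.distrib distrib_left mult.assoc)
      also have "\<dots> = 0" using z i by simp
      finally show "(\<Sum>k<d. (c k + c (k + d) * t) * R k i) = 0" .
    qed
    then have "c k + c (k + d) * t = 0" if "k < d" for k
      using ind[of "\<lambda>k. c k + c (k + d) * t" k] c that EI by blast
    then have *: "c k = 0 \<and> c (k + d) = 0" if "k < d" for k using E0 c that by blast
    show "c k = 0" using *[of k] *[of "k - d"] k by (cases "k < d") auto
  next
    fix k assume "k < 2 * d"
    then have "(Q (U k) + a * Q (V k)) + (polar Q (U k) (V k) + \<beta> * Q (V k)) * t = 0"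
      using QR'[of k] splitQ[of "U k" "V k"] by (simp add: R'[abs_def])
    then have "Q (U k) + a * Q (V k) = 0"
      using E0 by (meson QS PS US VS a \<beta> S_simps)
    then show "double_map a M Q (W k) = 0" by (simp add: double_map_def WU)
  next
    fix k y assume k: "k < 2 * d" and y: "\<forall>i. y i \<in> S" and r: "rad \<or> (\<exists>l<2 * d. y = W l)"
    define y1 where "y1 = (\<lambda>i. y (i + M))"
    \<comment> \<open>The \<open>S\<close>-vector \<open>y\<close> of length \<open>2 * M\<close> is
      read as the vector y + y1 t over \<open>E\<close>. Orthogonality over \<open>E\<close> then
      gives the wanted equation as the coefficient of 1.\<close>
    have "polar Q (R' k) (\<lambda>i. y i + y1 i * t) = 0"
    proof (cases rad)
      case True
      then show ?thesis using polR'[OF k] y EI y1_def by auto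
    next
      case False
      with r obtain l where l: "l < 2 * d" "y = W l" by blast
      have "polar Q (R' k) (\<lambda>i. y i + y1 i * t) = polar Q (R' k) (R' l)"
        by (rule polar_cong) (simp_all add: l y1_def R' W_def)
      then show ?thesis using polR'[OF k, of "R' l"] l R'E by auto
    qed
    then have "(polar Q (U k) y + a * polar Q (V k) y1)
      + (polar Q (U k) y1 + polar Q (V k) y + \<beta> * polar Q (V k) y1) * t = 0"
      using split[of "U k" "V k" y y1] by (simp add: R'[abs_def])
    moreover have "polar Q (U k) y \<in> S" "polar Q (V k) y1 \<in> S" "polar Q (U k) y1 \<in> S" "polar Q (V k) y \<in> S"
      using y by (auto intro!: PS US VS simp: y1_def)
    ultimately have "polar Q (U k) y + a * polar Q (V k) y1 = 0"
      using E0 by (meson a \<beta> S_simps)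
    then show "polar (double_map a M Q) (W k) y = 0" by (simp add: polar_double_map WU y1_def)
  qed
qed

text \<open>The polynomial X^2 - \<beta> X - a may be reducible over \<open>S\<close>. The norm of a
  nonzero element can then vanish, and inversion needs two cases.\<close>

lemma subfield_set_quadratic_extension:
  assumes S: "subfield_set S" and t: "t\<^sup>2 = \<beta> * t + a" and \<beta>: "\<beta> \<in> S" and a: "a \<in> S"
  shows "subfield_set {e + f * t |e f. e \<in> S \<and> f \<in> S}" (is "subfield_set ?E")
proof -
  note S_simps = subfield_setD[OF S]
  have EI: "x \<in> ?E" if "x = e + f * t" "e \<in> S" "f \<in> S" for x e f using that by blast
  have diff: "x - y \<in> ?E" if "x \<in> ?E" "y \<in> ?E" for x y
  proof -
    from that obtain e f e' f' where "x = e + f * t" "y = e' + f' * t" "e \<in> S" "f \<in> S" "e' \<in> S" "f' \<in> S" by blast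
    then show ?thesis by (intro EI[of _ "e - e'" "f - f'"]) (simp_all add: S_simps algebra_simps)
  qed
  have mult: "x * y \<in> ?E" if "x \<in> ?E" "y \<in> ?E" for x y
  proof -
    from that obtain e f e' f' where *: "x = e + f * t" "y = e' + f' * t" "e \<in> S" "f \<in> S" "e' \<in> S" "f' \<in> S" by blast
    have "x * y = e * e' + (e * f' + f * e') * t + f * f' * t\<^sup>2" by (simp add: * power2_eq_square algebra_simps)
    also have "\<dots> = (e * e' + f * f' * a) + (e * f' + f * e' + f * f' * \<beta>) * t" by (simp add: t algebra_simps)
    finally show ?thesis by (rule EI) (simp_all add: * S_simps a \<beta>)
  qed
  have inv: "inverse x \<in> ?E" if "x \<in> ?E" for x
  proof (cases "x = 0")
    case True then show ?thesis using that by simp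
  next
    case False
    from that obtain e f where *: "x = e + f * t" "e \<in> S" "f \<in> S" by blast
    \<comment> \<open>The norm of \<open>x\<close>, the product of \<open>x\<close> with its
      conjugate \<open>e + f * \<beta> - f * t\<close>.\<close>
    define N where "N = e * e + e * f * \<beta> - f * f * a"
    have N: "x * (e + f * \<beta> - f * t) = N"
    proof -
      have "x * (e + f * \<beta> - f * t) = e * e + e * f * \<beta> + f * f * \<beta> * t - f * f * t\<^sup>2"
        by (simp add: * power2_eq_square algebra_simps)
      then show ?thesis by (simp add: t N_def algebra_simps)
    qed
    have NS: "N \<in> S" using * by (simp add: N_def S_simps a \<beta>)
    show ?thesis
    proof (cases "N = 0")
      case True
      \<comment> \<open>The conjugate is zero, which puts \<open>f * t\<close>, and hence
        \<open>x\<close>, into \<open>S\<close>.\<close>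
      with N False have "f * t = e + f * \<beta>" by auto
      with * have "x = (e + e + f * \<beta>) + 0 * t" by simp
      then have "inverse x = inverse (e + e + f * \<beta>) + 0 * t" by (simp only: mult_zero_left add_0_right)
      moreover have "e + e + f * \<beta> \<in> S"
        by (rule S_simps(7)[OF S_simps(7)[OF *(2) *(2)] S_simps(4)[OF *(3) \<beta>]])
      ultimately show ?thesis by (rule EI[OF _ S_simps(5) S_simps(1)])
    next
      case nz: False
      have "inverse x = q / N" if "x * q = N" for q using that False nz by (auto simp: field_simps)
      from this[OF N] have "inverse x = (e + f * \<beta> - f * t) / N" .
      also have "\<dots> = (e + f * \<beta>) / N + (- f / N) * t" using nz by (simp add: divide_simps)
      finally have eq: "inverse x = (e + f * \<beta>) / N + (- f / N) * t" .
      show ?thesis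
        by (rule EI[OF eq S_simps(8)[OF S_simps(7)[OF *(2) S_simps(4)[OF *(3) \<beta>]] NS] S_simps(8)[OF S_simps(6)[OF *(3)] NS]])
    qed
  qed
  have "0 \<in> ?E" by (rule EI[of _ 0 0]) (simp_all add: S_simps)
  moreover have "1 \<in> ?E" by (rule EI[of _ 1 0]) (simp_all add: S_simps)
  ultimately show ?thesis unfolding subfield_set_def using diff mult inv by (intro conjI ballI)
qed

section \<open>Specializations\<close>

text \<open>
  The graph of a homomorphism from a local subring over the base field: elements with nonzero
  image are invertible in the subring.
\<close>

definition specialization :: "('a \<Rightarrow> 'o::field) \<Rightarrow> ('a \<Rightarrow> 'm::field) \<Rightarrow> ('o \<times> 'm) set \<Rightarrow> bool" where
  "specialization \<eta> \<theta> \<rho> \<longleftrightarrow> (\<forall>c. (\<eta> c, \<theta> c) \<in> \<rho>) \<and>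
     (\<forall>x x' y y'. (x, x') \<in> \<rho> \<longrightarrow> (y, y') \<in> \<rho> \<longrightarrow> (x + y, x' + y') \<in> \<rho> \<and> (x * y, x' * y') \<in> \<rho>) \<and>
     (\<forall>x x'. (x, x') \<in> \<rho> \<longrightarrow> x' \<noteq> 0 \<longrightarrow> (inverse x, inverse x') \<in> \<rho>) \<and>
     (\<forall>x'. (0, x') \<in> \<rho> \<longrightarrow> x' = 0)"

lemma specializationD:
  assumes "specialization \<eta> \<theta> \<rho>"
  shows "(\<eta> c, \<theta> c) \<in> \<rho>"
    and "(x, x') \<in> \<rho> \<Longrightarrow> (y, y') \<in> \<rho> \<Longrightarrow> (x + y, x' + y') \<in> \<rho>"
    and "(x, x') \<in> \<rho> \<Longrightarrow> (y, y') \<in> \<rho> \<Longrightarrow> (x * y, x' * y') \<in> \<rho>"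
    and "(x, x') \<in> \<rho> \<Longrightarrow> x' \<noteq> 0 \<Longrightarrow> (inverse x, inverse x') \<in> \<rho>"
    and "(0, x') \<in> \<rho> \<Longrightarrow> x' = 0"
  using assms unfolding specialization_def by blast+

lemma specialization_divide:
  assumes "specialization \<eta> \<theta> \<rho>" "(x, x') \<in> \<rho>" "(y, y') \<in> \<rho>" "y' \<noteq> 0"
  shows "(x / y, x' / y') \<in> \<rho>"
  using assms specializationD(3,4)[OF assms(1)] by (simp add: divide_inverse)

lemma specialization_diff:
  assumes "field_hom \<eta>" "field_hom \<theta>" "specialization \<eta> \<theta> \<rho>" "(x, x') \<in> \<rho>" "(y, y') \<in> \<rho>"
  shows "(x - y, x' - y') \<in> \<rho>"
proof -
  interpret \<eta>: field_hom \<eta> by fact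
  interpret \<theta>: field_hom \<theta> by fact
  have "(-1, -1) \<in> \<rho>" using specializationD(1)[OF assms(3), of "-1"] by (simp add: hom_distribs)
  from specializationD(3)[OF assms(3) this assms(5)] have "(- y, - y') \<in> \<rho>" by simp
  from specializationD(2)[OF assms(3) assms(4) this] show ?thesis by simp
qed

lemma specialization_sum:
  assumes "field_hom \<eta>" "field_hom \<theta>" "specialization \<eta> \<theta> \<rho>" "\<And>i. i \<in> I \<Longrightarrow> (f i, g i) \<in> \<rho>"
  shows "(sum f I, sum g I) \<in> \<rho>"
proof -
  interpret \<eta>: field_hom \<eta> by fact
  interpret \<theta>: field_hom \<theta> by fact
  have "(0, 0) \<in> \<rho>" using specializationD(1)[OF assms(3), of 0] by simp
  then show ?thesis using assms(4) specializationD(2)[OF assms(3)]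
    by (induction I rule: infinite_finite_induct) auto
qed

text \<open>Localization: a ring homomorphism, given by its graph \<open>R\<close>, extends to all
  fractions whose denominators have nonzero image. The hypothesis on \<open>(0, x')\<close> keeps
  these denominators away from 0 and makes 0 the only image of 0 in the extended relation.\<close>

lemma specialization_fractions:
  assumes const: "\<And>c. (\<eta> c, \<theta> c) \<in> R" and one: "(1, 1) \<in> R"
    and add: "\<And>x x' y y'. (x, x') \<in> R \<Longrightarrow> (y, y') \<in> R \<Longrightarrow> (x + y, x' + y') \<in> R"
    and mult: "\<And>x x' y y'. (x, x') \<in> R \<Longrightarrow> (y, y') \<in> R \<Longrightarrow> (x * y, x' * y') \<in> R"
    and zero: "\<And>x'. (0, x') \<in> R \<Longrightarrow> x' = 0"
  obtains \<rho> where "specialization \<eta> \<theta> \<rho>" "R \<subseteq> \<rho>"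
proof
  let ?\<rho> = "{(x / y, x' / y') |x x' y y'. (x, x') \<in> R \<and> (y, y') \<in> R \<and> y' \<noteq> 0}"
  have I: "(p, q) \<in> ?\<rho>" if "p = x / y" "q = x' / y'" "(x, x') \<in> R" "(y, y') \<in> R" "y' \<noteq> 0"
    for p q x x' y y' using that by blast
  have nz: "y \<noteq> 0" if "(y, y') \<in> R" "y' \<noteq> 0" for y y' using that zero by blast
  show sub: "R \<subseteq> ?\<rho>"
  proof
    fix p assume "p \<in> R"
    then show "p \<in> ?\<rho>" using I[of "fst p" "fst p" 1 "snd p" "snd p" 1] one by simp
  qed
  show "specialization \<eta> \<theta> ?\<rho>"
    unfolding specialization_def
  proof (intro conjI allI impI)
    fix c show "(\<eta> c, \<theta> c) \<in> ?\<rho>" using const sub by blast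
  next
    fix p p' q q' assume "(p, p') \<in> ?\<rho>" "(q, q') \<in> ?\<rho>"
    then obtain x x' y y' z z' w w' where *: "p = x / y" "p' = x' / y'" "(x, x') \<in> R" "(y, y') \<in> R" "y' \<noteq> 0"
      "q = z / w" "q' = z' / w'" "(z, z') \<in> R" "(w, w') \<in> R" "w' \<noteq> 0" by blast
    with nz have "y \<noteq> 0" "w \<noteq> 0" by auto
    then show "(p + q, p' + q') \<in> ?\<rho>"
      using * by (intro I[of _ "x * w + z * y" "y * w" _ "x' * w' + z' * y'" "y' * w'"])
        (simp_all add: add_frac_eq add mult)
    show "(p * q, p' * q') \<in> ?\<rho>"
      using * by (intro I[of _ "x * z" "y * w" _ "x' * z'" "y' * w'"]) (simp_all add: mult)
  next
    fix p p' assume "(p, p') \<in> ?\<rho>" "p' \<noteq> 0"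
    then obtain x x' y y' where *: "p = x / y" "p' = x' / y'" "(x, x') \<in> R" "(y, y') \<in> R" "y' \<noteq> 0" by blast
    with \<open>p' \<noteq> 0\<close> show "(inverse p, inverse p') \<in> ?\<rho>" by (intro I[of _ y x _ y' x']) auto
  next
    fix p' assume "(0, p') \<in> ?\<rho>"
    then obtain x x' y y' where *: "0 = x / y" "p' = x' / y'" "(x, x') \<in> R" "(y, y') \<in> R" "y' \<noteq> 0" by blast
    with nz[of y y'] have "x = 0" by auto
    with * zero show "p' = 0" by auto
  qed
qed

text \<open>
  An element of the ring generated by \<open>t\<close> that is killed has norm zero, so its image under
  one of the two possible values of \<open>t\<close> vanishes; one of the values must work for all elements.
\<close>

lemma specialization_extend:
  assumes "field_hom \<eta>" "field_hom \<theta>" and \<rho>: "specialization \<eta> \<theta> \<rho>"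
    and \<beta>: "(\<beta>, \<beta>') \<in> \<rho>" and a: "(a, a') \<in> \<rho>"
    and t: "t\<^sup>2 = \<beta> * t + a" and c: "c\<^sup>2 = \<beta>' * c + a'"
  obtains c' \<rho>' where "c' = c \<or> c' = \<beta>' - c" "specialization \<eta> \<theta> \<rho>'" "\<rho> \<subseteq> \<rho>'" "(t, c') \<in> \<rho>'"
proof -
  interpret \<eta>: field_hom \<eta> by fact
  interpret \<theta>: field_hom \<theta> by fact
  note D = specializationD[OF \<rho>] and diff = specialization_diff[OF assms(1-3)]
  \<comment> \<open>\<open>bad c'\<close> says that t \<mapsto> c' is not well defined: some linear
    expression in \<open>t\<close> is 0 while its image is not.\<close>
  define bad where "bad c' \<longleftrightarrow> (\<exists>e m f n. (e, m) \<in> \<rho> \<and> (f, n) \<in> \<rho> \<and> e + f * t = 0 \<and> m + n * c' \<noteq> 0)" for c'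
  \<comment> \<open>The norm of \<open>e + f * t\<close> is an expression in \<open>e\<close>,
    \<open>f\<close>, \<open>\<beta>\<close> and \<open>a\<close> alone, so its image is already
    fixed by \<open>\<rho>\<close>; that image is the product of the values at the two
    roots.\<close>
  have norm: "(m + n * c) * (m + n * (\<beta>' - c)) = 0"
    if "(e, m) \<in> \<rho>" "(f, n) \<in> \<rho>" "e + f * t = 0" for e m f n
  proof -
    have "(e * e + e * f * \<beta> - f * f * a, m * m + m * n * \<beta>' - n * n * a') \<in> \<rho>"
      using that \<beta> a by (intro diff D)
    moreover have "e * e + e * f * \<beta> - f * f * a = (e + f * t) * (e + f * (\<beta> - t))"
    proof -
      have "(e + f * t) * (e + f * (\<beta> - t)) = e * e + e * f * \<beta> + f * f * (\<beta> * t - t\<^sup>2)"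
        by (simp add: power2_eq_square algebra_simps)
      then show ?thesis by (simp add: t)
    qed
    moreover have "m * m + m * n * \<beta>' - n * n * a' = (m + n * c) * (m + n * (\<beta>' - c))"
    proof -
      have "(m + n * c) * (m + n * (\<beta>' - c)) = m * m + m * n * \<beta>' + n * n * (\<beta>' * c - c\<^sup>2)"
        by (simp add: power2_eq_square algebra_simps)
      then show ?thesis by (simp add: c)
    qed
    ultimately have "((e + f * t) * (e + f * (\<beta> - t)), (m + n * c) * (m + n * (\<beta>' - c))) \<in> \<rho>" by metis
    then show ?thesis unfolding that(3) by (intro D(5)) simp
  qed
  have "\<not> bad c \<or> \<not> bad (\<beta>' - c)"
  proof (rule ccontr)
    assume "\<not> ?thesis"
    then have bads: "bad c" "bad (\<beta>' - c)" by auto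
    from bads(1) obtain e m f n where 1: "(e, m) \<in> \<rho>" "(f, n) \<in> \<rho>" "e + f * t = 0" "m + n * c \<noteq> 0"
      unfolding bad_def by blast
    from bads(2) obtain e' m' f' n' where 2: "(e', m') \<in> \<rho>" "(f', n') \<in> \<rho>" "e' + f' * t = 0" "m' + n' * (\<beta>' - c) \<noteq> 0"
      unfolding bad_def by blast
    from norm[OF 1(1-3)] 1(4) have 3: "m + n * (\<beta>' - c) = 0" by simp
    from norm[OF 2(1-3)] 2(4) have 4: "m' + n' * c = 0" by simp
    \<comment> \<open>As in prime avoidance: each of the two relations fails at one root only, so
      their sum fails at both, against \<open>norm\<close>.\<close>
    have "(e + e') + (f + f') * t = (e + f * t) + (e' + f' * t)" by (simp add: algebra_simps)
    with 1(3) 2(3) have "(e + e') + (f + f') * t = 0" by simp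
    from norm[OF D(2)[OF 1(1) 2(1)] D(2)[OF 1(2) 2(2)] this]
    have "((m + n * c) + (m' + n' * c)) * ((m + n * (\<beta>' - c)) + (m' + n' * (\<beta>' - c))) = 0"
      by (simp add: algebra_simps)
    with 3 4 1(4) 2(4) show False by simp
  qed
  then obtain c' where c': "c' = c \<or> c' = \<beta>' - c" and good: "\<not> bad c'" by blast
  have cc: "c'\<^sup>2 = \<beta>' * c' + a'"
    using c' c by (auto simp: power2_eq_square algebra_simps)
  define R where "R = {(e + f * t, m + n * c') |e m f n. (e, m) \<in> \<rho> \<and> (f, n) \<in> \<rho>}"
  have I: "(p, q) \<in> R" if "p = e + f * t" "q = m + n * c'" "(e, m) \<in> \<rho>" "(f, n) \<in> \<rho>" for p q e f m n
    unfolding R_def using that by blast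
  have 0: "(0, 0) \<in> \<rho>" and 1: "(1, 1) \<in> \<rho>" using D(1)[of 0] D(1)[of 1] by simp_all
  have sub: "(x, x') \<in> R" if "(x, x') \<in> \<rho>" for x x' by (rule I[of _ x 0 _ x' 0]) (use that 0 in auto)
  obtain \<rho>' where "specialization \<eta> \<theta> \<rho>'" "R \<subseteq> \<rho>'"
  proof (rule specialization_fractions[of \<eta> \<theta> R])
    show "(\<eta> c, \<theta> c) \<in> R" for c by (rule sub) (rule D)
    show "(1, 1) \<in> R" by (rule sub) (rule 1)
    show "x' = 0" if "(0, x') \<in> R" for x'
    proof -
      from that obtain e m f n where "0 = e + f * t" "x' = m + n * c'" "(e, m) \<in> \<rho>" "(f, n) \<in> \<rho>"
        unfolding R_def by blast
      with good show ?thesis unfolding bad_def by metis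
    qed
    fix x x' y y' assume "(x, x') \<in> R" "(y, y') \<in> R"
    then obtain e m f n e' m' f' n' where *: "x = e + f * t" "x' = m + n * c'" "y = e' + f' * t" "y' = m' + n' * c'"
      and mem: "(e, m) \<in> \<rho>" "(f, n) \<in> \<rho>" "(e', m') \<in> \<rho>" "(f', n') \<in> \<rho>" unfolding R_def by blast
    show "(x + y, x' + y') \<in> R"
      by (rule I[of _ "e + e'" "f + f'" _ "m + m'" "n + n'"]) (simp_all add: * mem D algebra_simps)
    have "x * y = e * e' + (e * f' + f * e') * t + f * f' * t\<^sup>2"
      "x' * y' = m * m' + (m * n' + n * m') * c' + n * n' * c'\<^sup>2"
      by (simp_all add: * power2_eq_square algebra_simps)
    then have "x * y = (e * e' + f * f' * a) + (e * f' + f * e' + f * f' * \<beta>) * t"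
      "x' * y' = (m * m' + n * n' * a') + (m * n' + n * m' + n * n' * \<beta>') * c'"
      by (simp_all add: t cc algebra_simps)
    then show "(x * y, x' * y') \<in> R" by (rule I) (intro D mem a \<beta>)+
  qed blast
  moreover have "(t, c') \<in> R" by (rule I[of _ 0 1 _ 0 1]) (use 0 1 in auto)
  moreover have "\<rho> \<subseteq> R" using sub by auto
  ultimately show ?thesis using that[OF c'] by blast
qed

lemma polar_specialization:
  assumes \<rho>: "field_hom \<eta>" "field_hom \<theta>" "specialization \<eta> \<theta> \<rho>"
    and Q: "\<And>x x'. (\<And>i. i < n \<Longrightarrow> (x i, x' i) \<in> \<rho>) \<Longrightarrow> (Q x, Q' x') \<in> \<rho>"
    and "\<And>i. i < n \<Longrightarrow> (x i, x' i) \<in> \<rho>" "\<And>i. i < n \<Longrightarrow> (y i, y' i) \<in> \<rho>"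
  shows "(polar Q x y, polar Q' x' y') \<in> \<rho>"
  unfolding polar_def
  by (intro specialization_diff[OF \<rho>] Q assms specializationD(2)[OF \<rho>(3)]; simp)

lemma quad_specialization:
  assumes \<rho>: "field_hom \<eta>" "field_hom \<theta>" "specialization \<eta> \<theta> \<rho>"
    and "A \<in> carrier_mat n n" "\<And>i. i < n \<Longrightarrow> (x i, x' i) \<in> \<rho>"
  shows "(quad (map_mat \<eta> A) n x, quad (map_mat \<theta> A) n x') \<in> \<rho>"
  unfolding quad_def
  using assms(4,5) by (auto intro!: specialization_sum[OF \<rho>] specializationD[OF \<rho>(3)])

lemma pfister_map_specialization:
  assumes \<rho>: "specialization \<eta> \<theta> \<rho>"
    and Q: "\<And>x x'. (\<And>i. i < n \<Longrightarrow> (x i, x' i) \<in> \<rho>) \<Longrightarrow> (Q x, Q' x') \<in> \<rho>"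
    and "\<And>i. i < n * 2 ^ length as \<Longrightarrow> (x i, x' i) \<in> \<rho>"
  shows "(pfister_map (map \<eta> as) n Q x, pfister_map (map \<theta> as) n Q' x') \<in> \<rho>"
  using assms(3)
proof (induction as arbitrary: x x')
  case Nil then show ?case using Q by simp
next
  case (Cons a as)
  then show ?case
    by (auto simp: double_map_def intro!: specializationD[OF \<rho>] Cons.IH)
qed

lemma pfister_map_in_subfield:
  assumes S: "subfield_set S"
    and Q: "\<And>x. (\<And>i. i < n \<Longrightarrow> x i \<in> S) \<Longrightarrow> Q x \<in> S"
    and "set as \<subseteq> S" "\<And>i. i < n * 2 ^ length as \<Longrightarrow> x i \<in> S"
  shows "pfister_map as n Q x \<in> S"
  using assms(3,4)
proof (induction as arbitrary: x)
  case Nil then show ?case using Q by simp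
next
  case (Cons a as)
  then show ?case
    by (auto simp: double_map_def intro!: subfield_setD[OF S] Cons.IH)
qed

text \<open>
  If \<open>y\<close> is a zero of \<open>q\<close> with \<open>b\<^sub>q(y, u) = \<beta> q(u)\<close> and \<open>c\<^sup>2 = \<beta> c + a\<close>, then \<open>(y + c u, u)\<close> is a
  zero of \<open>q \<bottom> a q\<close> in characteristic 2. Moreover \<open>w + \<beta> u\<close> is the mirror image of \<open>w\<close> under the
  reflection in \<open>u\<close>.
\<close>

fun test_point ::
    "nat \<Rightarrow> (nat \<Rightarrow> 'm::field) \<Rightarrow> (nat \<Rightarrow> 'm) \<Rightarrow> 'm \<Rightarrow> 'm list \<Rightarrow> (nat \<Rightarrow> 'm) \<Rightarrow> bool" where
  "test_point n w u \<beta> [] x \<longleftrightarrow> (\<forall>i<n. x i = w i) \<or> (\<forall>i<n. x i = w i + \<beta> * u i)"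
| "test_point n w u \<beta> (a # as) x \<longleftrightarrow> (\<exists>c y. c\<^sup>2 = \<beta> * c + a \<and> test_point n w u \<beta> as y \<and>
     (\<forall>i < n * 2 ^ length as. x i = y i + c * u i \<and> x (i + n * 2 ^ length as) = u i))"

text \<open>\<open>\<beta>\<close> is the coefficient b(w, u) / q(u) of the reflection. By
  \<open>u_supp\<close> the vector \<open>u\<close> lies in the first copy of \<open>Q\<close>
  inside every \<open>pfister_map\<close>, so that one and the same \<open>u\<close> is used at all
  levels.\<close>

locale reflected_zero = quadratic_map n Q for n and Q :: "(nat \<Rightarrow> 'm::field) \<Rightarrow> 'm" +
  fixes w u :: "nat \<Rightarrow> 'm" and \<beta> :: 'm
  assumes two: "(2::'m) = 0"
    and u_supp: "\<And>i. n \<le> i \<Longrightarrow> u i = 0"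
    and w_zero: "Q w = 0" and u_nonzero: "Q u \<noteq> 0"
    and \<beta>: "\<beta> * Q u = polar Q w u"
begin

lemma shift_u: "(\<lambda>i. u (i + n * 2 ^ k)) = (\<lambda>_. 0)"
proof
  fix i have "n * 1 \<le> n * 2 ^ k" by (rule mult_le_mono2) simp
  then show "u (i + n * 2 ^ k) = 0" by (intro u_supp) linarith
qed

lemma pfister_map_zero: "pfister_map as n Q (\<lambda>_. 0) = 0"
  using quadratic_map.zero[OF quadratic_map_pfister_map[OF quadratic_map_axioms]] .

lemma pfister_map_u: "pfister_map as n Q u = Q u"
  by (induction as) (simp_all add: double_map_def shift_u pfister_map_zero)

lemma polar_pfister_map_u: "polar (pfister_map as n Q) x u = polar Q x u"
  by (induction as)
    (simp_all add: polar_double_map shift_u quadratic_map.polar_zero[OF quadratic_map_pfister_map[OF quadratic_map_axioms]])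

lemma polar_u_self: "polar Q u u = 0"
  by (simp add: polar_self two)

lemma polar_shift_u: "polar Q (\<lambda>i. x i + c * u i) u = polar Q x u"
  by (simp add: polar_add polar_scale polar_u_self)

text \<open>Adding multiples of \<open>u\<close> leaves the pairing with \<open>u\<close> unchanged,
  because b(u, u) = 2 q(u) = 0.\<close>

lemma test_point_polar: "test_point n w u \<beta> as x \<Longrightarrow> polar Q x u = \<beta> * Q u"
proof (induction as arbitrary: x)
  case Nil
  then have "polar Q x u = polar Q w u \<or> polar Q x u = polar Q (\<lambda>i. w i + \<beta> * u i) u"
    using polar_cong[of x w u u] polar_cong[of x "\<lambda>i. w i + \<beta> * u i" u u] by auto
  then show ?case by (auto simp: polar_shift_u \<beta>)
next
  case (Cons a as)
  then obtain c y where y: "test_point n w u \<beta> as y" "\<And>i. i < n * 2 ^ length as \<Longrightarrow> x i = y i + c * u i"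
    by auto
  have "n * 1 \<le> n * 2 ^ length as" by (rule mult_le_mono2) simp
  then have "x i = y i + c * u i" if "i < n" for i using y(2)[of i] that by linarith
  then have "polar Q x u = polar Q (\<lambda>i. y i + c * u i) u" by (intro polar_cong) auto
  then show ?case by (simp add: polar_shift_u Cons.IH y)
qed

text \<open>By \<open>test_point_polar\<close> the first half takes the value c^2 q(u) + c \<beta>
  q(u) = a q(u) in characteristic 2, which cancels against the value a q(u) of the second
  half.\<close>

lemma test_point_zero: "test_point n w u \<beta> as x \<Longrightarrow> pfister_map as n Q x = 0"
proof (induction as arbitrary: x)
  case Nil
  have "Q (\<lambda>i. w i + \<beta> * u i) = \<beta> * (\<beta> * Q u) + \<beta> * (\<beta> * Q u)"
    by (simp add: add scale polar_scale_right \<beta>[symmetric] w_zero power2_eq_square mult.assoc)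
  then show ?case using Nil cong[of x w] cong[of x "\<lambda>i. w i + \<beta> * u i"] two w_zero by auto
next
  case (Cons a as)
  let ?P = "pfister_map as n Q"
  interpret P: quadratic_map "n * 2 ^ length as" ?P
    by (rule quadratic_map_pfister_map[OF quadratic_map_axioms])
  from Cons obtain c y where c: "c\<^sup>2 = \<beta> * c + a" and y: "test_point n w u \<beta> as y"
    and x: "\<And>i. i < n * 2 ^ length as \<Longrightarrow> x i = y i + c * u i"
      "\<And>i. i < n * 2 ^ length as \<Longrightarrow> x (i + n * 2 ^ length as) = u i"
    by auto
  have "?P x = ?P (\<lambda>i. y i + c * u i)" by (rule P.cong) (rule x)
  also have "\<dots> = c\<^sup>2 * Q u + c * (\<beta> * Q u)"
    by (simp add: P.add P.scale P.polar_scale_right polar_pfister_map_u pfister_map_u Cons.IH[OF y] test_point_polar[OF y])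
  also have "\<dots> = a * Q u + (\<beta> * c * Q u + \<beta> * c * Q u)" unfolding c by (simp add: algebra_simps)
  finally have "?P x = a * Q u" by (simp add: two)
  moreover have "?P (\<lambda>i. x (i + n * 2 ^ length as)) = Q u"
    using P.cong[of "\<lambda>i. x (i + n * 2 ^ length as)" u] x(2) pfister_map_u by simp
  ultimately show ?case using two by (simp add: double_map_def)
qed

text \<open>Only the first half moves, because \<open>u\<close> is zero in the second. This absorbs
  the ambiguity in \<open>specialization_extend\<close>, where the new element may go to the other
  root.\<close>

lemma test_point_reflect:
  "test_point n w u \<beta> as x \<Longrightarrow> test_point n w u \<beta> as (\<lambda>i. x i + \<beta> * u i)"
proof (induction as arbitrary: x)
  case Nil
  have "w i + \<beta> * u i + \<beta> * u i = w i" for i by (simp add: add.assoc two)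
  then show ?case using Nil by auto
next
  case (Cons a as)
  let ?H = "n * 2 ^ length as"
  from Cons obtain c y where c: "c\<^sup>2 = \<beta> * c + a" and y: "test_point n w u \<beta> as y"
    and x: "\<And>i. i < ?H \<Longrightarrow> x i = y i + c * u i" "\<And>i. i < ?H \<Longrightarrow> x (i + ?H) = u i"
    by auto
  have "x i + \<beta> * u i = (y i + \<beta> * u i) + c * u i \<and> x (i + ?H) + \<beta> * u (i + ?H) = u i" if "i < ?H" for i
    using x[OF that] fun_cong[OF shift_u] by simp
  with c Cons.IH[OF y] show ?case by (simp only: test_point.simps) blast
qed

text \<open>The clause about coordinate 0 keeps the test point in the chart where the first
  coordinate is 1; only there can a generic zero be specialized to it by evaluating
  polynomials.\<close>

lemma test_point_exists:
  assumes "\<And>a. a \<in> set as \<Longrightarrow> \<exists>c. c\<^sup>2 = \<beta> * c + a"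
  shows "\<exists>x. test_point n w u \<beta> as x \<and> (0 < n \<longrightarrow> u 0 = 0 \<longrightarrow> x 0 = w 0)"
  using assms
proof (induction as)
  case Nil
  show ?case by (rule exI[of _ w]) simp
next
  case (Cons a as)
  let ?H = "n * 2 ^ length as"
  obtain y where y: "test_point n w u \<beta> as y" "0 < n \<longrightarrow> u 0 = 0 \<longrightarrow> y 0 = w 0" using Cons by auto
  obtain c where c: "c\<^sup>2 = \<beta> * c + a" using Cons.prems by auto
  show ?case
    by (rule exI[of _ "\<lambda>i. if i < ?H then y i + c * u i else u (i - ?H)"]) (use y c in auto)
qed

end

text \<open>The tower is dictated by the zero \<open>\<xi>\<close> of the product with
  \<open>Q\<close>, while the families belong to \<open>P\<close>; in the application
  \<open>Q\<close> is \<psi> and \<open>P\<close> is \<phi>. The induction passes from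
  \<open>S\<close>, \<open>\<rho>\<close>, \<open>\<xi>\<close> to a quadratic extension, an
  extended specialization and a zero with one slot less. On the way back it transfers the family
  that \<open>base\<close> supplies at the top.\<close>

lemma isotropic_family_tower:
  fixes \<eta> :: "'a::field \<Rightarrow> 'o::alg_closed_field" and \<theta> :: "'a \<Rightarrow> 'm::field"
  assumes hom: "field_hom \<eta>" "field_hom \<theta>" and two: "(2::'o) = 0"
    and "reflected_zero n Q' w u \<beta>" and Q: "quadratic_map n Q" and P: "quadratic_map m P"
    and Q_spec: "\<And>\<rho> x x'. specialization \<eta> \<theta> \<rho> \<Longrightarrow> (\<And>i. i < n \<Longrightarrow> (x i, x' i) \<in> \<rho>) \<Longrightarrow> (Q x, Q' x') \<in> \<rho>"
    and Q_S: "\<And>S x. subfield_set S \<Longrightarrow> range \<eta> \<subseteq> S \<Longrightarrow> (\<And>i. i < n \<Longrightarrow> x i \<in> S) \<Longrightarrow> Q x \<in> S"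
    and P_S: "\<And>S x. subfield_set S \<Longrightarrow> range \<eta> \<subseteq> S \<Longrightarrow> (\<And>i. i < m \<Longrightarrow> x i \<in> S) \<Longrightarrow> P x \<in> S"
    and base: "\<And>S \<rho> z x. subfield_set S \<Longrightarrow> range \<eta> \<subseteq> S \<Longrightarrow> specialization \<eta> \<theta> \<rho> \<Longrightarrow>
      (\<And>i. i < n \<Longrightarrow> z i \<in> S \<and> (z i, x i) \<in> \<rho>) \<Longrightarrow> Q z = 0 \<Longrightarrow> test_point n w u \<beta> [] x \<Longrightarrow>
      isotropic_family S m P rad d"
    and S: "subfield_set S" "range \<eta> \<subseteq> S" and \<rho>: "specialization \<eta> \<theta> \<rho>"
    and \<xi>: "\<And>i. i < n * 2 ^ length as \<Longrightarrow> \<xi> i \<in> S \<and> (\<xi> i, x i) \<in> \<rho>"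
    and zero: "pfister_map (map \<eta> as) n Q \<xi> = 0" and test: "test_point n w u \<beta> (map \<theta> as) x"
  shows "isotropic_family S (m * 2 ^ length as) (pfister_map (map \<eta> as) m P) rad (d * 2 ^ length as)"
proof -
  interpret Q': reflected_zero n Q' w u \<beta> by fact
  show ?thesis
    using S \<rho> \<xi> zero test
  proof (induction as arbitrary: S \<rho> \<xi> x)
    case Nil
    then show ?case using base[of S \<rho> \<xi> x] by simp
  next
    case (Cons a as S \<rho> \<xi> x)
    note S = Cons.prems(1,2) and \<rho> = Cons.prems(3)
    define H where "H = n * 2 ^ length as"
    define Y where "Y = (\<lambda>i. \<xi> (i + H))"
    let ?q = "pfister_map (map \<eta> as) n Q" and ?q' = "pfister_map (map \<theta> as) n Q'"
    let ?p = "pfister_map (map \<eta> as) m P"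
    interpret q: quadratic_map H ?q
      unfolding H_def using quadratic_map_pfister_map[OF Q, of "map \<eta> as"] by simp
    have q': "quadratic_map H ?q'"
      unfolding H_def using quadratic_map_pfister_map[OF Q'.quadratic_map_axioms, of "map \<theta> as"] by simp
    have p: "quadratic_map (m * 2 ^ length as) ?p"
      using quadratic_map_pfister_map[OF P, of "map \<eta> as"] by simp
    have \<xi>S: "\<xi> i \<in> S" "Y i \<in> S" and \<xi>\<rho>: "(\<xi> i, x i) \<in> \<rho>" "(Y i, x (i + H)) \<in> \<rho>" if "i < H" for i
      using Cons.prems(4)[of i] Cons.prems(4)[of "i + H"] that by (simp_all add: H_def Y_def)
    from Cons.prems(6) obtain c y where c: "c\<^sup>2 = \<beta> * c + \<theta> a"
      and y: "test_point n w u \<beta> (map \<theta> as) y"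
      and x: "\<And>i. i < H \<Longrightarrow> x i = y i + c * u i" "\<And>i. i < H \<Longrightarrow> x (i + H) = u i"
      by (auto simp: H_def)
    have \<xi>y: "(\<xi> i, y i + c * u i) \<in> \<rho>" and Yu: "(Y i, u i) \<in> \<rho>" if "i < H" for i
      using \<xi>\<rho>[OF that] x[OF that] by simp_all
    have q_spec: "(?q v, ?q' v') \<in> \<rho>" if "\<And>i. i < H \<Longrightarrow> (v i, v' i) \<in> \<rho>" for v v'
      by (rule pfister_map_specialization[OF \<rho> Q_spec[OF \<rho>]]) (use that in \<open>simp_all add: H_def\<close>)
    have qS: "?q v \<in> S" if "\<And>i. i < H \<Longrightarrow> v i \<in> S" for v
      by (rule pfister_map_in_subfield[OF S(1) Q_S[OF S]]) (use that S in \<open>auto simp: H_def\<close>)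
    \<comment> \<open>\<open>Y\<close> specializes to \<open>u\<close>, so \<open>?q Y\<close> has
      the nonzero image \<open>Q' u\<close>. This permits the division in \<open>\<gamma>\<close>
      and gives \<open>\<gamma>\<close> the image \<open>\<beta>\<close>.\<close>
    have qY: "(?q Y, Q' u) \<in> \<rho>" using q_spec[of Y u] Yu by (simp add: Q'.pfister_map_u)
    then have qY0: "?q Y \<noteq> 0" using specializationD(5)[OF \<rho>] Q'.u_nonzero by metis
    have "(polar ?q \<xi> Y, polar ?q' (\<lambda>i. y i + c * u i) u) \<in> \<rho>"
      by (rule polar_specialization[OF hom \<rho> q_spec]) (use \<xi>y Yu in auto)
    then have qb: "(polar ?q \<xi> Y, \<beta> * Q' u) \<in> \<rho>"
      by (simp add: Q'.polar_pfister_map_u Q'.polar_shift_u Q'.test_point_polar[OF y])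
    define \<gamma> where "\<gamma> = polar ?q \<xi> Y / ?q Y"
    have \<gamma>\<rho>: "(\<gamma>, \<beta>) \<in> \<rho>"
      using specialization_divide[OF \<rho> qb qY Q'.u_nonzero] Q'.u_nonzero by (simp add: \<gamma>_def)
    have \<gamma>S: "\<gamma> \<in> S"
      unfolding \<gamma>_def polar_def using \<xi>S by (intro subfield_setD[OF S(1)] qS) auto
    have aS: "\<eta> a \<in> S" using S by auto
    obtain t where t: "t\<^sup>2 = \<gamma> * t + \<eta> a"
    proof -
      have "\<exists>t. poly [:- \<eta> a, - \<gamma>, 1:] t = 0"
        by (rule alg_closed_imp_poly_has_root) simp
      then obtain t where "- \<eta> a + t * (- \<gamma> + t) = 0" by auto
      then have "t\<^sup>2 = \<gamma> * t + \<eta> a" by (simp add: power2_eq_square algebra_simps)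
      then show ?thesis using that by blast
    qed
    obtain c' \<rho>' where c': "c' = c \<or> c' = \<beta> - c" and \<rho>': "specialization \<eta> \<theta> \<rho>'" "\<rho> \<subseteq> \<rho>'" "(t, c') \<in> \<rho>'"
      using specialization_extend[OF hom \<rho> \<gamma>\<rho> specializationD(1)[OF \<rho>] t c] by blast
    define E where "E = {e + f * t |e f. e \<in> S \<and> f \<in> S}"
    have E: "subfield_set E"
      unfolding E_def by (rule subfield_set_quadratic_extension[OF S(1) t \<gamma>S aS])
    have EI: "e + f * t \<in> E" if "e \<in> S" "f \<in> S" for e f using that E_def by blast
    have SE: "S \<subseteq> E"
    proof
      fix e assume "e \<in> S"
      then show "e \<in> E" using EI[of e 0] subfield_setD(1)[OF S(1)] by simp
    qed
    define z where "z = (\<lambda>i. \<xi> i + t * Y i)"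
    \<comment> \<open>The image of \<open>z\<close>. For \<open>c' = c\<close> it is
      \<open>y\<close>, as 2 c = 0; for \<open>c' = \<beta> - c\<close> it is y + \<beta> u. Both
      are test points for the remaining slots.\<close>
    define x' where "x' = (\<lambda>i. y i + c * u i + c' * u i)"
    have "test_point n w u \<beta> (map \<theta> as) x'"
    proof -
      have cu: "c * u i + c * u i = 0" for i by (simp add: Q'.two)
      have "x' = y \<or> x' = (\<lambda>i. y i + \<beta> * u i)"
        using c' cu by (auto simp: x'_def fun_eq_iff algebra_simps)
      then show ?thesis using y Q'.test_point_reflect[OF y] by auto
    qed
    moreover have "?q z = 0"
    proof -
      have "?q z = ?q \<xi> + t * polar ?q \<xi> Y + t\<^sup>2 * ?q Y"
        by (simp add: z_def q.add q.scale q.polar_scale_right)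
      also have "polar ?q \<xi> Y = \<gamma> * ?q Y" using qY0 by (simp add: \<gamma>_def)
      also have "?q \<xi> + t * (\<gamma> * ?q Y) + t\<^sup>2 * ?q Y
          = (?q \<xi> + \<eta> a * ?q Y) + (t * (\<gamma> * ?q Y) + t * (\<gamma> * ?q Y))"
        by (simp add: t algebra_simps)
      also have "\<dots> = 0" using Cons.prems(5) two by (simp add: double_map_def H_def Y_def)
      finally show ?thesis .
    qed
    moreover have "z i \<in> E \<and> (z i, x' i) \<in> \<rho>'" if "i < n * 2 ^ length as" for i
    proof -
      have i: "i < H" using that by (simp add: H_def)
      have "(\<xi> i + t * Y i, y i + c * u i + c' * u i) \<in> \<rho>'"
        using \<xi>y[OF i] Yu[OF i] \<rho>' by (intro specializationD(2,3)[OF \<rho>'(1)]) auto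
      moreover have "\<xi> i + Y i * t \<in> E" by (intro EI \<xi>S i)
      ultimately show ?thesis by (simp add: z_def x'_def mult.commute)
    qed
    ultimately have fam: "isotropic_family E (m * 2 ^ length as) ?p rad (d * 2 ^ length as)"
      using Cons.IH[OF E _ \<rho>'(1), of z x'] S(2) SE by blast
    have "isotropic_family S (2 * (m * 2 ^ length as)) (double_map (\<eta> a) (m * 2 ^ length as) ?p) rad (2 * (d * 2 ^ length as))"
    proof (cases "t \<in> S")
      case True
      have "E \<subseteq> S" unfolding E_def using True subfield_setD(4,7)[OF S(1)] by blast
      with SE have "E = S" by blast
      with fam isotropic_family_double_map[OF S(1) p] show ?thesis by metis
    next
      case False
      show ?thesis
      proof (rule isotropic_family_double_extension[OF S(1) p _ False t \<gamma>S aS fam[unfolded E_def]])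
        fix v :: "nat \<Rightarrow> 'o" assume "\<And>i. v i \<in> S"
        then show "?p v \<in> S" using S by (intro pfister_map_in_subfield[OF S(1) P_S[OF S]]) auto
      qed
    qed
    then show ?case by (simp add: mult.left_commute)
  qed
qed

section \<open>Isometries\<close>

lemma qf_eval_quad:
  assumes "A \<in> carrier_mat n n"
  shows "qf_eval A (vec n x) = quad A n x"
  using assms
  by (auto simp: qf_eval_def quad_def scalar_prod_def sum_distrib_left atLeast0LessThan algebra_simps
      intro!: sum.cong)

lemma qf_eval_quad':
  assumes "A \<in> carrier_mat n n" "v \<in> carrier_vec n"
  shows "qf_eval A v = quad A n (\<lambda>i. v $ i)"
proof -
  have "v = vec n (\<lambda>i. v $ i)" using assms(2) by auto
  then show ?thesis using qf_eval_quad[OF assms(1)] by metis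
qed

definition unit_fun :: "nat \<Rightarrow> nat \<Rightarrow> 'f::field" where
  "unit_fun j i = (if i = j then 1 else 0)"

text \<open>Linearity is required only of the coordinates below \<open>n\<close>, since the values
  beyond are arbitrary. Injectivity stands for invertibility, which it implies in dimension
  \<open>n\<close>.\<close>

definition linear_injective :: "nat \<Rightarrow> ((nat \<Rightarrow> 'f::field) \<Rightarrow> nat \<Rightarrow> 'f) \<Rightarrow> bool" where
  "linear_injective n f \<longleftrightarrow>
     (\<forall>x y i. i < n \<longrightarrow> f (\<lambda>i. x i + y i) i = f x i + f y i) \<and>
     (\<forall>c x i. i < n \<longrightarrow> f (\<lambda>i. c * x i) i = c * f x i) \<and>
     (\<forall>x y i. (\<forall>i<n. x i = y i) \<longrightarrow> i < n \<longrightarrow> f x i = f y i) \<and>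
     (\<forall>x i. (\<forall>i<n. f x i = 0) \<longrightarrow> i < n \<longrightarrow> x i = 0)"

lemma linear_injectiveD:
  assumes "linear_injective n f"
  shows "i < n \<Longrightarrow> f (\<lambda>i. x i + y i) i = f x i + f y i"
    and "i < n \<Longrightarrow> f (\<lambda>i. c * x i) i = c * f x i"
    and "(\<And>i. i < n \<Longrightarrow> x i = y i) \<Longrightarrow> i < n \<Longrightarrow> f x i = f y i"
    and "(\<And>i. i < n \<Longrightarrow> f x i = 0) \<Longrightarrow> i < n \<Longrightarrow> x i = 0"
  using assms unfolding linear_injective_def by blast+

lemma linear_injective_sum:
  assumes f: "linear_injective n f" and "i < n"
  shows "f (\<lambda>i. \<Sum>j\<in>J. c j * v j i) i = (\<Sum>j\<in>J. c j * f (v j) i)"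
proof -
  have z: "f (\<lambda>_. 0) i = 0" using linear_injectiveD(2)[OF f \<open>i < n\<close>, of 0 "\<lambda>_. 0"] by simp
  show ?thesis
    by (induction J rule: infinite_finite_induct)
      (simp_all add: z linear_injectiveD(1,2)[OF f \<open>i < n\<close>])
qed

lemma linear_injective_expand:
  assumes f: "linear_injective n f" and i: "i < n"
  shows "f x i = (\<Sum>j<n. x j * f (unit_fun j) i)"
proof -
  have "f x i = f (\<lambda>i. \<Sum>j<n. x j * unit_fun j i) i"
    by (rule linear_injectiveD(3)[OF f _ i]) (simp add: unit_fun_def if_distrib cong: if_cong)
  then show ?thesis by (simp add: linear_injective_sum[OF f i])
qed

text \<open>The matrix with columns \<open>f (unit_fun j)\<close> has trivial kernel by injectivity,
  hence nonzero determinant.\<close>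

lemma isometricI:
  assumes A: "A \<in> carrier_mat n n" and B: "B \<in> carrier_mat n n" and f: "linear_injective n f"
    and AB: "\<And>x. quad A n (f x) = quad B n x"
  shows "A \<cong>\<^sub>q B"
proof -
  define P where "P = mat n n (\<lambda>(i, j). f (unit_fun j) i)"
  have P: "P \<in> carrier_mat n n" by (simp add: P_def)
  have Pf: "(P *\<^sub>v v) $ i = f (\<lambda>i. v $ i) i" if v: "v \<in> carrier_vec n" and i: "i < n" for v i
    using v i
    by (subst linear_injective_expand[OF f i])
      (simp add: P_def scalar_prod_def atLeast0LessThan mult.commute)
  have "det P \<noteq> 0"
  proof
    assume "det P = 0"
    then obtain v where v: "v \<in> carrier_vec n" "v \<noteq> 0\<^sub>v n" "P *\<^sub>v v = 0\<^sub>v n"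
      using det_0_iff_vec_prod_zero_field[OF P] by blast
    have "v $ i = 0" if "i < n" for i
    proof (rule linear_injectiveD(4)[OF f _ that])
      fix i assume "i < n"
      then show "f (($) v) i = 0" using Pf[OF v(1)] v(3) by simp
    qed
    with v show False by (auto simp: vec_eq_iff)
  qed
  from det_non_zero_imp_unit[OF P this, of "()"]
  obtain P' where P': "P' \<in> carrier_mat n n" "P' * P = 1\<^sub>m n" "P * P' = 1\<^sub>m n"
    unfolding Units_def by (auto simp: ring_mat_def)
  then have "invertible_mat P" using P unfolding invertible_mat_def inverts_mat_def square_mat.simps
    by (metis carrier_matD)
  moreover have "qf_eval A (P *\<^sub>v v) = qf_eval B v" if v: "v \<in> carrier_vec n" for v
  proof -
    have "qf_eval A (P *\<^sub>v v) = quad A n (\<lambda>i. (P *\<^sub>v v) $ i)" using A P v by (intro qf_eval_quad') auto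
    also have "\<dots> = quad A n (f (\<lambda>i. v $ i))"
      by (rule quadratic_map.cong[OF quadratic_map_quad]) (rule Pf[OF v])
    also have "\<dots> = qf_eval B v" unfolding AB using B v by (simp add: qf_eval_quad')
    finally show ?thesis .
  qed
  ultimately show ?thesis unfolding isometric_def using A B P by blast
qed

definition mat_fun :: "'f::field mat \<Rightarrow> nat \<Rightarrow> (nat \<Rightarrow> 'f) \<Rightarrow> nat \<Rightarrow> 'f" where
  "mat_fun P n x i = (\<Sum>j<n. P $$ (i, j) * x j)"

lemma mat_fun_mult:
  assumes "P \<in> carrier_mat n n" "R \<in> carrier_mat n n" "i < n"
  shows "mat_fun P n (mat_fun R n x) i = mat_fun (P * R) n x i"
proof -
  have "mat_fun P n (mat_fun R n x) i = (\<Sum>j<n. \<Sum>k<n. P $$ (i, j) * R $$ (j, k) * x k)"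
    by (simp add: mat_fun_def sum_distrib_left mult.assoc)
  also have "\<dots> = (\<Sum>k<n. \<Sum>j<n. P $$ (i, j) * R $$ (j, k) * x k)" by (rule sum.swap)
  also have "\<dots> = mat_fun (P * R) n x i"
    using assms by (simp add: mat_fun_def scalar_prod_def atLeast0LessThan sum_distrib_right)
  finally show ?thesis .
qed

lemma mat_fun_one: "i < n \<Longrightarrow> mat_fun (1\<^sub>m n) n x i = x i"
proof -
  assume i: "i < n"
  have "mat_fun (1\<^sub>m n) n x i = (\<Sum>j<n. if i = j then x j else 0)"
    unfolding mat_fun_def using i by (intro sum.cong) auto
  then show ?thesis using i by simp
qed

lemma isometricE:
  assumes "A \<cong>\<^sub>q B"
  obtains n P R where "A \<in> carrier_mat n n" "B \<in> carrier_mat n n" "P \<in> carrier_mat n n" "R \<in> carrier_mat n n"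
    "P * R = 1\<^sub>m n" "R * P = 1\<^sub>m n" "\<And>x. quad A n (mat_fun P n x) = quad B n x"
proof -
  from assms obtain n P where A: "A \<in> carrier_mat n n" and B: "B \<in> carrier_mat n n" and P: "P \<in> carrier_mat n n"
    and inv: "invertible_mat P" and eq: "\<And>v. v \<in> carrier_vec n \<Longrightarrow> qf_eval A (P *\<^sub>v v) = qf_eval B v"
    unfolding isometric_def by blast
  from inv obtain R where R: "P * R = 1\<^sub>m n" "R * P = 1\<^sub>m (dim_row R)"
    using P unfolding invertible_mat_def inverts_mat_def by auto
  have "dim_col R = n" using R(1) by (metis index_mult_mat(3) index_one_mat(3))
  moreover have "dim_row R = n" using R(2) P by (metis index_mult_mat(3) index_one_mat(3) carrier_matD(2))
  ultimately have Rc: "R \<in> carrier_mat n n" by auto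
  have "quad A n (mat_fun P n x) = quad B n x" for x
  proof -
    have "quad A n (mat_fun P n x) = quad A n (\<lambda>i. (P *\<^sub>v vec n x) $ i)"
      using P by (intro quadratic_map.cong[OF quadratic_map_quad])
        (auto simp: mat_fun_def scalar_prod_def atLeast0LessThan)
    also have "\<dots> = qf_eval A (P *\<^sub>v vec n x)" using A P by (intro qf_eval_quad'[symmetric]) auto
    also have "\<dots> = qf_eval B (vec n x)" by (rule eq) simp
    finally show ?thesis by (simp add: qf_eval_quad[OF B])
  qed
  with A B P Rc R show ?thesis using that \<open>dim_row R = n\<close> by metis
qed

lemma linear_injective_mat_fun:
  assumes "P \<in> carrier_mat n n" "R \<in> carrier_mat n n" "R * P = 1\<^sub>m n"
  shows "linear_injective n (mat_fun P n)"
  unfolding linear_injective_def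
proof (intro conjI allI impI)
  fix x i assume "\<forall>i<n. mat_fun P n x i = 0" "i < n"
  then have "mat_fun R n (mat_fun P n x) i = 0" unfolding mat_fun_def[of R] by simp
  then show "x i = 0" using mat_fun_mult[OF assms(2,1) \<open>i < n\<close>] assms(3) mat_fun_one[OF \<open>i < n\<close>] by metis
qed (simp_all add: mat_fun_def sum.distrib sum_distrib_left algebra_simps)

lemma linear_injective_comp:
  fixes f g :: "(nat \<Rightarrow> 'a::field) \<Rightarrow> nat \<Rightarrow> 'a"
  assumes f: "linear_injective n f" and g: "linear_injective n g"
  shows "linear_injective n (\<lambda>x. f (g x))"
  unfolding linear_injective_def
proof (intro conjI allI impI)
  note F = linear_injectiveD[OF f] and G = linear_injectiveD[OF g]
  fix x y :: "nat \<Rightarrow> 'a" and i assume i: "i < n"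
  have "f (g (\<lambda>i. x i + y i)) i = f (\<lambda>i. g x i + g y i) i" by (rule F(3)[OF _ i]) (rule G(1))
  then show "f (g (\<lambda>i. x i + y i)) i = f (g x) i + f (g y) i" by (simp add: F(1)[OF i])
next
  note F = linear_injectiveD[OF f] and G = linear_injectiveD[OF g]
  fix x :: "nat \<Rightarrow> 'a" and c i assume i: "i < n"
  have "f (g (\<lambda>i. c * x i)) i = f (\<lambda>i. c * g x i) i" by (rule F(3)[OF _ i]) (rule G(2))
  then show "f (g (\<lambda>i. c * x i)) i = c * f (g x) i" by (simp add: F(2)[OF i])
next
  note F = linear_injectiveD[OF f] and G = linear_injectiveD[OF g]
  fix x y :: "nat \<Rightarrow> 'a" and i assume "\<forall>i<n. x i = y i" and i: "i < n"
  then show "f (g x) i = f (g y) i" by (intro F(3)[OF _ i] G(3)) auto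
next
  note F = linear_injectiveD[OF f] and G = linear_injectiveD[OF g]
  fix x :: "nat \<Rightarrow> 'a" and i assume "\<forall>i<n. f (g x) i = 0" and i: "i < n"
  then have "g x k = 0" if "k < n" for k using F(4)[of "g x" k] that by blast
  then show "x i = 0" using G(4)[of x i] i by blast
qed

text \<open>Both directions are kept, because families are pushed along one map while the vectors
  they are tested against are pulled back along the other.\<close>

definition isometry_pair ::
    "nat \<Rightarrow> 'f::field mat \<Rightarrow> 'f mat \<Rightarrow> ((nat \<Rightarrow> 'f) \<Rightarrow> nat \<Rightarrow> 'f) \<Rightarrow> ((nat \<Rightarrow> 'f) \<Rightarrow> nat \<Rightarrow> 'f) \<Rightarrow> bool" where
  "isometry_pair n A B f g \<longleftrightarrow> linear_injective n f \<and> linear_injective n g \<and>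
     (\<forall>x. \<forall>i<n. f (g x) i = x i) \<and> (\<forall>x. \<forall>i<n. g (f x) i = x i) \<and> (\<forall>x. quad A n (f x) = quad B n x)"

lemma isometry_pairD:
  assumes "isometry_pair n A B f g"
  shows "linear_injective n f" "linear_injective n g"
    and "i < n \<Longrightarrow> f (g x) i = x i" "i < n \<Longrightarrow> g (f x) i = x i"
    and "quad A n (f x) = quad B n x" "quad B n (g x) = quad A n x"
    and "polar (quad A n) (f x) y = polar (quad B n) x (g y)"
    and "polar (quad B n) (g x) y = polar (quad A n) x (f y)"
proof -
  note cong = quadratic_map.cong[OF quadratic_map_quad]
  show f: "linear_injective n f" and g: "linear_injective n g"
    and fg: "i < n \<Longrightarrow> f (g x) i = x i" and gf: "i < n \<Longrightarrow> g (f x) i = x i"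
    and AB: "quad A n (f x) = quad B n x" for i x
    using assms unfolding isometry_pair_def by simp_all
  show BA: "quad B n (g x) = quad A n x" for x
    unfolding AB[symmetric] by (rule cong) (rule fg)
  have "quad A n (\<lambda>i. f x i + y i) = quad B n (\<lambda>i. x i + g y i)"
    unfolding BA[symmetric] by (rule cong) (simp add: linear_injectiveD(1)[OF g] gf)
  then show "polar (quad A n) (f x) y = polar (quad B n) x (g y)" by (simp add: polar_def AB BA)
  have "quad B n (\<lambda>i. g x i + y i) = quad A n (\<lambda>i. x i + f y i)"
    unfolding AB[symmetric] by (rule cong) (simp add: linear_injectiveD(1)[OF f] fg)
  then show "polar (quad B n) (g x) y = polar (quad A n) x (f y)" by (simp add: polar_def AB BA)
qed

lemma isometric_maps:
  fixes A B :: "'f::field mat"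
  assumes iso: "A \<cong>\<^sub>q B" and A: "A \<in> carrier_mat n n"
  obtains f g where "B \<in> carrier_mat n n" "isometry_pair n A B f g"
proof -
  obtain k P R where kA: "A \<in> carrier_mat k k" and *: "B \<in> carrier_mat k k" "P \<in> carrier_mat k k" "R \<in> carrier_mat k k"
    "P * R = 1\<^sub>m k" "R * P = 1\<^sub>m k" "\<And>x. quad A k (mat_fun P k x) = quad B k x"
    using isometricE[OF iso] by blast
  have "k = n" using A kA by auto
  note * = *[unfolded this]
  have "isometry_pair n A B (mat_fun P n) (mat_fun R n)"
    unfolding isometry_pair_def using linear_injective_mat_fun[OF *(2,3,5)] linear_injective_mat_fun[OF *(3,2,4)]
    by (simp add: mat_fun_mult[OF *(2,3)] mat_fun_mult[OF *(3,2)] * mat_fun_one)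
  with *(1) show ?thesis by (rule that)
qed

lemma isometric_refl:
  assumes "A \<in> carrier_mat n n"
  shows "A \<cong>\<^sub>q A"
  by (rule isometricI[OF assms assms, of "\<lambda>x. x"]) (simp_all add: linear_injective_def)

lemma isometric_trans:
  assumes AB: "A \<cong>\<^sub>q B" and BC: "B \<cong>\<^sub>q C"
  shows "A \<cong>\<^sub>q C"
proof -
  obtain n where A: "A \<in> carrier_mat n n" using AB unfolding isometric_def by blast
  obtain f f' where B: "B \<in> carrier_mat n n" and "isometry_pair n A B f f'"
    using isometric_maps[OF AB A] by blast
  note f = isometry_pairD[OF this(2)]
  obtain g g' where C: "C \<in> carrier_mat n n" and "isometry_pair n B C g g'"
    using isometric_maps[OF BC B] by blast
  note g = isometry_pairD[OF this(2)]
  show ?thesis by (rule isometricI[OF A C linear_injective_comp[OF f(1) g(1)]]) (simp add: f(5) g(5))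
qed

lemma quad_four_block:
  assumes "A \<in> carrier_mat a a" "B \<in> carrier_mat b b"
  shows "quad (four_block_mat A (0\<^sub>m a b) (0\<^sub>m b a) B) (a + b) x = quad A a x + quad B b (\<lambda>i. x (i + a))"
  using assms unfolding quad_def sum_lessThan_add by (simp add: sum.distrib)

lemma isometric_four_block:
  fixes A A' B B' :: "'a::field mat"
  assumes AA: "A \<cong>\<^sub>q A'" and BB: "B \<cong>\<^sub>q B'"
    and A: "A \<in> carrier_mat a a" and B: "B \<in> carrier_mat b b"
  shows "four_block_mat A (0\<^sub>m a b) (0\<^sub>m b a) B \<cong>\<^sub>q four_block_mat A' (0\<^sub>m a b) (0\<^sub>m b a) B'"
proof -
  obtain g g' where A': "A' \<in> carrier_mat a a" and "isometry_pair a A A' g g'"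
    using isometric_maps[OF AA A] by blast
  note g = isometry_pairD[OF this(2)]
  obtain h h' where B': "B' \<in> carrier_mat b b" and "isometry_pair b B B' h h'"
    using isometric_maps[OF BB B] by blast
  note h = isometry_pairD[OF this(2)]
  note G = linear_injectiveD[OF g(1)] and H = linear_injectiveD[OF h(1)]
  define f where "f x i = (if i < a then g x i else h (\<lambda>i. x (i + a)) (i - a))" for x :: "nat \<Rightarrow> 'a" and i
  have f: "linear_injective (a + b) f"
    unfolding linear_injective_def
  proof (intro conjI allI impI)
    fix x y :: "nat \<Rightarrow> 'a" and i assume "i < a + b"
    then show "f (\<lambda>i. x i + y i) i = f x i + f y i"
      using G(1)[of i x y] H(1)[of "i - a" "\<lambda>i. x (i + a)" "\<lambda>i. y (i + a)"] by (auto simp: f_def)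
  next
    fix x :: "nat \<Rightarrow> 'a" and c i assume "i < a + b"
    then show "f (\<lambda>i. c * x i) i = c * f x i"
      using G(2)[of i c x] H(2)[of "i - a" c "\<lambda>i. x (i + a)"] by (auto simp: f_def)
  next
    fix x y :: "nat \<Rightarrow> 'a" and i assume "\<forall>i<a + b. x i = y i" "i < a + b"
    then show "f x i = f y i"
      using G(3)[of x y i] H(3)[of "\<lambda>i. x (i + a)" "\<lambda>i. y (i + a)" "i - a"] by (auto simp: f_def)
  next
    fix x :: "nat \<Rightarrow> 'a" and i assume *: "\<forall>i<a + b. f x i = 0" and i: "i < a + b"
    show "x i = 0"
    proof (cases "i < a")
      case True
      have "g x k = 0" if "k < a" for k using *[rule_format, of k] that by (simp add: f_def)
      then show ?thesis using G(4)[of x i] True by blast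
    next
      case False
      have "h (\<lambda>i. x (i + a)) k = 0" if "k < b" for k using *[rule_format, of "k + a"] that by (simp add: f_def)
      then show ?thesis using H(4)[of "\<lambda>i. x (i + a)" "i - a"] False i by auto
    qed
  qed
  show ?thesis
  proof (rule isometricI[OF _ _ f])
    fix x :: "nat \<Rightarrow> 'a"
    have "quad A a (f x) = quad A a (g x)" "quad B b (\<lambda>i. f x (i + a)) = quad B b (h (\<lambda>i. x (i + a)))"
      by (rule quadratic_map.cong[OF quadratic_map_quad]; simp add: f_def)+
    then show "quad (four_block_mat A (0\<^sub>m a b) (0\<^sub>m b a) B) (a + b) (f x)
        = quad (four_block_mat A' (0\<^sub>m a b) (0\<^sub>m b a) B') (a + b) x"
      by (simp only: quad_four_block[OF A B] quad_four_block[OF A' B'] g(5) h(5))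
  qed (use A A' B B' in auto)
qed

lemma quad_unary_form_zero: "quad (unary_form 0) (Suc 0) x = 0"
  by (simp add: quad_def unary_form_def mat_of_rows_list_def)

lemma unary_form_carrier: "unary_form c \<in> carrier_mat 1 1"
  by (simp add: unary_form_def mat_of_rows_list_def)

lemma hyperbolic_plane_carrier: "hyperbolic_plane \<in> carrier_mat 2 2"
  by (simp add: hyperbolic_plane_def binary_form_def mat_of_rows_list_def numeral_2_eq_2)

lemma quad_hyperbolic_plane: "quad hyperbolic_plane 2 x = x 0 * x 1"
  by (simp add: quad_def hyperbolic_plane_def binary_form_def mat_of_rows_list_def numeral_2_eq_2)

section \<open>Witt decomposition\<close>

definition independent_family :: "nat \<Rightarrow> nat \<Rightarrow> (nat \<Rightarrow> nat \<Rightarrow> 'f::field) \<Rightarrow> bool" where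
  "independent_family M d V \<longleftrightarrow> (\<forall>c. (\<forall>i<M. (\<Sum>k<d. c k * V k i) = 0) \<longrightarrow> (\<forall>k<d. c k = 0))"

lemma independent_familyD:
  "independent_family M d V \<Longrightarrow> (\<And>i. i < M \<Longrightarrow> (\<Sum>k<d. c k * V k i) = 0) \<Longrightarrow> k < d \<Longrightarrow> c k = 0"
  unfolding independent_family_def by blast

text \<open>One step of Gaussian elimination at coordinate \<open>i0\<close>: if it vanishes on the
  family, the last vector is dropped, otherwise multiples of a pivot are subtracted. The
  coefficients \<open>b\<close> record that the new vectors stay in the span.\<close>

lemma independent_family_eliminate:
  assumes V: "independent_family M (Suc d) V"
  obtains W b where "independent_family M d W" "\<And>k. k < d \<Longrightarrow> W k i0 = 0"
    "\<And>k i. k < d \<Longrightarrow> W k i = (\<Sum>l<Suc d. b k l * V l i)"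
proof (cases "\<forall>k<Suc d. V k i0 = 0")
  case True
  show ?thesis
  proof (rule that[of V unit_fun])
    show "independent_family M d V"
      unfolding independent_family_def
    proof (intro allI impI)
      fix c k assume z: "\<forall>i<M. (\<Sum>k<d. c k * V k i) = 0" and k: "k < d"
      define c' where "c' k = (if k < d then c k else 0)" for k
      have "(\<Sum>k<Suc d. c' k * V k i) = (\<Sum>k<d. c k * V k i)" for i by (simp add: c'_def)
      then have "c' k = 0" using independent_familyD[OF V, of c' k] z k by simp
      then show "c k = 0" using k by (simp add: c'_def)
    qed
    show "V k i0 = 0" if "k < d" for k using True that by simp
    show "V k i = (\<Sum>l<Suc d. unit_fun k l * V l i)" if "k < d" for k i
      using that by (simp add: unit_fun_def if_distribR if_distrib cong: if_cong)
  qed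
next
  case False
  then obtain p where p: "p < Suc d" "V p i0 \<noteq> 0" by blast
  \<comment> \<open>\<open>s\<close> enumerates the indices other than the pivot \<open>p\<close>,
    with the last index \<open>d\<close> standing in for \<open>p\<close>.\<close>
  define s where "s k = (if k = p then d else k)" for k
  define r where "r k = V (s k) i0 / V p i0" for k
  define W where "W k i = V (s k) i - r k * V p i" for k i
  have s: "s k < Suc d" "s k \<noteq> p" if "k < d" for k using that p by (auto simp: s_def)
  have s_inj: "inj_on s {..<d}" by (auto simp: inj_on_def s_def split: if_splits)
  have s_bij: "s ` {..<d} = {..<Suc d} - {p}"
  proof (rule card_subset_eq)
    show "s ` {..<d} \<subseteq> {..<Suc d} - {p}" using s by auto
    show "card (s ` {..<d}) = card ({..<Suc d} - {p})" using s_inj p by (simp add: card_image)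
  qed simp
  show ?thesis
  proof (rule that[of W "\<lambda>k l. unit_fun (s k) l - r k * unit_fun p l"])
    show "W k i0 = 0" for k using p by (simp add: W_def r_def)
    show "W k i = (\<Sum>l<Suc d. (unit_fun (s k) l - r k * unit_fun p l) * V l i)" if "k < d" for k i
    proof -
      have "(\<Sum>l<Suc d. unit_fun q l * V l i) = V q i" if "q < Suc d" for q
        using that by (simp add: unit_fun_def if_distribR if_distrib cong: if_cong del: sum.lessThan_Suc)
      then have u: "(\<Sum>l<Suc d. unit_fun (s k) l * V l i) = V (s k) i"
        "(\<Sum>l<Suc d. unit_fun p l * V l i) = V p i" using s[OF that] p by blast+
      have "(\<Sum>l<Suc d. (unit_fun (s k) l - r k * unit_fun p l) * V l i)
          = (\<Sum>l<Suc d. unit_fun (s k) l * V l i) - r k * (\<Sum>l<Suc d. unit_fun p l * V l i)"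
        by (simp add: left_diff_distrib sum_subtractf sum_distrib_left mult.assoc del: sum.lessThan_Suc)
      then show ?thesis unfolding u by (simp add: W_def)
    qed
    show "independent_family M d W"
      unfolding independent_family_def
    proof (intro allI impI)
      fix c k assume z: "\<forall>i<M. (\<Sum>k<d. c k * W k i) = 0" and k: "k < d"
      \<comment> \<open>The coefficient at the pivot collects everything that was subtracted, so
        that a relation among the \<open>W k\<close> becomes one among the
        \<open>V l\<close>.\<close>
      define c' where "c' l = (if l = p then - (\<Sum>k<d. c k * r k) else c (inv_into {..<d} s l))" for l
      have c's: "c' (s k) = c k" if "k < d" for k
        using that s inv_into_f_f[OF s_inj] by (simp add: c'_def)
      have "(\<Sum>l<Suc d. c' l * V l i) = (\<Sum>k<d. c k * W k i)" for i
      proof -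
        have "(\<Sum>l<Suc d. c' l * V l i) = c' p * V p i + (\<Sum>l\<in>{..<Suc d} - {p}. c' l * V l i)"
          using p by (subst sum.remove[of _ p]) auto
        also have "(\<Sum>l\<in>{..<Suc d} - {p}. c' l * V l i) = (\<Sum>k<d. c k * V (s k) i)"
          unfolding s_bij[symmetric] by (subst sum.reindex[OF s_inj]) (simp add: c's)
        also have "c' p * V p i = - (\<Sum>k<d. c k * (r k * V p i))"
          by (simp add: c'_def sum_distrib_right mult.assoc)
        finally show ?thesis by (simp add: W_def right_diff_distrib sum_subtractf)
      qed
      then have "c' (s k) = 0" using independent_familyD[OF V, of c' "s k"] z s(1)[OF k] by simp
      then show "c k = 0" using c's[OF k] by simp
    qed
  qed
qed

lemma independent_family_le:
  "independent_family M d V \<Longrightarrow> d \<le> M"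
proof (induction M arbitrary: d V)
  case 0
  show ?case
  proof (rule ccontr)
    assume "\<not> d \<le> 0"
    then show False using independent_familyD[OF 0, of "\<lambda>_. 1" 0] by simp
  qed
next
  case (Suc M)
  show ?case
  proof (cases d)
    case (Suc d')
    obtain W b where W: "independent_family (Suc M) d' W" "\<And>k. k < d' \<Longrightarrow> W k M = 0"
      and "\<And>k i. k < d' \<Longrightarrow> W k i = (\<Sum>l<Suc d'. b k l * V l i)"
      by (rule independent_family_eliminate[OF Suc.prems[unfolded Suc], where ?i0.0 = M]) (rule that)
    have "independent_family M d' W"
      unfolding independent_family_def
    proof (intro allI impI)
      fix c k assume z: "\<forall>i<M. (\<Sum>k<d'. c k * W k i) = 0" and k: "k < d'"
      show "c k = 0"
      proof (rule independent_familyD[OF W(1) _ k])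
        fix i assume "i < Suc M"
        then show "(\<Sum>k<d'. c k * W k i) = 0" using z W(2) by (cases "i = M") auto
      qed
    qed
    from Suc.IH[OF this] Suc show ?thesis by simp
  qed simp
qed

section \<open>Sums of hyperbolic planes and an anisotropic form\<close>

fun hyperbolic_sum :: "nat \<Rightarrow> ((nat \<Rightarrow> 'f::field) \<Rightarrow> 'f) \<Rightarrow> (nat \<Rightarrow> 'f) \<Rightarrow> 'f" where
  "hyperbolic_sum 0 R x = R x"
| "hyperbolic_sum (Suc i) R x = x 0 * x 1 + hyperbolic_sum i R (\<lambda>k. x (k + 2))"

text \<open>In \<open>hyperbolic_sum i R\<close> the first \<open>2 * i\<close> coordinates belong
  to the hyperbolic planes and the next \<open>r\<close> to \<open>R\<close>. As \<open>R\<close>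
  reads no more than \<open>r\<close> coordinates, any further ones form a summand on which the form
  is zero.\<close>

definition anisotropic_map :: "nat \<Rightarrow> ((nat \<Rightarrow> 'f::field) \<Rightarrow> 'f) \<Rightarrow> bool" where
  "anisotropic_map r R \<longleftrightarrow> (\<forall>x. R x = 0 \<longrightarrow> (\<forall>i<r. x i = 0)) \<and> (\<forall>x y. (\<forall>i<r. x i = y i) \<longrightarrow> R x = R y)"

lemma hyperbolic_sum_cong:
  assumes "anisotropic_map r R" "\<And>k. k < 2 * i + r \<Longrightarrow> x k = y k"
  shows "hyperbolic_sum i R x = hyperbolic_sum i R y"
  using assms(2)
proof (induction i arbitrary: x y)
  case 0 then show ?case using assms(1) by (simp add: anisotropic_map_def)
next
  case (Suc i)
  have "hyperbolic_sum i R (\<lambda>k. x (k + 2)) = hyperbolic_sum i R (\<lambda>k. y (k + 2))"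
    by (rule Suc.IH) (simp add: Suc.prems)
  then show ?case using Suc.prems[of 0] Suc.prems[of 1] by simp
qed

text \<open>The coordinates left free are one from each hyperbolic pair and those beyond
  \<open>R\<close>; they span a totally isotropic subspace.\<close>

lemma hyperbolic_sum_zero:
  assumes R: "anisotropic_map r R" and R0: "R (\<lambda>_. 0) = 0"
    and "\<And>k. k < i \<Longrightarrow> x (2 * k + 1) = 0" "\<And>k. k < r \<Longrightarrow> x (2 * i + k) = 0"
  shows "hyperbolic_sum i R x = 0"
  using assms(3,4)
proof (induction i arbitrary: x)
  case 0
  then have "\<forall>k<r. x k = 0" by simp
  then have "R x = R (\<lambda>_. 0)" using conjunct2[OF R[unfolded anisotropic_map_def], rule_format, of x "\<lambda>_. 0"] by simp
  then show ?case using R0 by simp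
next
  case (Suc i)
  have "hyperbolic_sum i R (\<lambda>k. x (k + 2)) = 0"
  proof (rule Suc.IH)
    show "x (2 * k + 1 + 2) = 0" if "k < i" for k using Suc.prems(1)[of "Suc k"] that by simp
    show "x (2 * i + k + 2) = 0" if "k < r" for k using Suc.prems(2)[of k] that by (simp add: algebra_simps)
  qed
  then show ?case using Suc.prems(1)[of 0] by simp
qed

lemma independent_family_shift:
  assumes V: "independent_family (M + s) d V" and z: "\<And>k i. k < d \<Longrightarrow> i < s \<Longrightarrow> V k i = 0"
  shows "independent_family M d (\<lambda>k i. V k (i + s))"
  unfolding independent_family_def
proof (intro allI impI)
  fix c k assume *: "\<forall>i<M. (\<Sum>k<d. c k * V k (i + s)) = 0" and k: "k < d"
  show "c k = 0"
  proof (rule independent_familyD[OF V _ k])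
    fix i assume "i < M + s"
    then show "(\<Sum>k<d. c k * V k i) = 0" using *[rule_format, of "i - s"] z by (cases "i < s") auto
  qed
qed

text \<open>
  Induction on \<open>i\<close>: cut the subspace with the hyperplane orthogonal to the first hyperbolic basis
  vector \<open>e\<close> and project along \<open>e\<close>. If the cut is proper, then \<open>e\<close> is not in the subspace, so one
  dimension at most is lost.
\<close>

lemma isotropic_subspace_le:
  assumes R: "anisotropic_map r R"
  shows "independent_family (2 * i + r + j) d V \<Longrightarrow>
    (\<And>c. hyperbolic_sum i R (\<lambda>i. \<Sum>k<d. c k * V k i) = 0) \<Longrightarrow> d \<le> i + j"
proof (induction i arbitrary: d V)
  case 0
  have "V k l = 0" if "k < d" "l < r" for k l
  proof -
    have "R (\<lambda>i. \<Sum>m<d. unit_fun k m * V m i) = 0" using 0(2)[of "unit_fun k"] by simp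
    moreover have "(\<lambda>i. \<Sum>m<d. unit_fun k m * V m i) = V k"
      using \<open>k < d\<close> by (simp add: fun_eq_iff unit_fun_def if_distribR if_distrib cong: if_cong)
    ultimately show ?thesis using R \<open>l < r\<close> unfolding anisotropic_map_def by metis
  qed
  then have "independent_family j d (\<lambda>k i. V k (i + r))"
    using 0(1) by (intro independent_family_shift) (simp_all add: add.commute)
  then show ?case using independent_family_le by fastforce
next
  case (Suc i)
  let ?N = "2 * i + r + j"
  show ?case
  proof (cases d)
    case (Suc d')
    have N: "2 * Suc i + r + j = ?N + 2" by simp
    define SP where "SP = range (\<lambda>c i. \<Sum>k<d. c k * V k i)"
    have spanQ: "Z 0 * Z 1 + hyperbolic_sum i R (\<lambda>k. Z (k + 2)) = 0" if "Z \<in> SP" for Z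
      using that Suc.prems(2) unfolding SP_def by auto
    have span_add: "(\<lambda>i. Z i + Y i) \<in> SP" if "Z \<in> SP" "Y \<in> SP" for Z Y
    proof -
      from that obtain c e where "Z = (\<lambda>i. \<Sum>k<d. c k * V k i)" "Y = (\<lambda>i. \<Sum>k<d. e k * V k i)"
        unfolding SP_def by blast
      then have "(\<lambda>i. Z i + Y i) = (\<lambda>i. \<Sum>k<d. (c k + e k) * V k i)"
        by (simp add: sum.distrib distrib_right)
      then show ?thesis unfolding SP_def by (rule range_eqI[where x = "\<lambda>k. c k + e k"])
    qed
    have spanV: "V k \<in> SP" if "k < d" for k
    proof -
      have "V k = (\<lambda>i. \<Sum>m<d. unit_fun k m * V m i)"
        using that by (simp add: fun_eq_iff unit_fun_def if_distribR if_distrib cong: if_cong)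
      then show ?thesis unfolding SP_def by (rule range_eqI[where x = "unit_fun k"])
    qed
    \<comment> \<open>Let e be the basis vector of coordinate 0; coordinate 1 is the pairing with e.
      If it vanishes on the whole family, orthogonality to e is no condition, and coordinate 0 is
      eliminated instead, so that projecting along e stays injective.\<close>
    define i0 where "i0 = (if \<exists>p<d. V p 1 \<noteq> 0 then 1 else 0 :: nat)"
    have V: "independent_family (?N + 2) (Suc d') V" using Suc.prems(1) unfolding Suc N .
    obtain W b where W: "independent_family (?N + 2) d' W" "\<And>k. k < d' \<Longrightarrow> W k i0 = 0"
      and "\<And>k i. k < d' \<Longrightarrow> W k i = (\<Sum>l<Suc d'. b k l * V l i)"
      by (rule independent_family_eliminate[OF V, where ?i0.0 = i0]) (rule that)
    note Wb = this(3)[folded Suc]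
    have spanW: "(\<lambda>i. \<Sum>k<d'. c k * W k i) \<in> SP" for c
    proof -
      have "(\<lambda>i. \<Sum>k<d'. c k * W k i) = (\<lambda>i. \<Sum>k<d'. \<Sum>l<d. c k * b k l * V l i)"
        by (simp add: Wb sum_distrib_left mult.assoc)
      also have "\<dots> = (\<lambda>i. \<Sum>l<d. (\<Sum>k<d'. c k * b k l) * V l i)"
        by (subst sum.swap) (simp add: sum_distrib_right)
      finally show ?thesis unfolding SP_def by (rule range_eqI[where x = "\<lambda>l. \<Sum>k<d'. c k * b k l"])
    qed
    have W1: "W k 1 = 0" if "k < d'" for k
    proof (cases "\<exists>p<d. V p 1 \<noteq> 0")
      case True then show ?thesis using W(2)[OF that] by (simp add: i0_def)
    next
      case False then show ?thesis using Wb[OF that] by simp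
    qed
    \<comment> \<open>A combination killed by the projection is a multiple of e. Adding it to some
      \<open>V p\<close> with \<open>V p 1 \<noteq> 0\<close> changes the value of the form by
      \<open>Z 0 * V p 1\<close>, which must be 0 as both vectors are isotropic.\<close>
    have key: "Z 0 = 0" if Z: "Z = (\<lambda>i. \<Sum>k<d'. c k * W k i)" and Xz: "\<And>i. i < ?N \<Longrightarrow> Z (i + 2) = 0" for Z c
    proof (cases "\<exists>p<d. V p 1 \<noteq> 0")
      case True
      then obtain p where p: "p < d" "V p 1 \<noteq> 0" by blast
      have "Z 1 = 0" unfolding Z using W1 by simp
      moreover have "(\<lambda>i. Z i + V p i) \<in> SP" using spanW spanV p Z span_add by blast
      moreover have "hyperbolic_sum i R (\<lambda>k. Z (k + 2) + V p (k + 2)) = hyperbolic_sum i R (\<lambda>k. V p (k + 2))"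
        using Xz by (intro hyperbolic_sum_cong[OF R]) simp
      ultimately have "(Z 0 + V p 0) * V p 1 + hyperbolic_sum i R (\<lambda>k. V p (k + 2)) = 0"
        using spanQ[of "\<lambda>i. Z i + V p i"] by simp
      moreover have "V p 0 * V p 1 + hyperbolic_sum i R (\<lambda>k. V p (k + 2)) = 0" using spanQ spanV p by blast
      ultimately have "Z 0 * V p 1 = 0" by (simp add: algebra_simps)
      then show ?thesis using p by simp
    next
      case False
      then have "W k 0 = 0" if "k < d'" for k using W(2)[OF that] unfolding i0_def by (simp only: if_False)
      then show ?thesis unfolding Z by simp
    qed
    have "d' \<le> i + j"
    proof (rule Suc.IH[of d' "\<lambda>k i. W k (i + 2)"])
      show "independent_family ?N d' (\<lambda>k i. W k (i + 2))"
        unfolding independent_family_def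
      proof (intro allI impI)
        fix c k assume z: "\<forall>i<?N. (\<Sum>k<d'. c k * W k (i + 2)) = 0" and k: "k < d'"
        show "c k = 0"
        proof (rule independent_familyD[OF W(1) _ k])
          fix m assume m: "m < ?N + 2"
          consider "m = 0" | "m = 1" | "m = m - 2 + 2" "m - 2 < ?N" using m by linarith
          then show "(\<Sum>k<d'. c k * W k m) = 0"
          proof cases
            case 1 then show ?thesis using key[OF refl, of c] z by simp
          next
            case 2 then show ?thesis using W1 by simp
          next
            case 3 then show ?thesis using z by metis
          qed
        qed
      qed
      fix c
      have "(\<Sum>k<d'. c k * W k 1) = 0" using W1 by simp
      then show "hyperbolic_sum i R (\<lambda>i. \<Sum>k<d'. c k * W k (i + 2)) = 0"
        using spanQ[OF spanW[of c]] by simp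
    qed
    with Suc show ?thesis by simp
  qed simp
qed

lemma diag_block_mat_Cons:
  assumes "A \<in> carrier_mat a a" "diag_block_mat As \<in> carrier_mat b b"
  shows "diag_block_mat (A # As) = four_block_mat A (0\<^sub>m a b) (0\<^sub>m b a) (diag_block_mat As)"
    and "diag_block_mat (A # As) \<in> carrier_mat (a + b) (a + b)"
  using assms by (auto simp: Let_def)

lemma quad_diag_block_mat_Cons:
  assumes "A \<in> carrier_mat a a" "diag_block_mat As \<in> carrier_mat b b"
  shows "quad (diag_block_mat (A # As)) (a + b) x = quad A a x + quad (diag_block_mat As) b (\<lambda>i. x (i + a))"
  using assms by (simp only: diag_block_mat_Cons quad_four_block)

lemma diag_block_mat_zeros:
  "diag_block_mat (replicate j (unary_form (0::'f::field))) \<in> carrier_mat j j \<and>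
    quad (diag_block_mat (replicate j (unary_form (0::'f)))) j x = 0"
proof (induction j arbitrary: x)
  case 0 show ?case by (simp add: quad_def)
next
  case (Suc j)
  let ?D = "diag_block_mat (replicate j (unary_form (0::'f)))"
  have c: "?D \<in> carrier_mat j j" using Suc by blast
  note C = diag_block_mat_Cons(2)[OF unary_form_carrier[of 0] c]
    and Q = quad_diag_block_mat_Cons[OF unary_form_carrier[of 0] c]
  show ?case using C Q[where x = x] Suc[of "\<lambda>i. x (i + 1)"] by (simp add: quad_unary_form_zero)
qed

definition witt_form :: "nat \<Rightarrow> 'f::field mat \<Rightarrow> nat \<Rightarrow> 'f mat" where
  "witt_form i B j = diag_block_mat (replicate i hyperbolic_plane @ [B] @ replicate j (unary_form 0))"

lemma quad_witt_form:
  assumes B: "B \<in> carrier_mat r r"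
  shows "witt_form i B j \<in> carrier_mat (2 * i + r + j) (2 * i + r + j) \<and>
    quad (witt_form i B j) (2 * i + r + j) x = hyperbolic_sum i (quad B r) x"
proof (induction i arbitrary: x)
  case 0
  note Z = diag_block_mat_zeros[where j = j]
  show ?case
    using diag_block_mat_Cons(2)[OF B conjunct1[OF Z]] quad_diag_block_mat_Cons[OF B conjunct1[OF Z], where x = x] conjunct2[OF Z, of "\<lambda>i. x (i + r)"]
    by (simp add: witt_form_def)
next
  case (Suc i)
  let ?N = "2 * i + r + j"
  have c: "diag_block_mat (replicate i hyperbolic_plane @ [B] @ replicate j (unary_form 0)) \<in> carrier_mat ?N ?N"
    using Suc unfolding witt_form_def by blast
  have W: "witt_form (Suc i) B j =
      diag_block_mat (hyperbolic_plane # (replicate i hyperbolic_plane @ [B] @ replicate j (unary_form 0)))"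
    by (simp only: witt_form_def replicate_Suc append_Cons)
  have N: "2 * Suc i + r + j = 2 + ?N" by simp
  show ?case
    unfolding W N
    using diag_block_mat_Cons(2)[OF hyperbolic_plane_carrier c]
      quad_diag_block_mat_Cons[OF hyperbolic_plane_carrier c, where x = x] Suc[of "\<lambda>k. x (k + 2)"]
    by (simp add: quad_hyperbolic_plane witt_form_def)
qed

lemma anisotropic_map_quad:
  assumes "anisotropic B" "B \<in> carrier_mat r r"
  shows "anisotropic_map r (quad B r)"
  unfolding anisotropic_map_def
proof (intro conjI allI impI)
  fix x :: "nat \<Rightarrow> 'a" and i assume "quad B r x = 0" "i < r"
  then have "vec r x = 0\<^sub>v r" using assms unfolding anisotropic_def by (auto simp: qf_eval_quad)
  then show "x i = 0" using \<open>i < r\<close> by (metis index_vec index_zero_vec(1))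
next
  fix x y :: "nat \<Rightarrow> 'a" assume "\<forall>i<r. x i = y i"
  then show "quad B r x = quad B r y" by (intro quadratic_map.cong[OF quadratic_map_quad]) auto
qed

lemma quad_at_zero: "quad B r (\<lambda>_. 0) = 0"
  by (simp add: quad_def)

text \<open>The dual vectors \<open>D\<close> make linear independence survive every field extension.\<close>

definition split_isotropic_family :: "nat \<Rightarrow> ((nat \<Rightarrow> 'f::field) \<Rightarrow> 'f) \<Rightarrow> bool \<Rightarrow> nat \<Rightarrow> bool" where
  "split_isotropic_family M Q rad d \<longleftrightarrow> (\<exists>V D.
     (\<forall>k<d. \<forall>l<d. (\<Sum>i<M. D k i * V l i) = (if k = l then 1 else 0)) \<and>
     (\<forall>k<d. Q (V k) = 0) \<and>
     (\<forall>k<d. \<forall>y. rad \<or> (\<exists>l<d. y = V l) \<longrightarrow> polar Q (V k) y = 0))"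

lemma sum_unit_fun_mult: "j < n \<Longrightarrow> (\<Sum>i<n. unit_fun j i * f i) = f j"
  by (simp add: unit_fun_def if_distribR if_distrib cong: if_cong)

lemma split_isotropic_family_unit:
  assumes s: "\<And>k. k < d \<Longrightarrow> s k < M" "inj_on s {..<d}"
    and Q: "\<And>k. k < d \<Longrightarrow> Q (unit_fun (s k)) = 0"
    and P: "\<And>k y. k < d \<Longrightarrow> rad \<or> (\<exists>l<d. y = unit_fun (s l)) \<Longrightarrow> polar Q (unit_fun (s k)) y = 0"
  shows "split_isotropic_family M Q rad d"
  unfolding split_isotropic_family_def
proof (intro exI[of _ "\<lambda>k. unit_fun (s k)"] conjI allI impI)
  fix k l assume "k < d" "l < d"
  then show "(\<Sum>i<M. unit_fun (s k) i * unit_fun (s l) i) = (if k = l then 1 else (0::'a))"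
    using s(1)[of k] inj_onD[OF s(2), of k l] by (auto simp: sum_unit_fun_mult) (auto simp: unit_fun_def)
qed (use Q P in auto)

lemma hyperbolic_sum_isotropic_family:
  assumes R: "anisotropic_map r R" and R0: "R (\<lambda>_. 0) = 0"
  shows "split_isotropic_family (2 * i + r + j) (hyperbolic_sum i R) False (i + j)"
proof -
  \<comment> \<open>The even coordinate of each hyperbolic pair, then the trailing coordinates: for
    \<open>i \<le> k\<close> the index \<open>i + r + k\<close> is
    \<open>2 * i + r + (k - i)\<close>.\<close>
  define s where "s k = (if k < i then 2 * k else i + r + k)" for k
  let ?Q = "hyperbolic_sum i R"
  have odd: "s k \<noteq> 2 * l + 1" if "l < i" for k l
    using that by (auto simp: s_def) presburger
  have mid: "s k \<noteq> 2 * i + l" if "l < r" for k l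
    using that by (auto simp: s_def)
  have Q: "?Q (\<lambda>m. a * unit_fun (s k) m + b * unit_fun (s l) m) = 0" for a b k l
  proof (rule hyperbolic_sum_zero[OF R R0])
    show "a * unit_fun (s k) (2 * m + 1) + b * unit_fun (s l) (2 * m + 1) = 0" if "m < i" for m
      using odd[OF that, of k, symmetric] odd[OF that, of l, symmetric] by (simp add: unit_fun_def)
    show "a * unit_fun (s k) (2 * i + m) + b * unit_fun (s l) (2 * i + m) = 0" if "m < r" for m
      using mid[OF that, of k, symmetric] mid[OF that, of l, symmetric] by (simp add: unit_fun_def)
  qed
  show ?thesis
  proof (rule split_isotropic_family_unit[of _ s])
    show "inj_on s {..<i + j}" by (auto simp: inj_on_def s_def split: if_splits)
    show 0: "?Q (unit_fun (s k)) = 0" for k using Q[of 1 k 0 0] by simp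
    fix k and y :: "nat \<Rightarrow> 'a" assume "False \<or> (\<exists>l<i + j. y = unit_fun (s l))"
    then show "polar ?Q (unit_fun (s k)) y = 0" using 0 Q[of 1 k 1] by (auto simp: polar_def)
  qed (auto simp: s_def)
qed

lemma hyperbolic_sum_radical_family:
  assumes R: "anisotropic_map r R" and R0: "R (\<lambda>_. 0) = 0"
  shows "split_isotropic_family (2 * i + r + j) (hyperbolic_sum i R) True j"
proof (rule split_isotropic_family_unit[of _ "\<lambda>k. 2 * i + r + k"])
  let ?Q = "hyperbolic_sum i R" and ?e = "\<lambda>k. unit_fun (2 * i + r + k)"
  have 1: "?Q (\<lambda>m. ?e k m + y m) = ?Q y" for k y
    by (rule hyperbolic_sum_cong[OF R]) (simp add: unit_fun_def)
  show 0: "?Q (?e k) = 0" for k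
    by (rule hyperbolic_sum_zero[OF R R0]) (auto simp: unit_fun_def)
  show "polar ?Q (?e k) y = 0" for k y by (simp add: polar_def 0 1)
qed (auto simp: inj_on_def)

text \<open>Pairing with the hyperbolic partners kills the first \<open>2 * i\<close> coordinates;
  then the value of the form is that of \<open>R\<close>, and anisotropy kills the next
  \<open>r\<close>. Orthogonality alone would not do this, because in characteristic 2 an
  anisotropic form can have a nonzero polar radical.\<close>

lemma hyperbolic_sum_radical_le:
  assumes R: "anisotropic_map r R" and R0: "R (\<lambda>_. 0) = 0"
    and V: "independent_family (2 * i + r + j) d V"
    and Q: "\<And>k. k < d \<Longrightarrow> hyperbolic_sum i R (V k) = 0"
    and P: "\<And>k y. k < d \<Longrightarrow> polar (hyperbolic_sum i R) (V k) y = 0"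
  shows "d \<le> j"
proof -
  have zero: "hyperbolic_sum i R (\<lambda>_. 0) = 0" for i by (rule hyperbolic_sum_zero[OF R R0]) simp_all
  have rad: "(\<And>y. polar (hyperbolic_sum i R) x y = 0) \<Longrightarrow> m < 2 * i \<Longrightarrow> x m = 0" for x m i
  proof (induction i arbitrary: x m)
    case (Suc i)
    have pol: "polar (hyperbolic_sum (Suc i) R) x y = x 0 * y 1 + y 0 * x 1
        + polar (hyperbolic_sum i R) (\<lambda>k. x (k + 2)) (\<lambda>k. y (k + 2))" for y
      by (simp add: polar_def algebra_simps)
    have pz: "polar (hyperbolic_sum i R) x (\<lambda>_. 0) = 0" for x by (simp add: polar_def zero)
    have u: "unit_fun 0 (Suc (Suc k)) = (0::'a)" "unit_fun (Suc 0) (Suc (Suc k)) = (0::'a)" for k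
      by (simp_all add: unit_fun_def)
    have "x 0 = 0" using Suc.prems(1)[of "unit_fun 1"] pz unfolding pol by (simp add: u) (simp add: unit_fun_def)
    moreover have "x 1 = 0" using Suc.prems(1)[of "unit_fun 0"] pz unfolding pol by (simp add: u) (simp add: unit_fun_def)
    moreover have "x (k + 2) = 0" if "k < 2 * i" for k
    proof (rule Suc.IH[of "\<lambda>k. x (k + 2)" k, OF _ that])
      fix y
      show "polar (hyperbolic_sum i R) (\<lambda>k. x (k + 2)) y = 0"
        using Suc.prems(1)[of "\<lambda>k. if k < 2 then 0 else y (k - 2)"] unfolding pol by simp
    qed
    moreover consider "m = 0" | "m = 1" | "m = m - 2 + 2" "m - 2 < 2 * i" using Suc.prems(2) unfolding mult_Suc_right by linarith
    ultimately show ?case by (cases; metis)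
  qed simp
  have hs: "(\<And>m. m < 2 * i \<Longrightarrow> x m = 0) \<Longrightarrow> hyperbolic_sum i R x = R (\<lambda>k. x (k + 2 * i))" for x i
  proof (induction i arbitrary: x)
    case (Suc i)
    have "hyperbolic_sum i R (\<lambda>k. x (k + 2)) = R (\<lambda>k. x (k + 2 * i + 2))"
      by (rule Suc.IH) (simp add: Suc.prems)
    then show ?case using Suc.prems[of 0] by simp
  qed simp
  have "V k m = 0" if "k < d" "m < 2 * i + r" for k m
  proof (cases "m < 2 * i")
    case True then show ?thesis using rad[of i "V k" m] P \<open>k < d\<close> by blast
  next
    case False
    have "R (\<lambda>m. V k (m + 2 * i)) = 0" using hs[of i "V k"] rad[of i "V k"] P Q \<open>k < d\<close> by simp
    then have "V k ((m - 2 * i) + 2 * i) = 0"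
      using conjunct1[OF R[unfolded anisotropic_map_def], rule_format, of "\<lambda>m. V k (m + 2 * i)" "m - 2 * i"] False that(2)
      by simp
    then show ?thesis using False by simp
  qed
  then have "independent_family j d (\<lambda>k m. V k (m + (2 * i + r)))"
    using V by (intro independent_family_shift) (simp_all add: add.commute add.left_commute)
  then show ?thesis by (rule independent_family_le)
qed

section \<open>Isotropic families under isometries and field embeddings\<close>

lemma isotropic_family_span:
  assumes "quadratic_map M Q" "isotropic_family UNIV M Q False d"
  obtains V where "independent_family M d V" "\<And>c. Q (\<lambda>i. \<Sum>k<d. c k * V k i) = 0"
proof -
  interpret quadratic_map M Q by fact
  from assms(2) obtain V where V: "isotropic_vectors UNIV M Q False d V" unfolding isotropic_family_def ..
  have ind: "independent_family M d V"
    using isotropic_vectorsD(2)[OF V] unfolding independent_family_def by blast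
  have "e \<le> d \<Longrightarrow> Q (\<lambda>i. \<Sum>k<e. c k * V k i) = 0 \<and> (\<forall>l<d. polar Q (\<lambda>i. \<Sum>k<e. c k * V k i) (V l) = 0)" for e c
  proof (induction e)
    case 0 show ?case by (simp add: zero polar_zero)
  next
    case (Suc e)
    have pol: "polar Q (V k) (V l) = 0" if "k < d" "l < d" for k l
      using isotropic_vectorsD(4)[OF V that(1), of "V l"] that by blast
    show ?case
      using Suc isotropic_vectorsD(3)[OF V, of e] pol[of e]
      by (simp add: add scale polar_add polar_scale polar_scale_right)
  qed
  then show ?thesis using that[OF ind] by blast
qed

lemma isotropic_family_isometric:
  fixes A B :: "'f::field mat"
  assumes iso: "A \<cong>\<^sub>q B" and A: "A \<in> carrier_mat n n"
    and fam: "isotropic_family UNIV n (quad A n) rad d"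
  shows "isotropic_family UNIV n (quad B n) rad d"
proof -
  obtain f g where "isometry_pair n A B f g" using isometric_maps[OF iso A] by blast
  note g = isometry_pairD(2)[OF this] and PR = isometry_pairD(3)[OF this]
    and QB = isometry_pairD(6)[OF this] and PB = isometry_pairD(8)[OF this]
  from fam obtain V where "isotropic_vectors UNIV n (quad A n) rad d V" unfolding isotropic_family_def ..
  note V = isotropic_vectorsD[OF this]
  show ?thesis
    unfolding isotropic_family_def isotropic_vectors_def
  proof (intro exI[of _ "\<lambda>k. g (V k)"] conjI allI impI)
    fix c k assume z: "\<forall>i<n. (\<Sum>k<d. c k * g (V k) i) = 0" and k: "k < d"
    have "g (\<lambda>i. \<Sum>k<d. c k * V k i) i = 0" if "i < n" for i
      using z that by (simp add: linear_injective_sum[OF g])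
    then have "\<forall>i<n. (\<Sum>k<d. c k * V k i) = 0" using linear_injectiveD(4)[OF g] by blast
    then show "c k = 0" using V(2)[of c k] k by blast
  next
    fix k assume "k < d" then show "quad B n (g (V k)) = 0" using V(3) by (simp add: QB)
  next
    fix k y assume k: "k < d" and r: "rad \<or> (\<exists>l<d. y = g (V l))"
    have "polar (quad A n) (V k) (f y) = 0"
    proof (cases rad)
      case True then show ?thesis using V(4)[OF k] by blast
    next
      case False
      with r obtain l where l: "l < d" "y = g (V l)" by blast
      have "polar (quad A n) (V k) (f y) = polar (quad A n) (V k) (V l)"
        unfolding l(2) by (rule quadratic_map.polar_cong[OF quadratic_map_quad]) (simp_all add: PR)
      then show ?thesis using V(4)[OF k, of "V l"] l(1) by auto
    qed
    then show "polar (quad B n) (g (V k)) y = 0" by (simp add: PB)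
  qed simp
qed

lemma split_isotropic_family_isometric:
  fixes A B :: "'f::field mat"
  assumes iso: "A \<cong>\<^sub>q B" and A: "A \<in> carrier_mat n n"
    and fam: "split_isotropic_family n (quad B n) rad d"
  shows "split_isotropic_family n (quad A n) rad d"
proof -
  obtain f g where "isometry_pair n A B f g" using isometric_maps[OF iso A] by blast
  note g = isometry_pairD(2)[OF this] and RP = isometry_pairD(4)[OF this]
    and QA = isometry_pairD(5)[OF this] and PA = isometry_pairD(7)[OF this]
  from fam obtain V D where
    D: "\<And>k l. k < d \<Longrightarrow> l < d \<Longrightarrow> (\<Sum>i<n. D k i * V l i) = (if k = l then 1 else 0)"
    and Q: "\<And>k. k < d \<Longrightarrow> quad B n (V k) = 0"
    and pol: "\<And>k y. k < d \<Longrightarrow> rad \<or> (\<exists>l<d. y = V l) \<Longrightarrow> polar (quad B n) (V k) y = 0"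
    unfolding split_isotropic_family_def by blast
  show ?thesis
    unfolding split_isotropic_family_def
  \<comment> \<open>The dual functionals are composed with the inverse isometry \<open>g\<close>:
    the new coordinate at \<open>i\<close> is the functional \<open>D k\<close> applied to
    \<open>g (unit_fun i)\<close>.\<close>
  proof (rule exI[of _ "\<lambda>k. f (V k)"], rule exI[of _ "\<lambda>k i. \<Sum>j<n. D k j * g (unit_fun i) j"],
      intro conjI allI impI)
    fix k l assume kl: "k < d" "l < d"
    have "(\<Sum>i<n. (\<Sum>j<n. D k j * g (unit_fun i) j) * f (V l) i)
        = (\<Sum>i<n. \<Sum>j<n. D k j * (g (unit_fun i) j * f (V l) i))"
      by (simp add: sum_distrib_right mult.assoc)
    also have "\<dots> = (\<Sum>j<n. D k j * (\<Sum>i<n. g (unit_fun i) j * f (V l) i))"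
      by (subst sum.swap) (simp add: sum_distrib_left)
    also have "\<dots> = (\<Sum>j<n. D k j * V l j)"
    proof (rule sum.cong)
      fix j assume "j \<in> {..<n}"
      then show "D k j * (\<Sum>i<n. g (unit_fun i) j * f (V l) i) = D k j * V l j"
        using linear_injective_expand[OF g, of j "f (V l)"] RP[of j "V l"] by (simp add: mult.commute)
    qed simp
    finally show "(\<Sum>i<n. (\<Sum>j<n. D k j * g (unit_fun i) j) * f (V l) i) = (if k = l then 1 else 0)"
      using D kl by simp
  next
    fix k assume "k < d" then show "quad A n (f (V k)) = 0" using Q by (simp add: QA)
  next
    fix k y assume k: "k < d" and r: "rad \<or> (\<exists>l<d. y = f (V l))"
    have "polar (quad B n) (V k) (g y) = 0"
    proof (cases rad)
      case True then show ?thesis using pol[OF k] by blast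
    next
      case False
      with r obtain l where l: "l < d" "y = f (V l)" by blast
      have "polar (quad B n) (V k) (g y) = polar (quad B n) (V k) (V l)"
        unfolding l(2) by (rule quadratic_map.polar_cong[OF quadratic_map_quad]) (simp_all add: RP)
      then show ?thesis using pol[OF k, of "V l"] l(1) by auto
    qed
    then show "polar (quad A n) (f (V k)) y = 0" by (simp add: PA)
  qed
qed

lemma polar_quad_restrict:
  fixes A :: "'f::field mat" and s t :: "nat \<Rightarrow> nat"
  assumes s: "bij_betw s {..<m} I" and t: "\<And>j. j < m \<Longrightarrow> t (s j) = j"
  shows "polar (quad A n) (\<lambda>i. if i \<in> I then y (t i) else 0) z = (\<Sum>j<m. y j * polar (quad A n) (unit_fun (s j)) z)"
proof -
  interpret quadratic_map n "quad A n" by (rule quadratic_map_quad)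
  have "(\<lambda>i. if i \<in> I then y (t i) else 0) = (\<lambda>i. \<Sum>j<m. y j * unit_fun (s j) i)"
  proof
    fix i
    show "(if i \<in> I then y (t i) else 0) = (\<Sum>j<m. y j * unit_fun (s j) i)"
    proof (cases "i \<in> I")
      case True
      then obtain k where k: "k < m" "i = s k" using s by (auto simp: bij_betw_def)
      have "(\<Sum>j<m. y j * unit_fun (s j) i) = (\<Sum>j<m. if j = k then y j else 0)"
      proof (rule sum.cong)
        fix j assume "j \<in> {..<m}"
        then have "s k = s j \<longleftrightarrow> j = k" using s k by (auto simp: bij_betw_def inj_on_def)
        then show "y j * unit_fun (s j) i = (if j = k then y j else 0)" using k by (simp add: unit_fun_def)
      qed simp
      also have "\<dots> = y k" using k(1) by simp
      finally show ?thesis using True k t by simp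
    next
      case False
      then have "i \<noteq> s j" if "j < m" for j using s that by (auto simp: bij_betw_def)
      then show ?thesis using False by (simp add: unit_fun_def)
    qed
  qed
  moreover have "polar (quad A n) (\<lambda>i. \<Sum>j\<in>J. y j * unit_fun (s j) i) z
      = (\<Sum>j\<in>J. y j * polar (quad A n) (unit_fun (s j)) z)" for J
    by (induction J rule: infinite_finite_induct) (simp_all add: polar_zero polar_add polar_scale)
  ultimately show ?thesis by simp
qed

lemma polar_quad_expand:
  "polar (quad A n) y z = (\<Sum>j<n. y j * polar (quad A n) (unit_fun j) z)"
proof -
  have "polar (quad A n) y z = polar (quad A n) (\<lambda>i. if i \<in> {..<n} then y i else 0) z"
    by (rule quadratic_map.polar_cong[OF quadratic_map_quad]) auto
  also have "\<dots> = (\<Sum>j<n. y j * polar (quad A n) (unit_fun j) z)"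
    using polar_quad_restrict[of "\<lambda>i. i" n "{..<n}" "\<lambda>i. i" A n y z] by (simp add: bij_betw_def)
  finally show ?thesis .
qed

lemma quad_hom:
  assumes "field_hom f" "A \<in> carrier_mat n n"
  shows "quad (map_mat f A) n (\<lambda>i. f (x i)) = f (quad A n x)"
proof -
  interpret field_hom f by fact
  show ?thesis using assms(2) by (simp add: quad_def hom_distribs)
qed

lemma polar_hom:
  assumes "field_hom f" "A \<in> carrier_mat n n"
  shows "polar (quad (map_mat f A) n) (\<lambda>i. f (x i)) (\<lambda>i. f (y i)) = f (polar (quad A n) x y)"
proof -
  interpret field_hom f by fact
  show ?thesis
    using quad_hom[OF assms, of "\<lambda>i. x i + y i"] quad_hom[OF assms, of x] quad_hom[OF assms, of y]
    by (simp add: polar_def hom_distribs)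
qed

lemma field_hom_id: "field_hom (\<lambda>x::'a::field. x)"
  by unfold_locales simp_all

text \<open>The duality between \<open>D\<close> and \<open>V\<close> is an identity of scalars, so
  \<open>f\<close> preserves it, and pairing with the image of \<open>D k\<close> isolates each
  coefficient of a relation over \<open>S\<close>. In the radical case, orthogonality to the unit
  vectors suffices by linearity.\<close>

lemma split_isotropic_family_hom:
  fixes h :: "'a::field \<Rightarrow> 'k::field" and f :: "'k \<Rightarrow> 'o::field"
  assumes f: "field_hom f" "\<And>c. f (h c) = \<eta> c" and S: "subfield_set S" "range f \<subseteq> S"
    and A: "A \<in> carrier_mat m m" and fam: "split_isotropic_family m (quad (map_mat h A) m) rad d"
  shows "isotropic_family S m (quad (map_mat \<eta> A) m) rad d"
proof -
  interpret f: field_hom f by fact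
  let ?B = "map_mat h A"
  have B: "?B \<in> carrier_mat m m" using A by simp
  have fB: "map_mat \<eta> A = map_mat f ?B" using A f(2) by (auto intro!: eq_matI)
  interpret q: quadratic_map m "quad (map_mat f ?B) m" by (rule quadratic_map_quad)
  interpret b: quadratic_map m "quad ?B m" by (rule quadratic_map_quad)
  note Qh = quad_hom[OF f(1) B] and Ph = polar_hom[OF f(1) B]
  from fam obtain V D where
    D: "\<And>k l. k < d \<Longrightarrow> l < d \<Longrightarrow> (\<Sum>i<m. D k i * V l i) = (if k = l then 1 else 0)"
    and Q: "\<And>k. k < d \<Longrightarrow> quad ?B m (V k) = 0"
    and pol: "\<And>k y. k < d \<Longrightarrow> rad \<or> (\<exists>l<d. y = V l) \<Longrightarrow> polar (quad ?B m) (V k) y = 0"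
    unfolding split_isotropic_family_def by blast
  have fD: "(\<Sum>i<m. f (D k i) * f (V l i)) = (if k = l then 1 else 0)" if "k < d" "l < d" for k l
  proof -
    have "(\<Sum>i<m. f (D k i) * f (V l i)) = f (\<Sum>i<m. D k i * V l i)" by (simp add: hom_distribs)
    then show ?thesis using D[OF that] by simp
  qed
  show ?thesis
    unfolding isotropic_family_def isotropic_vectors_def fB
  proof (intro exI[of _ "\<lambda>k i. f (V k i)"] conjI allI impI)
    fix k i show "f (V k i) \<in> S" using S by auto
  next
    fix c k assume z: "\<forall>i<m. (\<Sum>k<d. c k * f (V k i)) = 0" and k: "k < d"
    have "0 = (\<Sum>i<m. f (D k i) * (\<Sum>l<d. c l * f (V l i)))" using z by simp
    also have "\<dots> = (\<Sum>i<m. \<Sum>l<d. c l * (f (D k i) * f (V l i)))"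
      by (simp add: sum_distrib_left mult.left_commute)
    also have "\<dots> = (\<Sum>l<d. c l * (\<Sum>i<m. f (D k i) * f (V l i)))"
      by (subst sum.swap) (simp add: sum_distrib_left)
    also have "\<dots> = (\<Sum>l<d. if k = l then c l else 0)" using fD k by (intro sum.cong) auto
    also have "\<dots> = c k" using k by simp
    finally show "c k = 0" by simp
  next
    fix k assume "k < d" then show "quad (map_mat f ?B) m (\<lambda>i. f (V k i)) = 0" using Qh[of "V k"] Q by simp
  next
    fix k y assume k: "k < d" and r: "rad \<or> (\<exists>l<d. y = (\<lambda>i. f (V l i)))"
    show "polar (quad (map_mat f ?B) m) (\<lambda>i. f (V k i)) y = 0"
    proof (cases rad)
      case True
      have "polar (quad (map_mat f ?B) m) (unit_fun j) (\<lambda>i. f (V k i)) = 0" for j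
      proof -
        have "unit_fun j = (\<lambda>i. f (unit_fun j i))" by (auto simp: unit_fun_def)
        then have "polar (quad (map_mat f ?B) m) (unit_fun j) (\<lambda>i. f (V k i))
            = f (polar (quad ?B m) (unit_fun j) (V k))" using Ph by metis
        also have "polar (quad ?B m) (unit_fun j) (V k) = 0"
          using pol[OF k] True b.polar_sym[of "unit_fun j" "V k"] by simp
        finally show ?thesis by simp
      qed
      then show ?thesis
        unfolding q.polar_sym[of "\<lambda>i. f (V k i)" y] polar_quad_expand[of _ _ y] by simp
    next
      case False
      with r obtain l where "l < d" "y = (\<lambda>i. f (V l i))" by blast
      then show ?thesis using Ph[of "V k" "V l"] pol[OF k, of "V l"] by auto
    qed
  qed
qed

lemma split_isotropic_family_imp:
  fixes A :: "'f::field mat"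
  assumes A: "A \<in> carrier_mat n n" and fam: "split_isotropic_family n (quad A n) rad d"
  shows "isotropic_family UNIV n (quad A n) rad d"
proof -
  have id: "map_mat (\<lambda>x. x) A = A" by (rule eq_matI) simp_all
  have "subfield_set (UNIV :: 'f set)" by (simp add: subfield_set_def)
  from split_isotropic_family_hom[OF field_hom_id refl this _ A, of "\<lambda>x. x"] fam show ?thesis
    unfolding id by blast
qed

text \<open>This identifies \<open>j\<close> as the largest dimension of a space of isotropic
  radical vectors and \<open>i + j\<close> as the largest dimension of a totally isotropic subspace.
  Both are intrinsic, which gives the uniqueness of \<open>i\<close> and \<open>j\<close>.\<close>

lemma witt_decomposition_bounds:
  fixes A :: "'f::field mat"
  assumes A: "A \<in> carrier_mat n n" and W: "witt_decomposition A i B j"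
  shows "isotropic_family UNIV n (quad A n) True d \<Longrightarrow> d \<le> j"
    and "isotropic_family UNIV n (quad A n) False d \<Longrightarrow> d \<le> i + j"
    and "split_isotropic_family n (quad A n) True j"
    and "split_isotropic_family n (quad A n) False (i + j)"
proof -
  from W have an: "anisotropic B" and iso: "A \<cong>\<^sub>q witt_form i B j"
    unfolding witt_decomposition_def witt_form_def by auto
  define r where "r = dim_row B"
  have B: "B \<in> carrier_mat r r" using an unfolding anisotropic_def r_def by auto
  note R = anisotropic_map_quad[OF an B] and W = quad_witt_form[OF B, of i j]
  obtain n' where "A \<in> carrier_mat n' n'" "witt_form i B j \<in> carrier_mat n' n'"
    using iso unfolding isometric_def by blast
  then have n: "2 * i + r + j = n" using A conjunct1[OF W] by (metis carrier_matD(1))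
  have Q: "quad (witt_form i B j) n = hyperbolic_sum i (quad B r)"
    using W unfolding n by blast
  show "d \<le> j" if "isotropic_family UNIV n (quad A n) True d"
  proof -
    from isotropic_family_isometric[OF iso A that] obtain V
      where V: "isotropic_vectors UNIV n (hyperbolic_sum i (quad B r)) True d V"
      unfolding Q isotropic_family_def ..
    show ?thesis
    proof (rule hyperbolic_sum_radical_le[OF R quad_at_zero, of i j d V])
      show "independent_family (2 * i + r + j) d V"
        using isotropic_vectorsD(2)[OF V] unfolding n independent_family_def by blast
    qed (use isotropic_vectorsD(3,4)[OF V] in auto)
  qed
  show "d \<le> i + j" if "isotropic_family UNIV n (quad A n) False d"
  proof -
    from isotropic_family_isometric[OF iso A that] have "isotropic_family UNIV n (quad (witt_form i B j) n) False d" .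
    from isotropic_family_span[OF quadratic_map_quad this] obtain V
      where "independent_family n d V" "\<And>c. hyperbolic_sum i (quad B r) (\<lambda>i. \<Sum>k<d. c k * V k i) = 0"
      unfolding Q by blast
    then show ?thesis using isotropic_subspace_le[OF R, of i j d V] unfolding n by blast
  qed
  show "split_isotropic_family n (quad A n) True j"
    using split_isotropic_family_isometric[OF iso A] hyperbolic_sum_radical_family[OF R quad_at_zero, of i j]
    unfolding Q n by blast
  show "split_isotropic_family n (quad A n) False (i + j)"
    using split_isotropic_family_isometric[OF iso A] hyperbolic_sum_isotropic_family[OF R quad_at_zero, of i j]
    unfolding Q n by blast
qed

lemma witt_decomposition_unique:
  fixes A :: "'f::field mat"
  assumes A: "A \<in> carrier_mat n n" and W: "witt_decomposition A i B j" and W': "witt_decomposition A i' B' j'"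
  shows "i = i'" "j = j'"
proof -
  note b = witt_decomposition_bounds[OF A W] and b' = witt_decomposition_bounds[OF A W']
  have "j \<le> j'" "j' \<le> j" "i + j \<le> i' + j'" "i' + j' \<le> i + j"
    using b(1)[OF split_isotropic_family_imp[OF A b'(3)]] b'(1)[OF split_isotropic_family_imp[OF A b(3)]]
      b(2)[OF split_isotropic_family_imp[OF A b'(4)]] b'(2)[OF split_isotropic_family_imp[OF A b(4)]] by auto
  then show "i = i'" "j = j'" by auto
qed

section \<open>Existence of the Witt decomposition\<close>

lemma quad_restrict:
  fixes A :: "'f::field mat" and s t :: "nat \<Rightarrow> nat"
  assumes s: "bij_betw s {..<m} I" and I: "I \<subseteq> {..<n}"
    and t: "\<And>j. j < m \<Longrightarrow> t (s j) = j"
  shows "quad A n (\<lambda>i. if i \<in> I then y (t i) else 0) = (\<Sum>j<m. \<Sum>k<m. A $$ (s j, s k) * y j * y k)"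
proof -
  let ?z = "\<lambda>i. if i \<in> I then y (t i) else 0"
  have red: "(\<Sum>i<n. f i) = (\<Sum>j<m. f (s j))" if "\<And>i. i < n \<Longrightarrow> i \<notin> I \<Longrightarrow> f i = 0" for f :: "nat \<Rightarrow> 'f"
  proof -
    have "(\<Sum>i<n. f i) = (\<Sum>i\<in>I. f i)" using I that by (intro sum.mono_neutral_right) auto
    also have "\<dots> = (\<Sum>j<m. f (s j))" by (rule sum.reindex_bij_betw[OF s, symmetric])
    finally show ?thesis .
  qed
  have sI: "s j \<in> I" if "j < m" for j using s that by (auto simp: bij_betw_def)
  show ?thesis
    unfolding quad_def
    by (subst red, simp, subst red, simp) (simp add: sI t)
qed

lemma enumerate_complement:
  assumes "P \<subseteq> {..<n}" "card P = k"
  obtains s t where "bij_betw s {..<n - k} ({..<n} - P)" "\<And>j. j < n - k \<Longrightarrow> t (s j) = j"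
    "\<And>i. i < n \<Longrightarrow> i \<notin> P \<Longrightarrow> t i < n - k \<and> s (t i) = i"
proof -
  have "finite P" using assms finite_subset by blast
  then have "card ({..<n} - P) = n - k" using assms by (simp add: card_Diff_subset)
  then obtain s where s: "bij_betw s {..<n - k} ({..<n} - P)"
    using ex_bij_betw_nat_finite[of "{..<n} - P"] by (auto simp: atLeast0LessThan)
  show ?thesis
  proof (rule that[OF s])
    show "inv_into {..<n - k} s (s j) = j" if "j < n - k" for j
      using s that by (auto simp: bij_betw_def)
    fix i assume "i < n" "i \<notin> P"
    then have "i \<in> s ` {..<n - k}" using s by (auto simp: bij_betw_def)
    then show "inv_into {..<n - k} s i < n - k \<and> s (inv_into {..<n - k} s i) = i"
      using inv_into_into[of i s "{..<n - k}"] f_inv_into_f[of i s "{..<n - k}"] by auto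
  qed
qed

text \<open>As \<open>v p \<noteq> 0\<close>, the unit vector at \<open>p\<close> can be exchanged
  for \<open>v\<close>. Being isotropic and orthogonal to everything, \<open>v\<close> contributes
  nothing to the form, and \<open>B\<close> is the restriction to the other coordinates.\<close>

lemma isometric_split_radical:
  fixes A :: "'f::field mat"
  assumes A: "A \<in> carrier_mat n n" and p: "p < n" "v p \<noteq> 0"
    and Qv: "quad A n v = 0" and rad: "\<And>y. polar (quad A n) v y = 0"
  obtains B where "B \<in> carrier_mat (n - 1) (n - 1)"
    "A \<cong>\<^sub>q four_block_mat B (0\<^sub>m (n - 1) 1) (0\<^sub>m 1 (n - 1)) (unary_form 0)"
proof -
  interpret quadratic_map n "quad A n" by (rule quadratic_map_quad)
  obtain s t where s: "bij_betw s {..<n - 1} ({..<n} - {p})" and t: "\<And>j. j < n - 1 \<Longrightarrow> t (s j) = j"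
    and st: "\<And>i. i < n \<Longrightarrow> i \<notin> {p} \<Longrightarrow> t i < n - 1 \<and> s (t i) = i"
    using enumerate_complement[of "{p}" n 1] p(1) by auto
  define I where "I = {..<n} - {p}"
  define B where "B = mat (n - 1) (n - 1) (\<lambda>(j, k). A $$ (s j, s k))"
  define z where "z x = (\<lambda>i. if i \<in> I then x (t i) else 0)" for x :: "nat \<Rightarrow> 'f"
  define f where "f x = (\<lambda>i. x (n - 1) * v i + z x i)" for x
  have B: "B \<in> carrier_mat (n - 1) (n - 1)" by (simp add: B_def)
  have n: "n - 1 + 1 = n" using p by simp
  have f: "linear_injective n f"
    unfolding linear_injective_def
  proof (intro conjI allI impI)
    fix x y :: "nat \<Rightarrow> 'f" and i
    show "f (\<lambda>i. x i + y i) i = f x i + f y i" by (simp add: f_def z_def algebra_simps)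
  next
    fix c and x :: "nat \<Rightarrow> 'f" and i
    show "f (\<lambda>i. c * x i) i = c * f x i" by (simp add: f_def z_def algebra_simps)
  next
    fix x y :: "nat \<Rightarrow> 'f" and i assume *: "\<forall>i<n. x i = y i" "i < n"
    have "z x i = z y i"
    proof (cases "i = p")
      case False
      then have "t i < n - 1" using st[OF *(2)] by simp
      then have "t i < n" by linarith
      then show ?thesis using * by (simp add: z_def)
    qed (simp add: z_def I_def)
    then show "f x i = f y i" using * p by (simp add: f_def)
  next
    fix x :: "nat \<Rightarrow> 'f" and i assume *: "\<forall>i<n. f x i = 0" and i: "i < n"
    have "f x p = 0" using * p by blast
    then have last: "x (n - 1) = 0" using p by (simp add: f_def z_def I_def)
    show "x i = 0"
    proof (cases "i = n - 1")
      case False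
      then have i': "i < n - 1" using i by simp
      then have "s i \<in> I" using s unfolding I_def by (auto simp: bij_betw_def)
      moreover have "f x (s i) = 0" using * \<open>s i \<in> I\<close> by (auto simp: I_def)
      ultimately show ?thesis using last t[OF i'] by (simp add: f_def z_def)
    qed (use last in simp)
  qed
  have "A \<cong>\<^sub>q four_block_mat B (0\<^sub>m (n - 1) 1) (0\<^sub>m 1 (n - 1)) (unary_form 0)" (is "_ \<cong>\<^sub>q ?C")
  proof (rule isometricI[OF A _ f])
    show "?C \<in> carrier_mat n n" using four_block_carrier_mat[OF B unary_form_carrier[of 0]] unfolding n .
    fix x
    have "quad A n (f x) = quad A n (z x)"
      by (simp add: f_def add scale polar_scale Qv rad)
    also have "\<dots> = quad B (n - 1) x"
      unfolding z_def using quad_restrict[of s "n - 1" I n t A x] s t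
      by (simp add: I_def quad_def B_def)
    also have "\<dots> = quad ?C (n - 1 + 1) x"
      by (simp only: quad_four_block[OF B unary_form_carrier]) (simp add: quad_unary_form_zero)
    finally show "quad A n (f x) = quad ?C n x" unfolding n .
  qed
  with B show ?thesis by (rule that)
qed

text \<open>A vector \<open>e\<close> with b(v, e) = 1 is corrected by a multiple of
  \<open>v\<close> to an isotropic \<open>w\<close>. The hyperbolic pair v, w replaces two unit
  vectors, and the remaining ones are projected to its orthogonal complement.\<close>

lemma isometric_split_hyperbolic:
  fixes A :: "'f::field mat"
  assumes A: "A \<in> carrier_mat n n" and p: "p < n" "v p \<noteq> 0"
    and Qv: "quad A n v = 0" and nrad: "\<exists>y. polar (quad A n) v y \<noteq> 0"
  obtains B where "B \<in> carrier_mat (n - 2) (n - 2)" "2 \<le> n"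
    "A \<cong>\<^sub>q four_block_mat hyperbolic_plane (0\<^sub>m 2 (n - 2)) (0\<^sub>m (n - 2) 2) B"
proof -
  interpret quadratic_map n "quad A n" by (rule quadratic_map_quad)
  let ?b = "polar (quad A n)"
  have vv: "?b v v = 0" by (simp add: polar_self Qv)
  \<comment> \<open>Two different unit vectors have to be exchanged. If among the unit vectors only
    the one at \<open>p\<close> paired nontrivially with \<open>v\<close>, then b(v, v) would be
    nonzero, as \<open>v p \<noteq> 0\<close>; but b(v, v) = 2 Q(v) = 0.\<close>
  have "\<exists>q<n. q \<noteq> p \<and> ?b v (unit_fun q) \<noteq> 0"
  proof (rule ccontr)
    assume "\<not> ?thesis"
    then have 0: "?b v (unit_fun q) = 0" if "q < n" "q \<noteq> p" for q using that by blast
    have expand: "?b v y = (\<Sum>j<n. y j * ?b (unit_fun j) v)" for y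
      by (subst polar_sym) (rule polar_quad_expand)
    have one: "?b v y = y p * ?b (unit_fun p) v" for y
    proof -
      have "(\<Sum>j<n. y j * ?b (unit_fun j) v) = (\<Sum>j\<in>{p}. y j * ?b (unit_fun j) v)"
        using p 0 polar_sym by (intro sum.mono_neutral_right) auto
      then show ?thesis unfolding expand by simp
    qed
    have "?b (unit_fun p) v = 0" using one[of v] vv p by simp
    then show False using nrad one by simp
  qed
  then obtain q where q: "q < n" "q \<noteq> p" "?b v (unit_fun q) \<noteq> 0" by blast
  define r where "r = inverse (?b v (unit_fun q))"
  define e where "e = (\<lambda>i. r * unit_fun q i)"
  have r: "r \<noteq> 0" using q by (simp add: r_def)
  have ve: "?b v e = 1" using q by (simp add: e_def polar_scale_right r_def)
  define \<alpha> where "\<alpha> = quad A n e"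
  \<comment> \<open>Q(e - \<alpha> v) = \<alpha> - \<alpha> b(e, v) = 0, because Q(v) = 0 and b(e,
    v) = 1.\<close>
  define w where "w = (\<lambda>i. e i + (- \<alpha>) * v i)"
  have Qw: "quad A n w = 0"
    unfolding w_def add scale polar_scale_right using ve Qv by (simp add: \<alpha>_def polar_sym[of e v])
  have vw: "?b v w = 1" "?b w v = 1"
    unfolding w_def polar_add_right polar_scale_right polar_add polar_scale polar_sym[of e v] using ve vv by simp_all
  have ww: "?b w w = 0" by (simp add: polar_self Qw)
  obtain s t where s: "bij_betw s {..<n - 2} ({..<n} - {p, q})" and t: "\<And>j. j < n - 2 \<Longrightarrow> t (s j) = j"
    and st: "\<And>i. i < n \<Longrightarrow> i \<notin> {p, q} \<Longrightarrow> t i < n - 2 \<and> s (t i) = i"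
    using enumerate_complement[of "{p, q}" n 2] p(1) q(1,2) by auto
  have n: "2 + (n - 2) = n" using p q by linarith
  define I where "I = {..<n} - {p, q}"
  define z where "z x = (\<lambda>i. if i \<in> I then x (t i + 2) else 0)" for x :: "nat \<Rightarrow> 'f"
  \<comment> \<open>Chosen so that \<open>f x\<close> pairs with \<open>w\<close> to
    \<open>x 0\<close> and with \<open>v\<close> to \<open>x 1\<close>: it is x0 v + x1 w plus the
    projection of \<open>z x\<close> to the orthogonal complement of v, w.\<close>
  define g where "g x = x 0 - ?b (z x) w" for x
  define g' where "g' x = x 1 - ?b (z x) v" for x
  define f where "f x = (\<lambda>i. (g x * v i + g' x * w i) + z x i)" for x
  \<comment> \<open>The form on the projected vectors: Q(z - b(z, w) v - b(z, v) w) = Q(z) - b(z, v)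
    b(z, w).\<close>
  define B where "B = mat (n - 2) (n - 2) (\<lambda>(j, k). A $$ (s j, s k) - ?b (unit_fun (s j)) v * ?b (unit_fun (s k)) w)"
  have B: "B \<in> carrier_mat (n - 2) (n - 2)" by (simp add: B_def)
  have z_add: "z (\<lambda>i. x i + y i) = (\<lambda>i. z x i + z y i)" for x y by (auto simp: z_def)
  have z_scale: "z (\<lambda>i. c * x i) = (\<lambda>i. c * z x i)" for c x by (auto simp: z_def)
  have fw: "?b (f x) w = x 0" and fv: "?b (f x) v = x 1" for x
    by (simp_all add: f_def polar_add polar_scale vw vv ww) (simp_all add: g_def g'_def)
  have f: "linear_injective n f"
    unfolding linear_injective_def
  proof (intro conjI allI impI)
    fix x y :: "nat \<Rightarrow> 'f" and i
    show "f (\<lambda>i. x i + y i) i = f x i + f y i"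
      by (simp add: f_def g_def g'_def z_add polar_add algebra_simps)
  next
    fix c and x :: "nat \<Rightarrow> 'f" and i
    show "f (\<lambda>i. c * x i) i = c * f x i"
      by (simp add: f_def g_def g'_def z_scale polar_scale algebra_simps)
  next
    fix x y :: "nat \<Rightarrow> 'f" and i assume *: "\<forall>i<n. x i = y i" "i < n"
    have "z x = z y"
    proof
      fix k show "z x k = z y k"
      proof (cases "k \<in> I")
        case True
        then have "t k + 2 < n" using st[of k] by (auto simp: I_def)
        then show ?thesis using * by (simp add: z_def)
      qed (simp add: z_def)
    qed
    moreover have "x 0 = y 0" "x 1 = y 1" using * n by auto
    ultimately show "f x i = f y i" by (simp add: f_def g_def g'_def)
  next
    fix x :: "nat \<Rightarrow> 'f" and i assume *: "\<forall>i<n. f x i = 0" and i: "i < n"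
    have "?b (f x) y = 0" for y
      using polar_cong[of "f x" "\<lambda>_. 0" y y] * polar_zero by simp
    then have x01: "x 0 = 0" "x 1 = 0" using fw[of x] fv[of x] by simp_all
    have "f x p = 0" "f x q = 0" using * p q by auto
    moreover have "z x p = 0" "z x q = 0" by (simp_all add: z_def I_def)
    ultimately have pq: "g x * v p + g' x * w p = 0" "g x * v q + g' x * w q = 0" by (simp_all add: f_def)
    have wpq: "w p = - \<alpha> * v p" "w q = r - \<alpha> * v q" using q(2) by (simp_all add: w_def e_def unit_fun_def)
    have "(g x - g' x * \<alpha>) * v p = 0" using pq(1) by (simp add: wpq algebra_simps)
    then have g: "g x = g' x * \<alpha>" using p by simp
    with pq(2) have "g' x * r = 0" by (simp add: wpq algebra_simps)
    with r g have g0: "g' x = 0" "g x = 0" by simp_all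
    show "x i = 0"
    proof -
      consider "i = 0" | "i = 1" | "i - 2 < n - 2" "i = i - 2 + 2" using i by linarith
      then show ?thesis
      proof cases
        case 3
        then have "s (i - 2) \<in> I" using s unfolding I_def by (auto simp: bij_betw_def)
        moreover have "f x (s (i - 2)) = 0" using * \<open>s (i - 2) \<in> I\<close> by (auto simp: I_def)
        ultimately have "x (i - 2 + 2) = 0" using g0 t[OF 3(1)] by (simp add: f_def z_def)
        then show ?thesis using 3(2) by simp
      qed (use x01 in simp_all)
    qed
  qed
  have "A \<cong>\<^sub>q four_block_mat hyperbolic_plane (0\<^sub>m 2 (n - 2)) (0\<^sub>m (n - 2) 2) B" (is "_ \<cong>\<^sub>q ?C")
  proof (rule isometricI[OF A _ f])
    show "?C \<in> carrier_mat n n" using four_block_carrier_mat[OF hyperbolic_plane_carrier B] unfolding n .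
    fix x :: "nat \<Rightarrow> 'f"
    define y where "y = (\<lambda>i. x (i + 2))"
    have z: "z x = (\<lambda>i. if i \<in> I then y (t i) else 0)" unfolding z_def y_def ..
    have s': "bij_betw s {..<n - 2} I" "I \<subseteq> {..<n}" using s by (auto simp: I_def)
    have "quad A n (f x) = g x * g' x + g x * ?b v (z x) + g' x * ?b w (z x) + quad A n (z x)"
      by (simp add: f_def add scale polar_add polar_scale polar_scale_right Qv Qw vw)
    also have "\<dots> = x 0 * x 1 + (quad A n (z x) - ?b (z x) v * ?b (z x) w)"
      by (simp add: g_def g'_def polar_sym[of v "z x"] polar_sym[of w "z x"] algebra_simps)
    also have "quad A n (z x) - ?b (z x) v * ?b (z x) w = quad B (n - 2) y"
    proof -
      have r: "?b (z x) u = (\<Sum>j<n - 2. y j * ?b (unit_fun (s j)) u)" for u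
        unfolding z by (rule polar_quad_restrict[OF s'(1)]) (rule t)
      have q: "quad A n (z x) = (\<Sum>j<n - 2. \<Sum>k<n - 2. A $$ (s j, s k) * y j * y k)"
        unfolding z by (rule quad_restrict[OF s']) (rule t)
      have "?b (z x) v * ?b (z x) w = (\<Sum>j<n - 2. \<Sum>k<n - 2. ?b (unit_fun (s j)) v * ?b (unit_fun (s k)) w * y j * y k)"
        unfolding r sum_product
        by (intro sum.cong refl) (simp add: mult_ac)
      then show ?thesis
        unfolding q by (simp add: quad_def B_def left_diff_distrib sum_subtractf)
    qed
    also have "x 0 * x 1 + quad B (n - 2) y = quad ?C (2 + (n - 2)) x"
      by (simp only: quad_four_block[OF hyperbolic_plane_carrier B] quad_hyperbolic_plane y_def)
    finally show "quad A n (f x) = quad ?C n x" unfolding n .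
  qed
  with B n show ?thesis by (intro that) auto
qed

text \<open>A nonzero isotropic vector either lies in the radical and splits off a form <0>, or has
  a partner and splits off a hyperbolic plane.\<close>

lemma witt_decomposition_exists:
  fixes A :: "'f::field mat"
  shows "A \<in> carrier_mat n n \<Longrightarrow> \<exists>i B j. witt_decomposition A i B j"
proof (induction n arbitrary: A rule: less_induct)
  case (less n)
  note A = less.prems
  show ?case
  proof (cases "anisotropic A")
    case True
    then have "witt_decomposition A 0 A 0"
      using isometric_refl[OF A] by (simp add: witt_decomposition_def del: diag_block_mat.simps)
    then show ?thesis by blast
  next
    case False
    then obtain u where u: "u \<in> carrier_vec n" "qf_eval A u = 0" "u \<noteq> 0\<^sub>v n"
      using A unfolding anisotropic_def by auto
    define v where "v = (\<lambda>i. u $ i)"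
    obtain p where p: "p < n" "v p \<noteq> 0" using u unfolding v_def by (auto simp: vec_eq_iff)
    have Qv: "quad A n v = 0" using qf_eval_quad'[OF A u(1)] u(2) by (simp add: v_def)
    have iso_W: "\<exists>i C j. anisotropic C \<and> B \<cong>\<^sub>q witt_form i C j"
      if "B \<in> carrier_mat m m" "m < n" for B :: "'f mat" and m
      using less.IH[OF that(2,1)] unfolding witt_decomposition_def witt_form_def by blast
    show ?thesis
    proof (cases "\<exists>y. polar (quad A n) v y \<noteq> 0")
      case False
      then obtain B where B: "B \<in> carrier_mat (n - 1) (n - 1)"
        "A \<cong>\<^sub>q four_block_mat B (0\<^sub>m (n - 1) 1) (0\<^sub>m 1 (n - 1)) (unary_form 0)"
        using isometric_split_radical[OF A p Qv] by blast
      obtain i C j where C: "anisotropic C" "B \<cong>\<^sub>q witt_form i C j" using iso_W[OF B(1)] p by auto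
      have Wc: "witt_form i C j \<in> carrier_mat (n - 1) (n - 1)"
        using C(2) B(1) unfolding isometric_def by auto
      have "A \<cong>\<^sub>q four_block_mat (witt_form i C j) (0\<^sub>m (n - 1) 1) (0\<^sub>m 1 (n - 1)) (unary_form 0)"
        by (rule isometric_trans[OF B(2) isometric_four_block[OF C(2) isometric_refl[OF unary_form_carrier] B(1) unary_form_carrier]])
      also have "four_block_mat (witt_form i C j) (0\<^sub>m (n - 1) 1) (0\<^sub>m 1 (n - 1)) (unary_form 0)
          = diag_block_mat ((replicate i hyperbolic_plane @ [C] @ replicate j (unary_form 0)) @ [unary_form 0])"
        using Wc unary_form_carrier[of "0::'f"] unfolding diag_block_mat_last Let_def witt_form_def by auto
      also have "\<dots> = witt_form i C (Suc j)"
        by (simp add: witt_form_def replicate_append_same)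
      finally have "witt_decomposition A i C (Suc j)"
        using C unfolding witt_decomposition_def witt_form_def by simp
      then show ?thesis by blast
    next
      case True
      then obtain B where B: "B \<in> carrier_mat (n - 2) (n - 2)" "2 \<le> n"
        "A \<cong>\<^sub>q four_block_mat hyperbolic_plane (0\<^sub>m 2 (n - 2)) (0\<^sub>m (n - 2) 2) B"
        using isometric_split_hyperbolic[OF A p Qv] by blast
      obtain i C j where C: "anisotropic C" "B \<cong>\<^sub>q witt_form i C j" using iso_W[OF B(1)] B(2) by auto
      have Wc: "witt_form i C j \<in> carrier_mat (n - 2) (n - 2)"
        using C(2) B(1) unfolding isometric_def by auto
      have "A \<cong>\<^sub>q four_block_mat hyperbolic_plane (0\<^sub>m 2 (n - 2)) (0\<^sub>m (n - 2) 2) (witt_form i C j)"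
        by (rule isometric_trans[OF B(3) isometric_four_block[OF isometric_refl[OF hyperbolic_plane_carrier] C(2) hyperbolic_plane_carrier B(1)]])
      also have "\<dots> = witt_form (Suc i) C j"
        using diag_block_mat_Cons(1)[OF hyperbolic_plane_carrier Wc[unfolded witt_form_def]]
        by (simp add: witt_form_def)
      finally have "witt_decomposition A (Suc i) C j"
        using C unfolding witt_decomposition_def witt_form_def by simp
      then show ?thesis by blast
    qed
  qed
qed

lemma witt_decomposition_indices:
  fixes A :: "'f::field mat"
  assumes A: "A \<in> carrier_mat n n"
  obtains B where "witt_decomposition A (witt_index A) B (defect A)"
proof -
  obtain i B j where W: "witt_decomposition A i B j" using witt_decomposition_exists[OF A] by blast
  have "witt_index A = i"
    unfolding witt_index_def
  proof (rule the_equality)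
    show "\<exists>B j. witt_decomposition A i B j" using W by blast
    fix i' assume "\<exists>B j. witt_decomposition A i' B j"
    then obtain B' j' where "witt_decomposition A i' B' j'" by blast
    from witt_decomposition_unique(1)[OF A this W] show "i' = i" .
  qed
  moreover have "defect A = j"
    unfolding defect_def
  proof (rule the_equality)
    show "\<exists>i B. witt_decomposition A i B j" using W by blast
    fix j' assume "\<exists>i B. witt_decomposition A i B j'"
    then obtain i' B' where "witt_decomposition A i' B' j'" by blast
    from witt_decomposition_unique(2)[OF A this W] show "j' = j" .
  qed
  ultimately show ?thesis using that W by simp
qed

text \<open>Everything later about \<open>witt_index\<close> and \<open>defect\<close> goes through
  these four facts: upper bounds for arbitrary families, and families with dual vectors that attain
  them.\<close>

lemma
  fixes A :: "'f::field mat"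
  assumes A: "A \<in> carrier_mat n n"
  shows radical_family_le_defect: "isotropic_family UNIV n (quad A n) True d \<Longrightarrow> d \<le> defect A"
    and isotropic_family_le: "isotropic_family UNIV n (quad A n) False d \<Longrightarrow> d \<le> witt_index A + defect A"
    and split_radical_family_defect: "split_isotropic_family n (quad A n) True (defect A)"
    and split_isotropic_family_index: "split_isotropic_family n (quad A n) False (witt_index A + defect A)"
proof -
  obtain B where "witt_decomposition A (witt_index A) B (defect A)" using witt_decomposition_indices[OF A] .
  note b = witt_decomposition_bounds[OF A this]
  show "isotropic_family UNIV n (quad A n) True d \<Longrightarrow> d \<le> defect A"
    "isotropic_family UNIV n (quad A n) False d \<Longrightarrow> d \<le> witt_index A + defect A"
    "split_isotropic_family n (quad A n) True (defect A)"
    "split_isotropic_family n (quad A n) False (witt_index A + defect A)" using b by blast+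
qed

section \<open>Generic zeros and function fields\<close>

definition monomial_eval :: "(nat \<Rightarrow> 'f::comm_ring_1) \<Rightarrow> (nat \<Rightarrow>\<^sub>0 nat) \<Rightarrow> 'f" where
  "monomial_eval x m = (\<Prod>i\<in>Poly_Mapping.keys m. x i ^ Poly_Mapping.lookup m i)"

definition mpoly_eval :: "('a::field \<Rightarrow> 'f::field) \<Rightarrow> (nat \<Rightarrow> 'f) \<Rightarrow> 'a mpoly \<Rightarrow> 'f" where
  "mpoly_eval h x p = (\<Sum>m\<in>Poly_Mapping.keys p. h (Poly_Mapping.lookup p m) * monomial_eval x m)"

lemma monomial_eval_superset:
  assumes "finite S" "Poly_Mapping.keys m \<subseteq> S"
  shows "monomial_eval x m = (\<Prod>i\<in>S. x i ^ Poly_Mapping.lookup m i)"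
  unfolding monomial_eval_def using assms by (intro prod.mono_neutral_left) (auto simp: in_keys_iff)

lemma monomial_eval_add: "monomial_eval x (m + n) = monomial_eval x m * monomial_eval x n"
proof -
  let ?S = "Poly_Mapping.keys m \<union> Poly_Mapping.keys n"
  have "monomial_eval x (m + n) = (\<Prod>i\<in>?S. x i ^ Poly_Mapping.lookup (m + n) i)"
    by (rule monomial_eval_superset) (simp_all add: Poly_Mapping.keys_add)
  also have "\<dots> = (\<Prod>i\<in>?S. x i ^ Poly_Mapping.lookup m i) * (\<Prod>i\<in>?S. x i ^ Poly_Mapping.lookup n i)"
    by (simp add: lookup_add power_add prod.distrib)
  also have "\<dots> = monomial_eval x m * monomial_eval x n"
    by (simp add: monomial_eval_superset[of ?S])
  finally show ?thesis .
qed

lemma mpoly_eval_superset: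
  assumes "field_hom h" "finite S" "Poly_Mapping.keys p \<subseteq> S"
  shows "mpoly_eval h x p = (\<Sum>m\<in>S. h (Poly_Mapping.lookup p m) * monomial_eval x m)"
proof -
  interpret field_hom h by fact
  show ?thesis
    unfolding mpoly_eval_def using assms by (intro sum.mono_neutral_left) (auto simp: in_keys_iff)
qed

lemma mpoly_eval_add:
  assumes h: "field_hom h"
  shows "mpoly_eval h x (p + q) = mpoly_eval h x p + mpoly_eval h x q"
proof -
  interpret field_hom h by fact
  let ?S = "Poly_Mapping.keys p \<union> Poly_Mapping.keys q"
  have "mpoly_eval h x (p + q) = (\<Sum>m\<in>?S. h (Poly_Mapping.lookup (p + q) m) * monomial_eval x m)"
    by (rule mpoly_eval_superset[OF h]) (simp_all add: Poly_Mapping.keys_add)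
  also have "\<dots> = (\<Sum>m\<in>?S. h (Poly_Mapping.lookup p m) * monomial_eval x m)
      + (\<Sum>m\<in>?S. h (Poly_Mapping.lookup q m) * monomial_eval x m)"
    by (simp add: lookup_add hom_add distrib_right sum.distrib)
  also have "\<dots> = mpoly_eval h x p + mpoly_eval h x q"
    by (simp add: mpoly_eval_superset[OF h, of ?S])
  finally show ?thesis .
qed

lemma mpoly_eval_0 [simp]: "mpoly_eval h x 0 = 0"
  by (simp add: mpoly_eval_def)

lemma mpoly_eval_single:
  assumes "field_hom h"
  shows "mpoly_eval h x (Poly_Mapping.single m a) = h a * monomial_eval x m"
proof -
  interpret field_hom h by fact
  show ?thesis by (simp add: mpoly_eval_def)
qed

lemma mpoly_eval_sum:
  assumes "field_hom h"
  shows "mpoly_eval h x (\<Sum>i\<in>I. p i) = (\<Sum>i\<in>I. mpoly_eval h x (p i))"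
  by (induction I rule: infinite_finite_induct) (simp_all add: mpoly_eval_add[OF assms])

lemma poly_mapping_sum_single:
  "p = (\<Sum>m\<in>Poly_Mapping.keys p. Poly_Mapping.single m (Poly_Mapping.lookup p m))"
proof (rule poly_mapping_eqI)
  fix k
  have "Poly_Mapping.lookup (\<Sum>m\<in>Poly_Mapping.keys p. Poly_Mapping.single m (Poly_Mapping.lookup p m)) k
      = (\<Sum>m\<in>Poly_Mapping.keys p. if m = k then Poly_Mapping.lookup p k else 0)"
    by (simp add: lookup_sum lookup_single when_def)
  also have "\<dots> = Poly_Mapping.lookup p k" by (simp add: in_keys_iff)
  finally show "Poly_Mapping.lookup p k
      = Poly_Mapping.lookup (\<Sum>m\<in>Poly_Mapping.keys p. Poly_Mapping.single m (Poly_Mapping.lookup p m)) k" ..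
qed

lemma mpoly_eval_mult:
  assumes h: "field_hom h"
  shows "mpoly_eval h x (p * q) = mpoly_eval h x p * mpoly_eval h x q"
proof -
  interpret field_hom h by fact
  let ?p = "Poly_Mapping.lookup p" and ?q = "Poly_Mapping.lookup q"
  have "p * q = (\<Sum>m\<in>Poly_Mapping.keys p. \<Sum>n\<in>Poly_Mapping.keys q. Poly_Mapping.single (m + n) (?p m * ?q n))"
    by (subst (1) poly_mapping_sum_single[of p], subst (1) poly_mapping_sum_single[of q])
      (simp add: sum_product mult_single)
  then have "mpoly_eval h x (p * q) = (\<Sum>m\<in>Poly_Mapping.keys p. \<Sum>n\<in>Poly_Mapping.keys q.
      (h (?p m) * monomial_eval x m) * (h (?q n) * monomial_eval x n))"
    by (simp add: mpoly_eval_sum[OF h] mpoly_eval_single[OF h] monomial_eval_add hom_mult mult_ac)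
  also have "\<dots> = mpoly_eval h x p * mpoly_eval h x q"
    by (simp add: mpoly_eval_def sum_product)
  finally show ?thesis .
qed

lemma mpoly_eval_const [simp]:
  assumes "field_hom h"
  shows "mpoly_eval h x (mpoly_const c) = h c"
  by (simp add: mpoly_const_def mpoly_eval_single[OF assms] monomial_eval_def)

lemma mpoly_eval_var [simp]:
  assumes "field_hom h"
  shows "mpoly_eval h x (mpoly_var i) = x i"
proof -
  interpret field_hom h by fact
  show ?thesis by (simp add: mpoly_var_def mpoly_eval_single[OF assms] monomial_eval_def)
qed

lemma mpoly_const_1: "mpoly_const 1 = 1"
  by (simp add: mpoly_const_def)

lemma mpoly_eval_1 [simp]:
  assumes "field_hom h"
  shows "mpoly_eval h x 1 = 1"
proof -
  interpret field_hom h by fact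
  show ?thesis using mpoly_eval_const[OF assms, of x 1] by (simp add: mpoly_const_1)
qed

lemma mpoly_ring_simps [simp]:
  "carrier (mpoly_ring V) = {p. \<forall>m \<in> Poly_Mapping.keys p. Poly_Mapping.keys m \<subseteq> V}"
  "monoid.mult (mpoly_ring V) = (*)" "monoid.one (mpoly_ring V) = 1"
  "ring.zero (mpoly_ring V) = 0" "ring.add (mpoly_ring V) = (+)"
  by (simp_all add: mpoly_ring_def)

lemma mpoly_ring_closed:
  shows "p \<in> carrier (mpoly_ring V) \<Longrightarrow> q \<in> carrier (mpoly_ring V) \<Longrightarrow> p + q \<in> carrier (mpoly_ring V)"
    and "p \<in> carrier (mpoly_ring V) \<Longrightarrow> q \<in> carrier (mpoly_ring V) \<Longrightarrow> p * q \<in> carrier (mpoly_ring V)"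
    and "mpoly_const c \<in> carrier (mpoly_ring V)"
    and "i \<in> V \<Longrightarrow> mpoly_var i \<in> carrier (mpoly_ring V)"
    and "p \<in> carrier (mpoly_ring V) \<Longrightarrow> - p \<in> carrier (mpoly_ring V)"
proof -
  show "p + q \<in> carrier (mpoly_ring V)" if "p \<in> carrier (mpoly_ring V)" "q \<in> carrier (mpoly_ring V)"
    using that Poly_Mapping.keys_add[of p q] by auto
  show "p * q \<in> carrier (mpoly_ring V)" if pq: "p \<in> carrier (mpoly_ring V)" "q \<in> carrier (mpoly_ring V)"
  proof -
    have "Poly_Mapping.keys m \<subseteq> V" if m: "m \<in> Poly_Mapping.keys (p * q)" for m
    proof -
      obtain a b where "m = a + b" "a \<in> Poly_Mapping.keys p" "b \<in> Poly_Mapping.keys q"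
        using m Poly_Mapping.keys_mult[of p q] by blast
      moreover from this have "Poly_Mapping.keys a \<subseteq> V" "Poly_Mapping.keys b \<subseteq> V" using pq by auto
      ultimately show ?thesis using Poly_Mapping.keys_add[of a b] by blast
    qed
    then show ?thesis by simp
  qed
  show "mpoly_const c \<in> carrier (mpoly_ring V)" by (simp add: mpoly_const_def)
  show "mpoly_var i \<in> carrier (mpoly_ring V)" if "i \<in> V" using that by (simp add: mpoly_var_def)
  show "- p \<in> carrier (mpoly_ring V)" if "p \<in> carrier (mpoly_ring V)"
    using that by (simp add: in_keys_iff)
qed

lemma mpoly_ring_1: "1 \<in> carrier (mpoly_ring V)" and mpoly_ring_0: "0 \<in> carrier (mpoly_ring V)"
  by simp_all

lemma cring_mpoly_ring: "cring (mpoly_ring V :: 'a::field mpoly ring)"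
proof (rule cringI)
  note closed = mpoly_ring_closed[where V = V]
  show "abelian_group (mpoly_ring V :: 'a mpoly ring)"
  proof (rule abelian_groupI)
    fix p :: "'a mpoly" assume "p \<in> carrier (mpoly_ring V)"
    then show "\<exists>q\<in>carrier (mpoly_ring V). q \<oplus>\<^bsub>mpoly_ring V\<^esub> p = \<zero>\<^bsub>mpoly_ring V\<^esub>"
      using closed(5)[of p] by (intro bexI[of _ "- p"]) (simp_all del: mpoly_ring_simps(1))
  qed (simp_all del: mpoly_ring_simps(1) add: closed(1) mpoly_ring_0 ac_simps)
  show "Group.comm_monoid (mpoly_ring V :: 'a mpoly ring)"
    by (rule Group.comm_monoidI)
      (simp_all del: mpoly_ring_simps(1) add: closed(2) mpoly_ring_1 ac_simps)
qed (simp_all add: distrib_right)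

text \<open>The constants and the variables in \<open>V\<close> generate the ring, so two
  homomorphisms on it need to be compared on these generators only.\<close>

lemma mpoly_ring_induct [consumes 1, case_names const var add mult]:
  assumes p: "p \<in> carrier (mpoly_ring V)"
    and const: "\<And>c. P (mpoly_const c)" and var: "\<And>i. i \<in> V \<Longrightarrow> P (mpoly_var i)"
    and add: "\<And>p q. p \<in> carrier (mpoly_ring V) \<Longrightarrow> q \<in> carrier (mpoly_ring V) \<Longrightarrow> P p \<Longrightarrow> P q \<Longrightarrow> P (p + q)"
    and mult: "\<And>p q. p \<in> carrier (mpoly_ring V) \<Longrightarrow> q \<in> carrier (mpoly_ring V) \<Longrightarrow> P p \<Longrightarrow> P q \<Longrightarrow> P (p * q)"
  shows "P p"
proof -
  note closed = mpoly_ring_closed[where V = V]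
  define P' where "P' p \<longleftrightarrow> p \<in> carrier (mpoly_ring V) \<and> P p" for p
  have P'add: "P' (p + q)" if "P' p" "P' q" for p q
    using that closed(1)[of p q] add[of p q] unfolding P'_def by blast
  have P'mult: "P' (p * q)" if "P' p" "P' q" for p q
    using that closed(2)[of p q] mult[of p q] unfolding P'_def by blast
  have P'const: "P' (mpoly_const c)" for c using const closed(3) unfolding P'_def by blast
  have P'1: "P' 1" using P'const[of 1] by (simp only: mpoly_const_1)
  have P'0: "P' 0" using P'const[of 0] by (simp add: mpoly_const_def)
  have pow: "P' (Poly_Mapping.single (Poly_Mapping.single i k) 1)" if "i \<in> V" for i k
  proof (induction k)
    case 0 show ?case using P'1 by simp
  next
    case (Suc k)
    have "P' (mpoly_var i)" using that var closed(4) unfolding P'_def by blast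
    from P'mult[OF this Suc] show ?case
      by (simp add: mpoly_var_def mult_single single_add[symmetric])
  qed
  have mon: "P' (Poly_Mapping.single (\<Sum>i\<in>I. Poly_Mapping.single i (f i)) 1)" if "I \<subseteq> V" "finite I" for I f
    using that(2,1)
  proof (induction I rule: finite_induct)
    case empty show ?case using P'1 by simp
  next
    case (insert i I)
    have "P' (Poly_Mapping.single (Poly_Mapping.single i (f i)) 1 * Poly_Mapping.single (\<Sum>i\<in>I. Poly_Mapping.single i (f i)) 1)"
      using insert by (intro P'mult pow) auto
    then show ?case using insert by (simp add: mult_single)
  qed
  have monom: "P' (Poly_Mapping.single m c)" if "Poly_Mapping.keys m \<subseteq> V" for m c
  proof -
    have "P' (Poly_Mapping.single m 1)"
      using mon[OF that, of "Poly_Mapping.lookup m"] poly_mapping_sum_single[of m] by simp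
    from P'mult[OF P'const[of c] this] show ?thesis by (simp add: mpoly_const_def mult_single)
  qed
  have "P' (\<Sum>m\<in>J. Poly_Mapping.single m (Poly_Mapping.lookup p m))" if "J \<subseteq> Poly_Mapping.keys p" "finite J" for J
    using that(2,1)
  proof (induction J rule: finite_induct)
    case empty show ?case using P'0 by simp
  next
    case (insert m J)
    then have "Poly_Mapping.keys m \<subseteq> V" using p by auto
    then show ?case using insert by (simp add: P'add[OF monom])
  qed
  from this[of "Poly_Mapping.keys p"] poly_mapping_sum_single[of p] have "P' p" by simp
  then show ?thesis by (simp add: P'_def)
qed

lemma qf_eval_vec:
  fixes A :: "'r::comm_ring_1 mat"
  assumes "A \<in> carrier_mat n n"
  shows "qf_eval A (vec n x) = (\<Sum>i<n. \<Sum>j<n. A $$ (i, j) * x i * x j)"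
  using assms
  by (auto simp: qf_eval_def scalar_prod_def sum_distrib_left atLeast0LessThan mult_ac
      intro!: sum.cong)

lemma dehomogenized_poly_sum:
  assumes "\<psi> \<in> carrier_mat n n"
  shows "dehomogenized_poly \<psi> = (\<Sum>i<n. \<Sum>j<n. mpoly_const (\<psi> $$ (i, j)) *
    (if i = 0 then 1 else mpoly_var i) * (if j = 0 then 1 else mpoly_var j))"
proof -
  have "map_mat mpoly_const \<psi> \<in> carrier_mat n n" "dim_row \<psi> = n" "dim_col \<psi> = n" using assms by auto
  then show ?thesis by (simp add: dehomogenized_poly_def qf_eval_vec)
qed

lemma form_poly_sum:
  assumes "\<psi> \<in> carrier_mat n n"
  shows "form_poly \<psi> = (\<Sum>i<n. \<Sum>j<n. mpoly_const (\<psi> $$ (i, j)) * mpoly_var i * mpoly_var j)"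
proof -
  have "map_mat mpoly_const \<psi> \<in> carrier_mat n n" "dim_row \<psi> = n" "dim_col \<psi> = n" using assms by auto
  then show ?thesis by (simp add: form_poly_def qf_eval_vec)
qed

lemma mpoly_eval_dehomogenized_poly:
  assumes h: "field_hom h" and \<psi>: "\<psi> \<in> carrier_mat n n" and x: "x 0 = 1"
  shows "mpoly_eval h x (dehomogenized_poly \<psi>) = quad (map_mat h \<psi>) n x"
proof -
  have "(if i = 0 then 1 else x i) = x i" for i using x by auto
  moreover have "mpoly_eval h x (if i = 0 then 1 else mpoly_var i) = (if i = 0 then 1 else x i)" for i
    using h by simp
  moreover note dehomogenized_poly_sum[OF \<psi>]
  ultimately show ?thesis
    using \<psi> by (simp add: mpoly_eval_sum[OF h] mpoly_eval_mult[OF h] h quad_def)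
qed

text \<open>A generic point of the quadric \<open>\<psi> = 0\<close> in the affine chart where the first coordinate is \<open>1\<close>.\<close>

definition generic_zero :: "'a::field mat \<Rightarrow> nat \<Rightarrow> ('a \<Rightarrow> 'k::field) \<Rightarrow> (nat \<Rightarrow> 'k) \<Rightarrow> bool" where
  "generic_zero \<psi> n h w \<longleftrightarrow> w 0 = 1 \<and> quad (map_mat h \<psi>) n w = 0 \<and>
     (\<forall>z. \<exists>p \<in> carrier (mpoly_ring {1..<n}). \<exists>q \<in> carrier (mpoly_ring {1..<n}).
        mpoly_eval h w q \<noteq> 0 \<and> z = mpoly_eval h w p / mpoly_eval h w q) \<and>
     (\<forall>p \<in> carrier (mpoly_ring {1..<n}). mpoly_eval h w p = 0 \<longrightarrow> (\<exists>q. p = q * dehomogenized_poly \<psi>))"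

text \<open>A polynomial vanishing at the generic point is a multiple of the equation of the
  quadric, so it vanishes at every point of the quadric in the chart.\<close>

lemma generic_zero_specialize:
  assumes "generic_zero \<psi> n h w" and \<psi>: "\<psi> \<in> carrier_mat n n"
    and p: "p \<in> carrier (mpoly_ring {1..<n})" "mpoly_eval h w p = 0"
    and g: "field_hom g" and x: "x 0 = 1" "quad (map_mat g \<psi>) n x = 0"
  shows "mpoly_eval g x p = 0"
proof -
  obtain q where "p = q * dehomogenized_poly \<psi>" using assms(1) p unfolding generic_zero_def by blast
  then show ?thesis by (simp add: mpoly_eval_mult[OF g] mpoly_eval_dehomogenized_poly[where x = x, OF g \<psi> x(1)] x(2))
qed

text \<open>The coordinates are the images of the variables. Evaluation there is
  \<open>\<iota>\<close> after the quotient map, so its kernel is the ideal and the fractions of its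
  values exhaust the field.\<close>

lemma function_field_generic_zero:
  fixes \<iota> :: "'a::field mpoly set \<Rightarrow> 'k::field"
  assumes h: "field_hom h" and \<psi>: "\<psi> \<in> carrier_mat n n"
    and emb: "fraction_field_embedding (affine_ring \<psi>) \<iota>"
    and const: "\<And>c. \<iota> (affine_ring_const \<psi> c) = h c"
  obtains w where "generic_zero \<psi> n h w"
proof -
  let ?R = "mpoly_ring {1..<n} :: 'a mpoly ring" and ?I = "function_field_ideal \<psi>"
  let ?d = "dehomogenized_poly \<psi>"
  have n: "dim_row \<psi> = n" using \<psi> by simp
  note closed = mpoly_ring_closed[where V = "{1..<n}"]
  interpret h: field_hom h by fact
  interpret R: cring ?R by (rule cring_mpoly_ring)
  have sum_closed: "(\<Sum>i\<in>J. f i) \<in> carrier ?R" if "\<And>i. i \<in> J \<Longrightarrow> f i \<in> carrier ?R" for J :: "nat set" and f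
    using that by (induction J rule: infinite_finite_induct) (auto intro!: mpoly_ring_closed simp del: mpoly_ring_simps(1) simp: mpoly_ring_0)
  have d: "?d \<in> carrier ?R"
  proof -
    show ?thesis
      unfolding dehomogenized_poly_sum[OF \<psi>]
      by (intro sum_closed mpoly_ring_closed(2,3)) (auto intro!: mpoly_ring_closed mpoly_ring_1 simp del: mpoly_ring_simps(1))
  qed
  have I: "?I = {x * ?d |x. x \<in> carrier ?R}"
    unfolding function_field_ideal_def cgenideal_def n by simp
  interpret I: ideal ?I ?R
    unfolding function_field_ideal_def n by (rule R.cgenideal_ideal[OF d])
  define Q where "Q = ?R Quot ?I"
  have AQ: "affine_ring \<psi> = Q" by (simp add: affine_ring_def Q_def n)
  have \<iota>: "\<iota> \<in> Ring.ring_hom Q class_ring" "inj_on \<iota> (carrier Q)"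
    and frac: "\<And>z. \<exists>p \<in> carrier Q. \<exists>q \<in> carrier Q. \<iota> q \<noteq> 0 \<and> z = \<iota> p / \<iota> q"
    using emb unfolding fraction_field_embedding_def AQ by blast+
  define c where "c = (+>\<^bsub>?R\<^esub>) ?I"
  have c: "c \<in> Ring.ring_hom ?R Q" unfolding c_def Q_def by (rule I.rcos_ring_hom)
  define H where "H p = \<iota> (c p)" for p
  have cQ: "c p \<in> carrier Q" if "p \<in> carrier ?R" for p using ring_hom_closed[OF c that] .
  have Hadd: "H (p + q) = H p + H q" and Hmult: "H (p * q) = H p * H q"
    if "p \<in> carrier ?R" "q \<in> carrier ?R" for p q
    using ring_hom_add[OF c that] ring_hom_mult[OF c that]
      ring_hom_add[OF \<iota>(1) cQ[OF that(1)] cQ[OF that(2)]] ring_hom_mult[OF \<iota>(1) cQ[OF that(1)] cQ[OF that(2)]]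
    by (simp_all add: H_def)
  have Hconst: "H (mpoly_const a) = h a" for a
    using const[of a] by (simp add: H_def c_def affine_ring_const_def n)
  define w where "w i = (if i = 0 then 1 else H (mpoly_var i))" for i
  have eval: "H p = mpoly_eval h w p" if "p \<in> carrier ?R" for p
    using that
  proof (induction p rule: mpoly_ring_induct)
    case (var i) then show ?case using h by (simp add: w_def)
  qed (use h in \<open>simp_all add: Hconst Hadd Hmult mpoly_eval_add mpoly_eval_mult del: mpoly_ring_simps(1)\<close>)
  have ker: "\<exists>q. p = q * ?d" if p: "p \<in> carrier ?R" "H p = 0" for p
  proof -
    have "H 0 = 0" using Hconst[of 0] by (simp add: mpoly_const_def)
    then have "c p = c 0" using \<iota>(2) p cQ cQ[OF mpoly_ring_0] by (auto simp: H_def inj_on_def)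
    moreover have "c 0 = ?I" using R.a_rcos_zero[OF I.is_ideal I.zero_closed] by (simp add: c_def)
    ultimately have "p \<in> ?I" using I.rcos_const_imp_mem[OF p(1)] by (simp add: c_def)
    then show ?thesis unfolding I by blast
  qed
  have d_zero: "mpoly_eval h w ?d = 0"
  proof -
    have "?d \<in> ?I" unfolding I using mpoly_ring_1 by (metis (mono_tags, lifting) mem_Collect_eq mult_1)
    then have "c ?d = c 0" using R.a_rcos_zero[OF I.is_ideal] I.zero_closed by (simp add: c_def)
    then have "H ?d = H 0" by (simp add: H_def)
    also have "H 0 = 0" using Hconst[of 0] by (simp add: mpoly_const_def)
    finally show ?thesis by (simp add: eval[OF d])
  qed
  have surj: "\<exists>p\<in>carrier ?R. s = c p" if "s \<in> carrier Q" for s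
    using that unfolding Q_def FactRing_def A_RCOSETS_def' c_def by auto
  show ?thesis
  proof (rule that, unfold generic_zero_def, intro conjI allI ballI impI)
    show "w 0 = 1" by (simp add: w_def)
    then show "quad (map_mat h \<psi>) n w = 0"
      using d_zero mpoly_eval_dehomogenized_poly[OF h \<psi>, of w] by simp
    fix z
    obtain s r where "s \<in> carrier Q" "r \<in> carrier Q" "\<iota> r \<noteq> 0" "z = \<iota> s / \<iota> r" using frac[of z] by blast
    moreover obtain p q where "p \<in> carrier ?R" "q \<in> carrier ?R" "s = c p" "r = c q" using surj calculation by metis
    ultimately show "\<exists>p\<in>carrier ?R. \<exists>q\<in>carrier ?R. mpoly_eval h w q \<noteq> 0 \<and> z = mpoly_eval h w p / mpoly_eval h w q"
      using eval unfolding H_def by metis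
  next
    fix p assume "p \<in> carrier ?R" "mpoly_eval h w p = 0"
    then show "\<exists>q. p = q * ?d" using ker eval by metis
  qed
qed

lemma mpoly_eval_specialization:
  assumes \<rho>: "field_hom \<eta>" "field_hom \<theta>" "specialization \<eta> \<theta> \<rho>"
    and p: "p \<in> carrier (mpoly_ring V)" and x: "\<And>i. i \<in> V \<Longrightarrow> (x i, x' i) \<in> \<rho>"
  shows "(mpoly_eval \<eta> x p, mpoly_eval \<theta> x' p) \<in> \<rho>"
  using p
proof (induction p rule: mpoly_ring_induct)
  case (const c) then show ?case using \<rho> by (simp add: specializationD)
next
  case (var i) then show ?case using \<rho> x by simp
next
  case (add p q) then show ?case using \<rho> by (simp add: mpoly_eval_add specializationD)
next
  case (mult p q) then show ?case using \<rho> by (simp add: mpoly_eval_mult specializationD)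
qed

lemma mpoly_eval_in_subfield:
  assumes \<eta>: "field_hom \<eta>" and S: "subfield_set S" "range \<eta> \<subseteq> S"
    and p: "p \<in> carrier (mpoly_ring V)" and x: "\<And>i. i \<in> V \<Longrightarrow> x i \<in> S"
  shows "mpoly_eval \<eta> x p \<in> S"
  using p
proof (induction p rule: mpoly_ring_induct)
  case (const c) then show ?case using \<eta> S by auto
next
  case (var i) then show ?case using \<eta> x by simp
next
  case (add p q) then show ?case using \<eta> S by (simp add: mpoly_eval_add subfield_setD)
next
  case (mult p q) then show ?case using \<eta> S by (simp add: mpoly_eval_mult subfield_setD)
qed

text \<open>The points \<open>w\<close> and \<open>z\<close> satisfy the same polynomials, so
  sending p(w) / q(w) to p(z) / q(z) is well defined by \<open>zero\<close> and has nonzero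
  denominators by \<open>nonzero\<close>. This is the embedding of F(\<psi>) into the top of the
  tower.\<close>

lemma generic_zero_hom:
  fixes h :: "'a::field \<Rightarrow> 'k::field" and \<eta> :: "'a \<Rightarrow> 'o::field"
  assumes gen: "generic_zero \<psi> n h w" and h: "field_hom h" and \<eta>: "field_hom \<eta>"
    and zero: "\<And>p. p \<in> carrier (mpoly_ring {1..<n}) \<Longrightarrow> mpoly_eval h w p = 0 \<Longrightarrow> mpoly_eval \<eta> z p = 0"
    and nonzero: "\<And>p. p \<in> carrier (mpoly_ring {1..<n}) \<Longrightarrow> mpoly_eval \<eta> z p = 0 \<Longrightarrow> mpoly_eval h w p = 0"
    and S: "subfield_set S" "range \<eta> \<subseteq> S" and z: "\<And>i. i \<in> {1..<n} \<Longrightarrow> z i \<in> S"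
  obtains f where "field_hom f" "\<And>c. f (h c) = \<eta> c" "range f \<subseteq> S"
proof -
  interpret h: field_hom h by fact
  interpret \<eta>: field_hom \<eta> by fact
  let ?R = "mpoly_ring {1..<n} :: 'a mpoly ring"
  note closed = mpoly_ring_closed[where V = "{1..<n}"]
  define rep where "rep k pq \<longleftrightarrow> fst pq \<in> carrier ?R \<and> snd pq \<in> carrier ?R \<and>
    mpoly_eval h w (snd pq) \<noteq> 0 \<and> k = mpoly_eval h w (fst pq) / mpoly_eval h w (snd pq)" for k pq
  have "\<exists>pq. rep k pq" for k
  proof -
    obtain p q where "p \<in> carrier ?R" "q \<in> carrier ?R"
      "mpoly_eval h w q \<noteq> 0" "k = mpoly_eval h w p / mpoly_eval h w q"
      using gen unfolding generic_zero_def by blast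
    then have "rep k (p, q)" by (simp add: rep_def del: mpoly_ring_simps(1))
    then show ?thesis by blast
  qed
  then obtain r where r: "\<And>k. rep k (r k)" by metis
  define f where "f k = mpoly_eval \<eta> z (fst (r k)) / mpoly_eval \<eta> z (snd (r k))" for k
  have f: "f k = mpoly_eval \<eta> z p / mpoly_eval \<eta> z q"
    if p: "p \<in> carrier ?R" and q: "q \<in> carrier ?R" and nz: "mpoly_eval h w q \<noteq> 0"
      and k: "k = mpoly_eval h w p / mpoly_eval h w q" for k p q
  proof -
    let ?p = "fst (r k)" and ?q = "snd (r k)"
    have r': "?p \<in> carrier ?R" "?q \<in> carrier ?R" "mpoly_eval h w ?q \<noteq> 0"
      "k = mpoly_eval h w ?p / mpoly_eval h w ?q" using r[of k] unfolding rep_def by blast+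
    let ?c = "mpoly_const (- 1) :: 'a mpoly"
    have m: "?p * q + ?c * (p * ?q) \<in> carrier ?R" using p q r' by (intro closed)
    have "mpoly_eval h w ?p * mpoly_eval h w q = mpoly_eval h w p * mpoly_eval h w ?q"
      using k r' nz by (simp add: frac_eq_eq)
    then have "mpoly_eval h w (?p * q + ?c * (p * ?q)) = 0"
      by (simp add: mpoly_eval_add[OF h] mpoly_eval_mult[OF h] h hom_distribs)
    from zero[OF m this] have "mpoly_eval \<eta> z ?p * mpoly_eval \<eta> z q = mpoly_eval \<eta> z p * mpoly_eval \<eta> z ?q"
      by (simp add: mpoly_eval_add[OF \<eta>] mpoly_eval_mult[OF \<eta>] \<eta> hom_distribs)
    moreover have "mpoly_eval \<eta> z q \<noteq> 0" "mpoly_eval \<eta> z ?q \<noteq> 0" using nonzero nz q r' by blast+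
    ultimately show ?thesis by (simp add: f_def frac_eq_eq)
  qed
  have fc: "f (h c) = \<eta> c" for c
    using f[OF closed(3)[of c] mpoly_ring_1, of "h c"] h \<eta> by simp
  have "field_hom f"
  proof
    show "f 0 = 0" using fc[of 0] by simp
    show "f 1 = 1" using fc[of 1] by simp
    fix x y
    obtain p q where x: "p \<in> carrier ?R" "q \<in> carrier ?R" "mpoly_eval h w q \<noteq> 0" "x = mpoly_eval h w p / mpoly_eval h w q"
      using r[of x] unfolding rep_def by blast
    obtain p' q' where y: "p' \<in> carrier ?R" "q' \<in> carrier ?R" "mpoly_eval h w q' \<noteq> 0" "y = mpoly_eval h w p' / mpoly_eval h w q'"
      using r[of y] unfolding rep_def by blast
    have nz: "mpoly_eval \<eta> z q \<noteq> 0" "mpoly_eval \<eta> z q' \<noteq> 0" using nonzero x y by blast+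
    have "f (x + y) = mpoly_eval \<eta> z (p * q' + p' * q) / mpoly_eval \<eta> z (q * q')"
    proof (rule f)
      show "p * q' + p' * q \<in> carrier ?R" using x y by (intro closed)
      show "q * q' \<in> carrier ?R" using x y by (intro closed)
    qed (use x y in \<open>simp_all add: mpoly_eval_add[OF h] mpoly_eval_mult[OF h] add_frac_eq\<close>)
    then show "f (x + y) = f x + f y"
      unfolding f[OF x] f[OF y] using nz by (simp add: mpoly_eval_add[OF \<eta>] mpoly_eval_mult[OF \<eta>] add_frac_eq)
    have "f (x * y) = mpoly_eval \<eta> z (p * p') / mpoly_eval \<eta> z (q * q')"
    proof (rule f)
      show "p * p' \<in> carrier ?R" using x y by (intro closed)
      show "q * q' \<in> carrier ?R" using x y by (intro closed)
    qed (use x y in \<open>simp_all add: mpoly_eval_mult[OF h]\<close>)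
    then show "f (x * y) = f x * f y"
      unfolding f[OF x] f[OF y] by (simp add: mpoly_eval_mult[OF \<eta>])
  qed
  moreover have "range f \<subseteq> S"
  proof
    fix s assume "s \<in> range f"
    then obtain k where "s = f k" by blast
    then show "s \<in> S" unfolding f_def using r[of k] unfolding rep_def
      by (auto intro!: subfield_setD(8)[OF S(1)] mpoly_eval_in_subfield[OF \<eta> S] z simp del: mpoly_ring_simps(1))
  qed
  ultimately show ?thesis using that fc by blast
qed

text \<open>The transfer down the tower ends with a family over a copy of the field inside its
  algebraic closure; here it is pulled back to the field itself.\<close>

lemma isotropic_family_range:
  fixes g :: "'l::field \<Rightarrow> 'o::field"
  assumes g: "field_hom g" and A: "A \<in> carrier_mat M M"
    and fam: "isotropic_family (range g) M (quad (map_mat g A) M) rad d"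
  shows "isotropic_family UNIV M (quad A M) rad d"
proof -
  interpret g: field_hom g by fact
  note Qh = quad_hom[OF g A] and Ph = polar_hom[OF g A]
  from fam obtain W where "isotropic_vectors (range g) M (quad (map_mat g A) M) rad d W"
    unfolding isotropic_family_def ..
  note W = isotropic_vectorsD[OF this]
  have "\<forall>k i. \<exists>v. W k i = g v" using W(1) by blast
  then obtain V where V: "\<And>k i. W k i = g (V k i)" by metis
  have WV: "W k = (\<lambda>i. g (V k i))" for k using V by blast
  show ?thesis
    unfolding isotropic_family_def isotropic_vectors_def
  proof (intro exI[of _ V] conjI allI impI)
    fix c k assume z: "\<forall>i<M. (\<Sum>k<d. c k * V k i) = 0" and k: "k < d"
    have "(\<Sum>k<d. g (c k) * W k i) = 0" if "i < M" for i
    proof -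
      have "(\<Sum>k<d. g (c k) * W k i) = g (\<Sum>k<d. c k * V k i)" by (simp add: V hom_distribs)
      then show ?thesis using z that by simp
    qed
    then have "g (c k) = 0" using W(2)[of "\<lambda>k. g (c k)" k] k by blast
    then show "c k = 0" by simp
  next
    fix k assume "k < d"
    then show "quad A M (V k) = 0" using W(3)[of k] Qh[of "V k"] by (simp add: WV)
  next
    fix k y assume k: "k < d" and r: "rad \<or> (\<exists>l<d. y = V l)"
    have "polar (quad (map_mat g A) M) (W k) (\<lambda>i. g (y i)) = 0"
      by (rule W(4)[OF k]) (use r WV in auto)
    then show "polar (quad A M) (V k) y = 0" using Ph[of "V k" y] by (simp add: WV)
  qed simp
qed

lemma subfield_set_range:
  assumes "field_hom g"
  shows "subfield_set (range g)"
proof -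
  interpret field_hom g by fact
  show ?thesis
    unfolding subfield_set_def
    by (auto simp: hom_distribs[symmetric] intro: range_eqI[of _ _ 0] range_eqI[of _ _ 1])
qed

text \<open>The assignment p(w) \<mapsto> p(x) is well defined by
  \<open>generic_zero_specialize\<close> and extends to fractions by localization. The map
  \<open>g\<close> places the generic zero in a larger field, which has room for the tower.\<close>

lemma generic_zero_specialization:
  fixes h :: "'a::field \<Rightarrow> 'k::field" and g :: "'k \<Rightarrow> 'o::field" and \<theta> :: "'a \<Rightarrow> 'm::field"
  assumes gen: "generic_zero \<psi> n h w" and h: "field_hom h" and g: "field_hom g" and \<theta>: "field_hom \<theta>"
    and \<psi>: "\<psi> \<in> carrier_mat n n" and x: "x 0 = 1" "quad (map_mat \<theta> \<psi>) n x = 0"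
  obtains \<rho> where "specialization (\<lambda>c. g (h c)) \<theta> \<rho>" "\<And>i. i < n \<Longrightarrow> (g (w i), x i) \<in> \<rho>"
proof -
  interpret g: field_hom g by fact
  let ?C = "carrier (mpoly_ring {1..<n})"
  let ?R = "{(g (mpoly_eval h w p), mpoly_eval \<theta> x p) |p. p \<in> ?C}"
  note closed = mpoly_ring_closed[where V = "{1..<n}"]
  have RI: "(a, b) \<in> ?R" if "p \<in> ?C" "a = g (mpoly_eval h w p)" "b = mpoly_eval \<theta> x p" for a b p
    using that by blast
  have const: "(g (h c), \<theta> c) \<in> ?R" for c by (rule RI[OF closed(3)[of c]]) (use h \<theta> in simp_all)
  obtain \<rho> where \<rho>: "specialization (\<lambda>c. g (h c)) \<theta> \<rho>" "?R \<subseteq> \<rho>"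
  proof (rule specialization_fractions[of "\<lambda>c. g (h c)" \<theta> ?R, OF const])
    show "(1, 1) \<in> ?R" by (rule RI[OF mpoly_ring_1]) (use h \<theta> in simp_all)
    fix a a' b b' assume "(a, a') \<in> ?R" "(b, b') \<in> ?R"
    then obtain p p' where *: "p \<in> ?C" "a = g (mpoly_eval h w p)" "a' = mpoly_eval \<theta> x p"
      "p' \<in> ?C" "b = g (mpoly_eval h w p')" "b' = mpoly_eval \<theta> x p'" by blast
    show "(a + b, a' + b') \<in> ?R"
      by (rule RI[OF closed(1)[OF *(1,4)]]) (simp_all add: * mpoly_eval_add h \<theta> g.hom_add)
    show "(a * b, a' * b') \<in> ?R"
      by (rule RI[OF closed(2)[OF *(1,4)]]) (simp_all add: * mpoly_eval_mult h \<theta> g.hom_mult)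
  next
    fix b assume "(0, b) \<in> ?R"
    then obtain p where p: "p \<in> ?C" "mpoly_eval h w p = 0" "b = mpoly_eval \<theta> x p" by auto
    then show "b = 0" using generic_zero_specialize[OF gen \<psi> p(1,2) \<theta> x] by simp
  qed blast
  show ?thesis
  proof (rule that[OF \<rho>(1)])
    fix i assume i: "i < n"
    have "w 0 = 1" using gen unfolding generic_zero_def by blast
    have "(g (w i), x i) \<in> ?R"
    proof (cases "i = 0")
      case True
      then show ?thesis using h \<theta> x(1) \<open>w 0 = 1\<close> by (intro RI[OF mpoly_ring_1]) simp_all
    next
      case False
      then show ?thesis using i h \<theta> by (intro RI[OF closed(4)[of i]]) simp_all
    qed
    with \<rho>(2) show "(g (w i), x i) \<in> \<rho>" by blast
  qed
qed

text \<open>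
  The reflection in the anisotropic vector \<open>u\<close> defined over the base field is an involution of the
  quadric, so the mirror image of a generic zero is again generic.
\<close>

lemma generic_zero_reflect:
  fixes h :: "'a::field \<Rightarrow> 'k::field"
  assumes gen: "generic_zero \<psi> n h w" and h: "field_hom h" and \<psi>: "\<psi> \<in> carrier_mat n n"
    and refl: "reflected_zero n (quad (map_mat h \<psi>) n) w (\<lambda>i. h (u i)) \<beta>" and u: "u 0 = 0" and n: "0 < n"
    and q: "q \<in> carrier (mpoly_ring {1..<n})" "mpoly_eval h (\<lambda>i. w i + \<beta> * h (u i)) q = 0"
  shows "mpoly_eval h w q = 0"
proof -
  interpret h: field_hom h by fact
  let ?Q = "quad (map_mat h \<psi>) n" and ?U = "\<lambda>i. h (u i)"
  interpret Q: reflected_zero n ?Q w ?U \<beta> by fact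
  define w' where "w' = (\<lambda>i. w i + \<beta> * ?U i)"
  have w0: "w 0 = 1" using gen unfolding generic_zero_def by blast
  then have w'0: "w' 0 = 1" using u by (simp add: w'_def)
  have w'Q: "?Q w' = 0" using Q.test_point_zero[of "[]" w'] by (simp add: w'_def)
  \<comment> \<open>A specialization of the function field to itself that moves the generic zero to
    its mirror image.\<close>
  obtain \<sigma> where \<sigma>: "specialization h h \<sigma>" and ww': "\<And>i. i < n \<Longrightarrow> (w i, w' i) \<in> \<sigma>"
    using generic_zero_specialization[OF gen h field_hom_id h \<psi> w'0 w'Q] by blast
  note D = specializationD[OF \<sigma>]
  \<comment> \<open>The vectors \<open>w\<close> and \<open>w'\<close> have the same pairing with
    \<open>u\<close>, as \<open>u\<close> is orthogonal to itself. Hence \<beta> is sent to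
    itself.\<close>
  have "(polar ?Q w ?U, polar ?Q w' ?U) \<in> \<sigma>"
    by (rule polar_specialization[OF h h \<sigma> quad_specialization[OF h h \<sigma> \<psi>]]) (use ww' D in auto)
  then have "(polar ?Q w ?U, polar ?Q w ?U) \<in> \<sigma>" by (simp add: w'_def Q.polar_shift_u)
  moreover have "(?Q ?U, ?Q ?U) \<in> \<sigma>"
    by (rule quad_specialization[OF h h \<sigma> \<psi>]) (rule D)
  ultimately have "(polar ?Q w ?U / ?Q ?U, polar ?Q w ?U / ?Q ?U) \<in> \<sigma>"
    by (rule specialization_divide[OF \<sigma> _ _ Q.u_nonzero])
  moreover have "polar ?Q w ?U / ?Q ?U = \<beta>" using Q.\<beta> Q.u_nonzero by (simp add: divide_eq_eq)
  ultimately have \<beta>\<sigma>: "(\<beta>, \<beta>) \<in> \<sigma>" by simp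
  \<comment> \<open>The point w' = w + \<beta> u is sent to w' + \<beta> u = w: reflecting twice is
    the identity.\<close>
  have "(mpoly_eval h w' q, mpoly_eval h w q) \<in> \<sigma>"
  proof (rule mpoly_eval_specialization[OF h h \<sigma> q(1)])
    fix i assume i: "i \<in> {1..<n}"
    have "(w i + \<beta> * ?U i, w' i + \<beta> * ?U i) \<in> \<sigma>" using ww'[of i] \<beta>\<sigma> i by (intro D) auto
    moreover have "w' i + \<beta> * ?U i = w i" by (simp add: w'_def add.assoc Q.two)
    moreover have "w i + \<beta> * ?U i = w' i" by (simp add: w'_def)
    ultimately show "(w' i, w i) \<in> \<sigma>" by (simp only:)
  qed
  then show ?thesis using q(2) D(5) by (simp add: w'_def)
qed

section \<open>Irreducible and nondegenerate forms\<close>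

text \<open>Off the diagonal the terms cancel in pairs. The commutative ring is arbitrary so that
  variables can be inserted for the \<open>x i\<close>.\<close>

lemma alternating_sum_zero:
  fixes a :: "'i \<Rightarrow> 'i \<Rightarrow> 'r::comm_ring_1"
  assumes "finite J" "\<And>i. i \<in> J \<Longrightarrow> a i i = 0" "\<And>i j. i \<in> J \<Longrightarrow> j \<in> J \<Longrightarrow> a i j + a j i = 0"
  shows "(\<Sum>i\<in>J. \<Sum>j\<in>J. a i j * x i * x j) = 0"
  using assms
proof (induction J rule: finite_induct)
  case (insert k J)
  have "(\<Sum>i\<in>J. a i k * x i * x k) + (\<Sum>j\<in>J. a k j * x k * x j) = (\<Sum>j\<in>J. (a j k + a k j) * x j * x k)"
    by (simp add: sum.distrib algebra_simps)
  also have "\<dots> = 0" using insert.prems by (intro sum.neutral) auto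
  finally have "(\<Sum>i\<in>J. a i k * x i * x k) + (\<Sum>j\<in>J. a k j * x k * x j) = 0" .
  moreover have "(\<Sum>i\<in>insert k J. \<Sum>j\<in>insert k J. a i j * x i * x j)
      = a k k * x k * x k + ((\<Sum>i\<in>J. a i k * x i * x k) + (\<Sum>j\<in>J. a k j * x k * x j))
        + (\<Sum>i\<in>J. \<Sum>j\<in>J. a i j * x i * x j)"
    using insert.hyps by (simp add: sum.distrib algebra_simps)
  ultimately show ?case using insert by simp
qed simp

lemma quad_unit_fun:
  assumes "i < n"
  shows "quad A n (unit_fun i) = A $$ (i, i)"
proof -
  have "quad A n (unit_fun i) = (\<Sum>k<n. unit_fun i k * (\<Sum>l<n. unit_fun i l * A $$ (k, l)))"
    by (simp add: quad_def sum_distrib_left mult_ac)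
  then show ?thesis using assms by (simp add: sum_unit_fun_mult)
qed

lemma polar_quad_unit_fun:
  assumes "i < n" "j < n"
  shows "polar (quad A n) (unit_fun i) (unit_fun j) = A $$ (i, j) + A $$ (j, i)"
proof -
  have "polar (quad A n) (unit_fun i) (unit_fun j) = (\<Sum>k<n. unit_fun i k * (\<Sum>l<n. unit_fun j l * A $$ (k, l)))
      + (\<Sum>k<n. unit_fun j k * (\<Sum>l<n. unit_fun i l * A $$ (k, l)))"
    by (simp add: polar_quad sum_distrib_left sum.distrib distrib_left mult_ac)
  then show ?thesis using assms by (simp add: sum_unit_fun_mult)
qed

text \<open>A unit has no zeros, and here the origin is one.\<close>

lemma mpoly_not_unit:
  fixes p :: "'a::field mpoly"
  assumes "mpoly_eval (\<lambda>x. x) (\<lambda>_. 0) p = 0"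
  shows "\<not> p dvd 1"
proof
  assume "p dvd 1"
  then obtain q where "1 = p * q" by (auto simp: dvd_def)
  then have "mpoly_eval (\<lambda>x. x) (\<lambda>_. 0) (1::'a mpoly) = mpoly_eval (\<lambda>x. x) (\<lambda>_. 0) (p * q)" by simp
  then show False using assms by (simp add: mpoly_eval_mult[OF field_hom_id] field_hom_id)
qed

lemma mpoly_const_add: "mpoly_const (a + b) = mpoly_const a + mpoly_const b"
  and mpoly_const_mult: "mpoly_const (a * b) = mpoly_const a * mpoly_const b"
  and mpoly_const_0: "mpoly_const 0 = 0"
  by (simp_all add: mpoly_const_def single_add mult_single)

text \<open>Otherwise \<psi> vanishes on the hyperplane where coordinate 0 is 0. Its polynomial
  there is determined by the values at unit vectors and their pairwise sums, even over a finite
  field, so it is zero and variable 0 divides \<open>form_poly \<psi>\<close>. The condition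
  \<open>u 0 = 0\<close> makes the reflection in \<open>u\<close> preserve the first coordinate of a
  zero.\<close>

lemma irreducible_form_nonzero_off_hyperplane:
  fixes \<psi> :: "'a::field mat"
  assumes irr: "Factorial_Ring.irreducible (form_poly \<psi>)" and \<psi>: "\<psi> \<in> carrier_mat n n" and n: "0 < n"
  obtains u where "u 0 = 0" "\<And>i. n \<le> i \<Longrightarrow> u i = 0" "quad \<psi> n u \<noteq> 0"
proof (rule ccontr)
  assume no: "\<not> thesis"
  note goal = that
  have zero: "quad \<psi> n u = 0" if "u 0 = 0" "\<And>i. n \<le> i \<Longrightarrow> u i = 0" for u
    using no goal[of u] that by blast
  obtain k where k: "n = Suc k" using n by (cases n) auto
  have uz: "quad \<psi> n (unit_fun (Suc i)) = 0" if "i < k" for i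
    by (rule zero) (use that k in \<open>auto simp: unit_fun_def\<close>)
  have d: "\<psi> $$ (Suc i, Suc i) = 0" if "i < k" for i
    using quad_unit_fun[of "Suc i" n \<psi>] uz[OF that] that k by simp
  have o: "\<psi> $$ (Suc i, Suc j) + \<psi> $$ (Suc j, Suc i) = 0" if "i < k" "j < k" for i j
  proof -
    have "quad \<psi> n (\<lambda>l. unit_fun (Suc i) l + unit_fun (Suc j) l) = 0"
      by (rule zero) (use that k in \<open>auto simp: unit_fun_def\<close>)
    then show ?thesis
      using polar_quad_unit_fun[of "Suc i" n "Suc j" \<psi>] uz that k by (simp add: polar_def)
  qed
  let ?c = "\<lambda>i j. mpoly_const (\<psi> $$ (i, j))" and ?x = "mpoly_var :: nat \<Rightarrow> 'a mpoly"
  define L where "L = ?c 0 0 * ?x 0 + (\<Sum>j<k. ?c 0 (Suc j) * ?x (Suc j)) + (\<Sum>i<k. ?c (Suc i) 0 * ?x (Suc i))"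
  have alt: "(\<Sum>i<k. \<Sum>j<k. ?c (Suc i) (Suc j) * ?x (Suc i) * ?x (Suc j)) = 0"
    by (rule alternating_sum_zero[of "{..<k}" "\<lambda>i j. ?c (Suc i) (Suc j)" "\<lambda>i. ?x (Suc i)"])
      (simp_all add: d mpoly_const_0 mpoly_const_add[symmetric] o)
  have "form_poly \<psi> = ?c 0 0 * ?x 0 * ?x 0 + (\<Sum>j<k. ?c 0 (Suc j) * ?x 0 * ?x (Suc j))
      + ((\<Sum>i<k. ?c (Suc i) 0 * ?x (Suc i) * ?x 0) + (\<Sum>i<k. \<Sum>j<k. ?c (Suc i) (Suc j) * ?x (Suc i) * ?x (Suc j)))"
    unfolding form_poly_sum[OF \<psi>] k sum.lessThan_Suc_shift by (simp add: sum.distrib)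
  also have "\<dots> = ?x 0 * L"
    unfolding alt L_def by (simp add: distrib_left sum_distrib_left mult_ac)
  finally have "?x 0 dvd 1 \<or> L dvd 1" using irr unfolding Factorial_Ring.irreducible_def by blast
  moreover have "mpoly_eval (\<lambda>x. x) (\<lambda>_. 0) (?x 0) = (0::'a)" by (simp add: field_hom_id)
  moreover have "mpoly_eval (\<lambda>x. x) (\<lambda>_. 0) L = (0::'a)"
    by (simp add: L_def field_hom_id mpoly_eval_add[OF field_hom_id] mpoly_eval_mult[OF field_hom_id] mpoly_eval_sum[OF field_hom_id])
  ultimately show False using mpoly_not_unit by blast
qed

text \<open>The isometry writes the form as a product of two linear forms, neither of which is a
  unit. Hence the two alternatives in the definition of F(\<psi>) do not overlap at the hyperbolic
  plane.\<close>

lemma hyperbolic_plane_not_irreducible: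
  fixes \<psi> :: "'a::field mat"
  assumes iso: "\<psi> \<cong>\<^sub>q hyperbolic_plane"
  shows "\<not> Factorial_Ring.irreducible (form_poly \<psi>)"
proof
  assume irr: "Factorial_Ring.irreducible (form_poly \<psi>)"
  obtain n where \<psi>: "\<psi> \<in> carrier_mat n n" using iso unfolding isometric_def by blast
  obtain g g' where "hyperbolic_plane \<in> (carrier_mat n n :: 'a mat set)"
    and "isometry_pair n \<psi> hyperbolic_plane g' g"
    using isometric_maps[OF iso \<psi>] by blast
  note g = isometry_pairD(2)[OF this(2)] and \<psi>g = isometry_pairD(6)[OF this(2)]
  have "n = 2"
    using \<open>hyperbolic_plane \<in> _\<close> hyperbolic_plane_carrier[where 'a = 'a] by (metis carrier_matD(1))
  note \<psi> = \<psi>[unfolded this] and g = g[unfolded this] and \<psi>g = \<psi>g[unfolded this]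
  define r where "r i j = g (unit_fun j) i" for i j
  have "g x i = r i 0 * x 0 + r i 1 * x 1" if "i < 2" for x i
    using linear_injective_expand[OF g that, of x] by (simp add: r_def numeral_2_eq_2 mult.commute)
  then have q: "quad \<psi> 2 x = (r 0 0 * x 0 + r 0 1 * x 1) * (r 1 0 * x 0 + r 1 1 * x 1)" for x
    by (simp add: \<psi>g[symmetric] quad_hyperbolic_plane)
  have e: "\<psi> $$ (0, 0) = r 0 0 * r 1 0" "\<psi> $$ (1, 1) = r 0 1 * r 1 1"
    using quad_unit_fun[of 0 2 \<psi>] quad_unit_fun[of 1 2 \<psi>] unfolding q by (simp_all add: unit_fun_def)
  have e': "\<psi> $$ (0, 1) + \<psi> $$ (1, 0) = r 0 0 * r 1 1 + r 0 1 * r 1 0"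
    using polar_quad_unit_fun[of 0 2 1 \<psi>] unfolding polar_def q by (simp add: unit_fun_def algebra_simps)
  let ?c = "\<lambda>i j. mpoly_const (r i j)" and ?x = "mpoly_var :: nat \<Rightarrow> 'a mpoly"
  define L where "L i = ?c i 0 * ?x 0 + ?c i 1 * ?x 1" for i
  have "form_poly \<psi> = mpoly_const (\<psi> $$ (0, 0)) * ?x 0 * ?x 0
      + mpoly_const (\<psi> $$ (0, 1) + \<psi> $$ (1, 0)) * ?x 0 * ?x 1 + mpoly_const (\<psi> $$ (1, 1)) * ?x 1 * ?x 1"
    unfolding form_poly_sum[OF \<psi>] mpoly_const_add by (simp add: numeral_2_eq_2 algebra_simps)
  also have "\<dots> = L 0 * L 1"
    unfolding e e' L_def mpoly_const_add mpoly_const_mult by (simp add: algebra_simps)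
  finally have "L 0 dvd 1 \<or> L 1 dvd 1" using irr unfolding Factorial_Ring.irreducible_def by blast
  moreover have "mpoly_eval (\<lambda>x. x) (\<lambda>_. 0) (L i) = (0::'a)" for i
    by (simp add: L_def field_hom_id mpoly_eval_add[OF field_hom_id] mpoly_eval_mult[OF field_hom_id])
  ultimately show False using mpoly_not_unit by blast
qed

section \<open>Nondegenerate polar forms\<close>

definition nondegenerate :: "nat \<Rightarrow> ((nat \<Rightarrow> 'f::field) \<Rightarrow> 'f) \<Rightarrow> bool" where
  "nondegenerate M Q \<longleftrightarrow> (\<forall>x. (\<forall>y. polar Q x y = 0) \<longrightarrow> (\<forall>i<M. x i = 0))"

lemma nondegenerateD: "nondegenerate M Q \<Longrightarrow> (\<And>y. polar Q x y = 0) \<Longrightarrow> i < M \<Longrightarrow> x i = 0"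
  unfolding nondegenerate_def by blast

lemma nondegenerate_double_map:
  assumes "quadratic_map M Q" and nd: "nondegenerate M Q" and a: "a \<noteq> 0"
  shows "nondegenerate (2 * M) (double_map a M Q)"
  unfolding nondegenerate_def
proof (intro allI impI)
  interpret quadratic_map M Q by fact
  fix x :: "nat \<Rightarrow> 'a" and i assume *: "\<forall>y. polar (double_map a M Q) x y = 0" and i: "i < 2 * M"
  have 1: "polar Q x y = 0" for y
  proof -
    have "polar Q x (\<lambda>i. if i < M then y i else 0) = polar Q x y" by (rule polar_cong) simp_all
    then show ?thesis
      using *[rule_format, of "\<lambda>i. if i < M then y i else 0"] by (simp add: polar_double_map polar_zero)
  qed
  have 2: "polar Q (\<lambda>i. x (i + M)) y = 0" for y
    using *[rule_format, of "\<lambda>i. y (i - M)"] 1 a by (simp add: polar_double_map)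
  show "x i = 0"
    using nondegenerateD[OF nd 1, of i] nondegenerateD[OF nd 2, of "i - M"] i by (cases "i < M") auto
qed

lemma nondegenerate_pfister_map:
  assumes Q: "quadratic_map M Q" and nd: "nondegenerate M Q"
  shows "0 \<notin> set as \<Longrightarrow> nondegenerate (M * 2 ^ length as) (pfister_map as M Q)"
proof (induction as)
  case (Cons a as)
  then show ?case
    using nondegenerate_double_map[OF quadratic_map_pfister_map[OF Q], of as a] by (simp add: mult.left_commute)
qed (use nd in simp)

text \<open>\<open>A + A\<^sup>T\<close> is the Gram matrix of the polar form. The determinant
  criterion makes nondegeneracy pass to field extensions.\<close>

lemma nondegenerate_iff_det:
  fixes A :: "'f::field mat"
  assumes A: "A \<in> carrier_mat n n"
  shows "nondegenerate n (quad A n) \<longleftrightarrow> det (A + A\<^sup>T) \<noteq> 0"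
proof -
  interpret quadratic_map n "quad A n" by (rule quadratic_map_quad)
  let ?G = "A + A\<^sup>T"
  have G: "?G \<in> carrier_mat n n" using A by simp
  have Gv: "(?G *\<^sub>v v) $ i = polar (quad A n) (unit_fun i) (\<lambda>j. v $ j)" if v: "v \<in> carrier_vec n" and i: "i < n" for v i
  proof -
    have "polar (quad A n) (unit_fun i) (\<lambda>j. v $ j) = polar (quad A n) (\<lambda>j. v $ j) (unit_fun i)"
      by (rule polar_sym)
    also have "\<dots> = (\<Sum>j<n. v $ j * (A $$ (j, i) + A $$ (i, j)))"
      using i by (subst polar_quad_expand) (simp add: polar_quad_unit_fun)
    also have "\<dots> = (?G *\<^sub>v v) $ i"
      using A v i by (simp add: scalar_prod_def atLeast0LessThan mult.commute add.commute)
    finally show ?thesis ..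
  qed
  have rad: "polar (quad A n) x y = 0" if "?G *\<^sub>v vec n x = 0\<^sub>v n" for x y
  proof -
    have "polar (quad A n) (unit_fun i) x = 0" if i: "i < n" for i
    proof -
      have "polar (quad A n) (unit_fun i) x = polar (quad A n) (unit_fun i) (\<lambda>j. vec n x $ j)"
        by (rule polar_cong) simp_all
      then show ?thesis using Gv[of "vec n x" i] i \<open>?G *\<^sub>v vec n x = 0\<^sub>v n\<close> by simp
    qed
    then have "polar (quad A n) y x = 0" by (subst polar_quad_expand) simp
    then show ?thesis using polar_sym[of x y] by simp
  qed
  show ?thesis
  proof
    assume nd: "nondegenerate n (quad A n)"
    show "det ?G \<noteq> 0"
    proof
      assume "det ?G = 0"
      then obtain v where v: "v \<in> carrier_vec n" "v \<noteq> 0\<^sub>v n" "?G *\<^sub>v v = 0\<^sub>v n"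
        using det_0_iff_vec_prod_zero_field[OF G] by blast
      have "v = vec n (\<lambda>i. v $ i)" using v(1) by auto
      with v(3) have "?G *\<^sub>v vec n (\<lambda>i. v $ i) = 0\<^sub>v n" by metis
      then have "v $ i = 0" if "i < n" for i
        using nondegenerateD[OF nd, of "\<lambda>i. v $ i" i] rad that by blast
      with v show False by (auto simp: vec_eq_iff)
    qed
  next
    assume d: "det ?G \<noteq> 0"
    show "nondegenerate n (quad A n)"
      unfolding nondegenerate_def
    proof (intro allI impI)
      fix x i assume *: "\<forall>y. polar (quad A n) x y = 0" and i: "i < n"
      have "(?G *\<^sub>v vec n x) $ i = 0" if "i < n" for i
      proof -
        have "polar (quad A n) (unit_fun i) (\<lambda>j. vec n x $ j) = polar (quad A n) (unit_fun i) x"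
          by (rule polar_cong) simp_all
        also have "\<dots> = 0" using * polar_sym[of "unit_fun i" x] by simp
        finally show ?thesis using Gv[of "vec n x" i] that by simp
      qed
      then have "?G *\<^sub>v vec n x = 0\<^sub>v n" using A by (intro eq_vecI) auto
      then have "vec n x = 0\<^sub>v n" using d det_0_iff_vec_prod_zero_field[OF G] by (meson vec_carrier)
      then show "x i = 0" using i by (metis index_vec index_zero_vec(1))
    qed
  qed
qed

lemma nondegenerate_hom:
  assumes f: "field_hom f" and A: "A \<in> carrier_mat n n" and nd: "nondegenerate n (quad A n)"
  shows "nondegenerate n (quad (map_mat f A) n)"
proof -
  interpret field_hom f by fact
  have "map_mat f A + (map_mat f A)\<^sup>T = map_mat f (A + A\<^sup>T)"
    using A by (auto intro!: eq_matI simp: hom_distribs)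
  then have "det (map_mat f A + (map_mat f A)\<^sup>T) = f (det (A + A\<^sup>T))" by (simp add: hom_det)
  then show ?thesis using nd nondegenerate_iff_det[OF A] nondegenerate_iff_det[of "map_mat f A" n] A by simp
qed

lemma binary_form_carrier: "binary_form a b \<in> carrier_mat 2 2"
  by (simp add: binary_form_def mat_of_rows_list_def numeral_2_eq_2)

lemma quad_binary_form: "quad (binary_form a b) 2 x = a * x 0 * x 0 + x 0 * x 1 + b * x 1 * x 1"
  by (simp add: quad_def binary_form_def mat_of_rows_list_def numeral_2_eq_2 algebra_simps)

text \<open>In characteristic 2 the polar form of \<open>binary_form a b\<close> is x0 y1 + x1 y0,
  whatever \<open>a\<close> and \<open>b\<close> are.\<close>

lemma nondegenerate_binary_forms:
  fixes abs :: "('f::field \<times> 'f) list"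
  assumes two: "(2::'f) = 0"
  shows "diag_block_mat (map (\<lambda>(a, b). binary_form a b) abs) \<in> carrier_mat (2 * length abs) (2 * length abs) \<and>
    nondegenerate (2 * length abs) (quad (diag_block_mat (map (\<lambda>(a, b). binary_form a b) abs)) (2 * length abs))"
proof (induction abs)
  case Nil show ?case by (simp add: nondegenerate_def)
next
  case (Cons ab abs)
  obtain a b where ab: "ab = (a, b)" by fastforce
  let ?D = "diag_block_mat (map (\<lambda>(a, b). binary_form a b) abs)" and ?n = "2 * length abs"
  have D: "?D \<in> carrier_mat ?n ?n" and nd: "nondegenerate ?n (quad ?D ?n)" using Cons.IH by blast+
  have E: "map (\<lambda>(a, b). binary_form a b) (ab # abs) = binary_form a b # map (\<lambda>(a, b). binary_form a b) abs"
    by (simp add: ab)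
  have N: "2 * length (ab # abs) = 2 + ?n" by simp
  let ?E = "diag_block_mat (binary_form a b # map (\<lambda>(a, b). binary_form a b) abs)"
  note q = quad_diag_block_mat_Cons[OF binary_form_carrier D]
  have "nondegenerate (2 + ?n) (quad ?E (2 + ?n))"
    unfolding nondegenerate_def
  proof (intro allI impI)
    fix x i assume *: "\<forall>y. polar (quad ?E (2 + ?n)) x y = 0" and i: "i < 2 + ?n"
    have pol: "polar (quad ?E (2 + ?n)) x y = (2 * a * x 0 * y 0 + (x 0 * y 1 + y 0 * x 1) + 2 * b * x 1 * y 1)
        + polar (quad ?D ?n) (\<lambda>i. x (i + 2)) (\<lambda>i. y (i + 2))" for y
      by (simp only: polar_def q quad_binary_form) (simp add: algebra_simps)
    interpret d: quadratic_map ?n "quad ?D ?n" by (rule quadratic_map_quad)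
    have u: "(\<lambda>i. unit_fun 0 (i + 2)) = (\<lambda>_. 0::'f)" "(\<lambda>i. unit_fun 1 (i + 2)) = (\<lambda>_. 0::'f)"
      by (simp_all add: unit_fun_def fun_eq_iff)
    have 0: "2 * a * x 0 + x 1 = 0" and 1: "x 0 + 2 * b * x 1 = 0"
      using *[rule_format, of "unit_fun 0"] *[rule_format, of "unit_fun 1"]
      unfolding pol u d.polar_zero by (simp_all add: unit_fun_def)
    have rest: "x (j + 2) = 0" if "j < ?n" for j
    proof (rule nondegenerateD[OF nd _ that])
      fix y
      show "polar (quad ?D ?n) (\<lambda>i. x (i + 2)) y = 0"
        using *[rule_format, of "\<lambda>i. if i < 2 then 0 else y (i - 2)"] unfolding pol by simp
    qed
    consider "i = 0" | "i = 1" | "i = i - 2 + 2" "i - 2 < ?n" using i by linarith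
    then show "x i = 0"
    proof cases
      case 3 then show ?thesis using rest by metis
    qed (use 0 1 two in simp_all)
  qed
  then show ?case unfolding E N using diag_block_mat_Cons(2)[OF binary_form_carrier D] by blast
qed


lemma nonsingular_nondegenerate:
  fixes A :: "'f::field mat"
  assumes two: "(2::'f) = 0" and A: "A \<in> carrier_mat m m" and ns: "nonsingular A"
  shows "nondegenerate m (quad A m)"
proof -
  obtain abs where iso: "A \<cong>\<^sub>q diag_block_mat (map (\<lambda>(a, b). binary_form a b) abs)"
    using ns unfolding nonsingular_def by blast
  define B where "B = diag_block_mat (map (\<lambda>(a, b). binary_form a b) abs)"
  obtain f g where Bm: "B \<in> carrier_mat m m" and "isometry_pair m A B f g"
    using isometric_maps[OF iso[folded B_def] A] by blast
  note g = isometry_pairD(2)[OF this(2)] and PB = isometry_pairD(8)[OF this(2)]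
  have B: "B \<in> carrier_mat (2 * length abs) (2 * length abs)"
    and ndB: "nondegenerate (2 * length abs) (quad B (2 * length abs))"
    using nondegenerate_binary_forms[OF two, of abs] unfolding B_def by blast+
  have "2 * length abs = m" using B Bm by (metis carrier_matD(1))
  note ndB = ndB[unfolded this]
  show ?thesis
    unfolding nondegenerate_def
  proof (intro allI impI)
    fix x i assume "\<forall>y. polar (quad A m) x y = 0" and i: "i < m"
    then have "g x j = 0" if "j < m" for j
      using nondegenerateD[OF ndB, of "g x" j] that by (simp add: PB)
    then show "x i = 0" using linear_injectiveD(4)[OF g] i by blast
  qed
qed

section \<open>Tensor products with Pfister forms\<close>

lemma length_pfister: "length (pfister as) = 2 ^ length as"
  by (induction as) (simp_all add: bilinear_tensor_def)

lemma map_mat_diag_block_mat: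
  assumes "f 0 = 0"
  shows "map_mat f (diag_block_mat As) = diag_block_mat (map (map_mat f) As)"
proof (induction As)
  case Nil show ?case by (auto intro!: eq_matI)
next
  case (Cons A As)
  let ?D = "diag_block_mat As"
  have "map_mat f (four_block_mat A (0\<^sub>m (dim_row A) (dim_col ?D)) (0\<^sub>m (dim_row ?D) (dim_col A)) ?D)
      = four_block_mat (map_mat f A) (0\<^sub>m (dim_row A) (dim_col ?D)) (0\<^sub>m (dim_row ?D) (dim_col A)) (map_mat f ?D)"
    using assms by (intro eq_matI) auto
  then show ?case unfolding diag_block_mat.simps list.map Let_def Cons.IH[symmetric] by simp
qed

lemma quad_smult:
  assumes "A \<in> carrier_mat n n"
  shows "quad (c \<cdot>\<^sub>m A) n x = c * quad A n x"
  using assms by (simp add: quad_def sum_distrib_left mult.assoc)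

lemma quad_diag_block_smult:
  fixes g :: "'a::field \<Rightarrow> 'l::field"
  assumes g: "field_hom g" and A: "A \<in> carrier_mat n n"
  shows "diag_block_mat (map (\<lambda>b. b \<cdot>\<^sub>m A) bs) \<in> carrier_mat (n * length bs) (n * length bs) \<and>
    quad (map_mat g (diag_block_mat (map (\<lambda>b. b \<cdot>\<^sub>m A) bs))) (n * length bs) x
      = (\<Sum>k<length bs. g (bs ! k) * quad (map_mat g A) n (\<lambda>i. x (i + n * k)))"
proof (induction bs arbitrary: x)
  case Nil show ?case by (simp add: quad_def)
next
  case (Cons b bs)
  interpret g: field_hom g by fact
  let ?D = "diag_block_mat (map (\<lambda>b. b \<cdot>\<^sub>m A) bs)" and ?N = "n * length bs"
  have D: "?D \<in> carrier_mat ?N ?N" using Cons.IH by blast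
  have bA: "b \<cdot>\<^sub>m A \<in> carrier_mat n n" using A by simp
  have N: "n * length (b # bs) = n + ?N" by simp
  have gD: "map_mat g ?D = diag_block_mat (map (map_mat g) (map (\<lambda>b. b \<cdot>\<^sub>m A) bs))"
    by (rule map_mat_diag_block_mat) simp
  have "map_mat g (diag_block_mat (map (\<lambda>b. b \<cdot>\<^sub>m A) (b # bs)))
      = diag_block_mat (map_mat g (b \<cdot>\<^sub>m A) # map (map_mat g) (map (\<lambda>b. b \<cdot>\<^sub>m A) bs))"
    by (subst map_mat_diag_block_mat) simp_all
  moreover have "map_mat g (b \<cdot>\<^sub>m A) \<in> carrier_mat n n" using A by simp
  moreover have "diag_block_mat (map (map_mat g) (map (\<lambda>b. b \<cdot>\<^sub>m A) bs)) \<in> carrier_mat ?N ?N"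
    using D unfolding gD[symmetric] by simp
  ultimately have "quad (map_mat g (diag_block_mat (map (\<lambda>b. b \<cdot>\<^sub>m A) (b # bs)))) (n + ?N) x
      = quad (map_mat g (b \<cdot>\<^sub>m A)) n x + quad (map_mat g ?D) ?N (\<lambda>i. x (i + n))"
    unfolding gD by (simp only: quad_diag_block_mat_Cons)
  also have "map_mat g (b \<cdot>\<^sub>m A) = g b \<cdot>\<^sub>m map_mat g A" using A by (auto intro!: eq_matI simp: g.hom_mult)
  also have "quad (g b \<cdot>\<^sub>m map_mat g A) n x = g b * quad (map_mat g A) n x"
    using A by (intro quad_smult) simp
  also have "quad (map_mat g ?D) ?N (\<lambda>i. x (i + n))
      = (\<Sum>k<length bs. g (bs ! k) * quad (map_mat g A) n (\<lambda>i. x (i + n * Suc k)))"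
    using Cons.IH[of "\<lambda>i. x (i + n)"] by (simp add: algebra_simps)
  finally have "quad (map_mat g (diag_block_mat (map (\<lambda>b. b \<cdot>\<^sub>m A) (b # bs)))) (n * length (b # bs)) x
      = (\<Sum>k<length (b # bs). g ((b # bs) ! k) * quad (map_mat g A) n (\<lambda>i. x (i + n * k)))"
    unfolding N list.size(4) add_0_right One_nat_def add_Suc_right sum.lessThan_Suc_shift by simp
  moreover have "diag_block_mat (map (\<lambda>b. b \<cdot>\<^sub>m A) (b # bs)) \<in> carrier_mat (n * length (b # bs)) (n * length (b # bs))"
    unfolding N list.map by (rule diag_block_mat_Cons(2)[OF bA D])
  ultimately show ?case by blast
qed

text \<open>\<open>pfister (a # as)\<close> lists the coefficients of \<open>pfister as\<close> and
  then their multiples by \<open>a\<close>, which is the order of the blocks in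
  \<open>double_map\<close>. This links the iterated doubling to \<open>tensor_form\<close>.\<close>

lemma pfister_map_sum:
  assumes g: "field_hom g"
  shows "pfister_map (map g as) n Q x = (\<Sum>k<2 ^ length as. g (pfister as ! k) * Q (\<lambda>i. x (i + n * k)))"
proof (induction as arbitrary: x)
  case Nil
  interpret field_hom g by fact
  show ?case by simp
next
  case (Cons a as)
  interpret field_hom g by fact
  let ?H = "2 ^ length as"
  have p: "pfister (a # as) = pfister as @ map (\<lambda>b. a * b) (pfister as)"
    by (simp add: bilinear_tensor_def map_idI)
  have "(\<Sum>k<2 ^ length (a # as). g (pfister (a # as) ! k) * Q (\<lambda>i. x (i + n * k)))
      = (\<Sum>k<?H. g (pfister (a # as) ! k) * Q (\<lambda>i. x (i + n * k)))
        + (\<Sum>k<?H. g (pfister (a # as) ! (k + ?H)) * Q (\<lambda>i. x (i + n * (k + ?H))))"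
    by (simp only: length_Cons power_Suc sum_lessThan_double)
  also have "(\<Sum>k<?H. g (pfister (a # as) ! k) * Q (\<lambda>i. x (i + n * k))) = pfister_map (map g as) n Q x"
    unfolding Cons.IH p by (intro sum.cong refl) (simp add: nth_append length_pfister)
  also have "(\<Sum>k<?H. g (pfister (a # as) ! (k + ?H)) * Q (\<lambda>i. x (i + n * (k + ?H))))
      = g a * pfister_map (map g as) n Q (\<lambda>i. x (i + n * ?H))"
    unfolding Cons.IH p sum_distrib_left
    by (intro sum.cong refl) (simp add: nth_append length_pfister hom_mult distrib_left mult.assoc add.assoc)
  finally show ?case by (simp add: double_map_def)
qed

lemma
  fixes g :: "'a::field \<Rightarrow> 'l::field"
  assumes "A \<in> carrier_mat n n"
  shows tensor_form_carrier: "pfister as \<otimes>\<^sub>q A \<in> carrier_mat (n * 2 ^ length as) (n * 2 ^ length as)"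
    and quad_tensor_form: "field_hom g \<Longrightarrow>
      quad (map_mat g (pfister as \<otimes>\<^sub>q A)) (n * 2 ^ length as) = pfister_map (map g as) n (quad (map_mat g A) n)"
proof -
  show "pfister as \<otimes>\<^sub>q A \<in> carrier_mat (n * 2 ^ length as) (n * 2 ^ length as)"
    using quad_diag_block_smult[OF field_hom_id assms, of "pfister as"]
    unfolding tensor_form_def length_pfister by blast
  assume g: "field_hom g"
  show "quad (map_mat g (pfister as \<otimes>\<^sub>q A)) (n * 2 ^ length as) = pfister_map (map g as) n (quad (map_mat g A) n)"
    using quad_diag_block_smult[OF g assms, of "pfister as"]
    unfolding tensor_form_def length_pfister pfister_map_sum[OF g] by blast
qed

lemma isotropic_family_pfister_map:
  assumes S: "subfield_set S" and Q: "quadratic_map M Q" and fam: "isotropic_family S M Q rad d"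
  shows "isotropic_family S (M * 2 ^ length as) (pfister_map as M Q) rad (d * 2 ^ length as)"
proof (induction as)
  case (Cons a as)
  from isotropic_family_double_map[OF S quadratic_map_pfister_map[OF Q] Cons.IH, of a]
  show ?case by (simp add: mult.left_commute)
qed (use fam in simp)

section \<open>The tower over the function field\<close>

text \<open>A nonzero defect yields a vector orthogonal to everything, and its dual vector shows
  that it is not zero.\<close>

lemma nondegenerate_defect:
  fixes A :: "'f::field mat"
  assumes A: "A \<in> carrier_mat n n" and nd: "nondegenerate n (quad A n)"
  shows "defect A = 0"
proof (rule ccontr)
  assume "defect A \<noteq> 0"
  then have "0 < defect A" by simp
  moreover obtain V D where
    "\<And>k l. k < defect A \<Longrightarrow> l < defect A \<Longrightarrow> (\<Sum>i<n. D k i * V l i) = (if k = l then 1 else 0)"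
    and "\<And>k y. k < defect A \<Longrightarrow> polar (quad A n) (V k) y = 0"
    using split_radical_family_defect[OF A] unfolding split_isotropic_family_def by blast
  ultimately have D: "(\<Sum>i<n. D 0 i * V 0 i) = 1" and pol: "\<And>y. polar (quad A n) (V 0) y = 0" by simp_all
  have "V 0 i = 0" if "i < n" for i using nondegenerateD[OF nd, of "V 0" i] pol that by blast
  with D show False by simp
qed

lemma field_hom_two:
  fixes f :: "'a::field \<Rightarrow> 'b::field"
  assumes "field_hom f" and two: "(2::'a) = 0"
  shows "(2::'b) = 0"
proof -
  interpret f: field_hom f by fact
  have "f (1 + 1) = 1 + 1" by (simp only: f.hom_add f.hom_one)
  then show ?thesis using two by simp
qed

lemma isometric_carrier_mat: "A \<cong>\<^sub>q B \<Longrightarrow> A \<in> carrier_mat k k \<Longrightarrow> B \<in> carrier_mat k k"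
  unfolding isometric_def by auto

text \<open>The common core of both claims: \<open>rad\<close> selects the kind of family, and the
  dimension is multiplied by \<open>2 ^ length as\<close>, the dimension of the Pfister
  form.\<close>

lemma function_field_family:
  fixes \<phi> \<psi> :: "'a::field mat" and h :: "'a \<Rightarrow> 'k::field" and h' :: "'a \<Rightarrow> 'l::field"
  assumes char: "CHAR('a) = 2"
    and \<phi>: "\<phi> \<in> carrier_mat m m" and \<psi>: "\<psi> \<in> carrier_mat n n" and n: "2 \<le> n"
    and K: "is_function_field \<psi> h" and L: "is_function_field (pfister as \<otimes>\<^sub>q \<psi>) h'"
    and fam: "split_isotropic_family m (quad (map_mat h \<phi>) m) rad d"
  shows "isotropic_family UNIV (m * 2 ^ length as)
    (quad (map_mat h' (pfister as \<otimes>\<^sub>q \<phi>)) (m * 2 ^ length as)) rad (d * 2 ^ length as)"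
proof -
  have h: "field_hom h" and h': "field_hom h'" using K L unfolding is_function_field_def by auto
  interpret h: field_hom h by fact
  interpret h': field_hom h' by fact
  let ?k = "length as"
  let ?\<Phi> = "pfister as \<otimes>\<^sub>q \<phi>" and ?\<Psi> = "pfister as \<otimes>\<^sub>q \<psi>" and ?N = "n * 2 ^ ?k" and ?M = "m * 2 ^ ?k"
  have \<Phi>: "?\<Phi> \<in> carrier_mat ?M ?M" and \<Psi>: "?\<Psi> \<in> carrier_mat ?N ?N"
    using tensor_form_carrier[OF \<phi>] tensor_form_carrier[OF \<psi>] by auto
  have n_le: "n \<le> ?N" by simp
  have not_unary: False if "A \<cong>\<^sub>q unary_form a" "A \<in> carrier_mat k k" "2 \<le> k" for A :: "'a mat" and a k
  proof -
    have "k = 1" using isometric_carrier_mat[OF that(1,2)] unary_form_carrier[of a] by (metis carrier_matD(1))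
    with that(3) show False by simp
  qed
  consider (split) "bij h" | (irreducible) \<iota> where "Factorial_Ring.irreducible (form_poly \<psi>)"
      "fraction_field_embedding (affine_ring \<psi>) \<iota>" "\<And>c. \<iota> (affine_ring_const \<psi> c) = h c"
    using K unfolding is_function_field_def by blast
  then show ?thesis
  proof cases
    case split
    \<comment> \<open>Here F(\<psi>) is the base field up to \<open>h\<close>, so it embeds into
      every extension of the base field.\<close>
    define g where "g k = h' (inv_into UNIV h k)" for k
    have inj: "inj h" and surj: "surj h" using split by (auto simp: bij_def)
    have gh: "g (h c) = h' c" for c using inj by (simp add: g_def)
    have g: "field_hom g"
    proof
      show "g 0 = 0" "g 1 = 1" using gh[of 0] gh[of 1] by simp_all
      fix x y
      obtain a b where "x = h a" "y = h b" using surj by (metis surjD)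
      then show "g (x + y) = g x + g y" "g (x * y) = g x * g y"
        using gh h.hom_add h.hom_mult h'.hom_add h'.hom_mult by metis+
    qed
    have S: "subfield_set UNIV" by (simp add: subfield_set_def)
    have "isotropic_family UNIV m (quad (map_mat h' \<phi>) m) rad d"
      by (rule split_isotropic_family_hom[OF g gh S _ \<phi> fam]) simp
    from isotropic_family_pfister_map[OF S quadratic_map_quad this, of "map h' as"]
    show ?thesis by (simp add: quad_tensor_form[OF \<phi> h'])
  next
    case (irreducible \<iota>)
    obtain w where gen: "generic_zero \<psi> n h w"
      using function_field_generic_zero[OF h \<psi> irreducible(2,3)] by blast
    \<comment> \<open>The product has dimension at least 2, which excludes the unary
      alternative.\<close>
    consider (bij) "?\<Psi> \<cong>\<^sub>q hyperbolic_plane" | (emb) \<kappa> where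
        "fraction_field_embedding (affine_ring ?\<Psi>) \<kappa>" "\<And>c. \<kappa> (affine_ring_const ?\<Psi> c) = h' c"
      using L not_unary[OF _ \<Psi>] n n_le unfolding is_function_field_def by fastforce
    then show ?thesis
    proof cases
      case bij
      have N2: "n * 2 ^ ?k = 2"
        using isometric_carrier_mat[OF bij \<Psi>] hyperbolic_plane_carrier[where 'a = 'a] by (metis carrier_matD(1))
      \<comment> \<open>Dimension 2 leaves room for no slot. The product is then \<psi> itself,
        which is irreducible and therefore not hyperbolic.\<close>
      have "as = []"
      proof (rule ccontr)
        assume "as \<noteq> []"
        then have "(2::nat) ^ 1 \<le> 2 ^ ?k" by (intro power_increasing) (auto simp: Suc_le_eq)
        then have "2 * 2 \<le> n * 2 ^ ?k" using n by (intro mult_le_mono) simp_all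
        then show False using N2 by simp
      qed
      have "?\<Psi> = \<psi>"
        unfolding tensor_form_def \<open>as = []\<close> by (auto simp del: diag_block_mat.simps intro!: eq_matI)
      then show ?thesis using hyperbolic_plane_not_irreducible bij irreducible(1) by metis
    next
      case (emb \<kappa>)
      obtain \<xi> where gen': "generic_zero ?\<Psi> ?N h' \<xi>"
        using function_field_generic_zero[OF h' \<Psi> emb] by blast
      have two: "(2::'a) = 0" using of_nat_CHAR[where 'a = 'a] char by simp
      note two_hom = field_hom_two[OF _ two]
      obtain u where u: "u 0 = 0" "\<And>i. n \<le> i \<Longrightarrow> u i = 0" "quad \<psi> n u \<noteq> 0"
        using irreducible_form_nonzero_off_hyperplane[OF irreducible(1) \<psi>] n by auto
      define \<beta> where "\<beta> = polar (quad (map_mat h \<psi>) n) w (\<lambda>i. h (u i)) / quad (map_mat h \<psi>) n (\<lambda>i. h (u i))"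
      have w: "w 0 = 1" "quad (map_mat h \<psi>) n w = 0" using gen unfolding generic_zero_def by auto
      have refl: "reflected_zero n (quad (map_mat h \<psi>) n) w (\<lambda>i. h (u i)) \<beta>"
        unfolding reflected_zero_def reflected_zero_axioms_def
        using u w(2) two_hom[OF h] by (auto simp: quadratic_map_quad quad_hom[OF h \<psi>] \<beta>_def)
      \<comment> \<open>The two closures have different tasks: the tower is built in that of
        \<open>'l\<close>, while that of \<open>'k\<close> supplies the roots \<open>c\<close> for
        the test point.\<close>
      let ?i = "to_ac :: 'l \<Rightarrow> 'l alg_closure" and ?j = "to_ac :: 'k \<Rightarrow> 'k alg_closure"
      have i: "field_hom ?i" and j: "field_hom ?j" by (unfold_locales; simp)+
      define \<eta> where "\<eta> = (\<lambda>c. ?i (h' c))"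
      define \<theta> where "\<theta> = (\<lambda>c. ?j (h c))"
      have \<eta>: "field_hom \<eta>" and \<theta>: "field_hom \<theta>"
        unfolding \<eta>_def \<theta>_def by (unfold_locales; simp add: h.hom_add h.hom_mult h'.hom_add h'.hom_mult)+
      have j\<theta>: "map_mat \<theta> A = map_mat ?j (map_mat h A)" and i\<eta>: "map_mat \<eta> A = map_mat ?i (map_mat h' A)" for A
        by (auto intro!: eq_matI simp: \<eta>_def \<theta>_def)
      have \<theta>_eq: "\<theta> c = ?j (h c)" for c by (simp add: \<theta>_def)
      let ?w = "\<lambda>i. ?j (w i)" and ?u = "\<lambda>i. \<theta> (u i)" and ?\<beta> = "?j \<beta>"
      let ?q = "quad (map_mat \<eta> \<psi>) n" and ?q' = "quad (map_mat \<theta> \<psi>) n" and ?p = "quad (map_mat \<eta> \<phi>) m"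
      have h\<psi>: "map_mat h \<psi> \<in> carrier_mat n n" using \<psi> by simp
      note Q0 = quad_hom[OF j h\<psi>] and P0 = polar_hom[OF j h\<psi>]
      interpret R: reflected_zero n "quad (map_mat h \<psi>) n" w "\<lambda>i. h (u i)" \<beta> by (rule refl)
      have refl': "reflected_zero n ?q' ?w ?u ?\<beta>"
        unfolding reflected_zero_def reflected_zero_axioms_def
      proof (intro conjI allI impI)
        show "quadratic_map n ?q'" by (rule quadratic_map_quad)
        show "(2::'k alg_closure) = 0" by (rule two_hom[OF \<theta>])
        show "?u i = 0" if "n \<le> i" for i using u(2)[OF that] by (simp add: \<theta>_def)
        show "?q' ?w = 0" using Q0[of w] w(2) by (simp add: j\<theta>)
        show "?q' ?u \<noteq> 0" using Q0[of "\<lambda>i. h (u i)"] R.u_nonzero by (simp add: j\<theta> \<theta>_eq)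
        show "?\<beta> * ?q' ?u = polar ?q' ?w ?u"
          using Q0[of "\<lambda>i. h (u i)"] P0[of w "\<lambda>i. h (u i)"] R.\<beta> by (simp add: j\<theta> \<theta>_eq flip: to_ac_mult)
      qed
      interpret R': reflected_zero n ?q' ?w ?u ?\<beta> by (rule refl')
      obtain x where x: "test_point n ?w ?u ?\<beta> (map \<theta> as) x" "x 0 = 1"
      proof -
        have "\<exists>c. c\<^sup>2 = ?\<beta> * c + a" for a
        proof -
          have "\<exists>t. poly [:- a, - ?\<beta>, 1:] t = 0"
            by (rule alg_closed_imp_poly_has_root) simp
          then obtain t where "- a + t * (- ?\<beta> + t) = 0" by auto
          then have "t\<^sup>2 = ?\<beta> * t + a" by (simp add: power2_eq_square algebra_simps)
          then show ?thesis by blast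
        qed
        then obtain x where "test_point n ?w ?u ?\<beta> (map \<theta> as) x \<and> (0 < n \<longrightarrow> ?u 0 = 0 \<longrightarrow> x 0 = ?w 0)"
          using R'.test_point_exists[of "map \<theta> as"] by blast
        then show ?thesis using that[of x] n u(1) w(1) by (simp add: \<theta>_def)
      qed
      have x_zero: "quad (map_mat \<theta> ?\<Psi>) ?N x = 0"
        using R'.test_point_zero[OF x(1)] by (simp add: quad_tensor_form[OF \<psi> \<theta>])
      have \<xi>: "quad (map_mat h' ?\<Psi>) ?N \<xi> = 0" using gen' unfolding generic_zero_def by auto
      obtain \<rho> where \<rho>: "specialization \<eta> \<theta> \<rho>" and \<xi>x: "\<And>l. l < ?N \<Longrightarrow> (?i (\<xi> l), x l) \<in> \<rho>"
        using generic_zero_specialization[OF gen' h' i \<theta> \<Psi> x(2) x_zero] unfolding \<eta>_def by blast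
      have base: "isotropic_family S m ?p rad d"
        if S: "subfield_set S" "range \<eta> \<subseteq> S" and \<sigma>: "specialization \<eta> \<theta> \<sigma>"
          and z: "\<And>i. i < n \<Longrightarrow> z i \<in> S \<and> (z i, y i) \<in> \<sigma>" and qz: "?q z = 0"
          and y: "test_point n ?w ?u ?\<beta> [] y" for S \<sigma> z y
      proof -
        note D = specializationD[OF \<sigma>]
        have n0: "0 < n" using n by simp
        have y0: "y 0 = 1" using y n0 w(1) u(1) by (auto simp: \<theta>_def)
        have z1: "(z 0, 1) \<in> \<sigma>" using z[OF n0] y0 by simp
        then have z0: "z 0 \<noteq> 0" using D(5)[of 1] by auto
        \<comment> \<open>The zero need not lie in the chart, but its first coordinate specializes
          to 1, hence is nonzero and can be divided out.\<close>
        define z' where "z' = (\<lambda>i. inverse (z 0) * z i)"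
        have z'0: "z' 0 = 1" using z0 by (simp add: z'_def)
        have qz': "?q z' = 0"
          by (simp add: z'_def quadratic_map.scale[OF quadratic_map_quad] qz)
        have z'y: "(z' i, y i) \<in> \<sigma>" if "i < n" for i
          using D(3)[OF D(4)[OF z1] conjunct2[OF z[OF that]]] by (simp add: z'_def)
        have z'S: "z' i \<in> S" if "i < n" for i
          using z[OF that] z[OF n0] by (simp add: z'_def subfield_setD[OF S(1)])
        obtain f where f: "field_hom f" "\<And>c. f (h c) = \<eta> c" "range f \<subseteq> S"
        proof (rule generic_zero_hom[OF gen h \<eta> _ _ S])
          fix p :: "'a mpoly" assume p: "p \<in> carrier (mpoly_ring {1..<n})"
          show "mpoly_eval \<eta> z' p = 0" if "mpoly_eval h w p = 0"
            by (rule generic_zero_specialize[OF gen \<psi> p that \<eta> z'0 qz'])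
          \<comment> \<open>A polynomial vanishing at \<open>z'\<close> vanishes at the image
            \<open>y\<close>. Up to the embedding into the closure, \<open>y\<close> is
            \<open>w\<close> or its mirror image, and \<open>generic_zero_reflect\<close> settles
            the second case.\<close>
          show "mpoly_eval h w p = 0" if zero: "mpoly_eval \<eta> z' p = 0"
          proof -
            have ev: "(mpoly_eval \<eta> z' p, mpoly_eval \<theta> v p) \<in> \<sigma>" if v: "\<And>i. i < n \<Longrightarrow> y i = v i" for v
              by (rule mpoly_eval_specialization[OF \<eta> \<theta> \<sigma> p]) (use z'y v in auto)
            have jv: "mpoly_eval \<theta> (\<lambda>i. ?j (v i)) p = ?j (mpoly_eval h v p)" for v
              using p
              by (induction p rule: mpoly_ring_induct)
                (use h \<theta> in \<open>simp_all add: mpoly_eval_add mpoly_eval_mult \<theta>_def\<close>)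
            have w_or: "mpoly_eval h v p = 0" if "\<And>i. i < n \<Longrightarrow> y i = ?j (v i)" for v
            proof -
              have "(0, ?j (mpoly_eval h v p)) \<in> \<sigma>" using ev[of "\<lambda>i. ?j (v i)", OF that] zero by (simp add: jv)
              from D(5)[OF this] show ?thesis by simp
            qed
            from y consider "\<forall>i<n. y i = ?j (w i)" | "\<forall>i<n. y i = ?j (w i + \<beta> * h (u i))"
              by (auto simp: \<theta>_def)
            then show ?thesis
            proof cases
              case 1 then show ?thesis using w_or[of w] by blast
            next
              case 2
              then have "mpoly_eval h (\<lambda>i. w i + \<beta> * h (u i)) p = 0"
                by (intro w_or[of "\<lambda>i. w i + \<beta> * h (u i)"]) simp
              then show ?thesis by (rule generic_zero_reflect[OF gen h \<psi> refl u(1) n0 p])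
            qed
          qed
        next
          show "z' i \<in> S" if "i \<in> {1..<n}" for i using z'S that by simp
        qed blast
        show ?thesis by (rule split_isotropic_family_hom[OF f(1,2) S(1) f(3) \<phi> fam])
      qed
      have range: "range \<eta> \<subseteq> range ?i" by (auto simp: \<eta>_def)
      have in_S: "quad (map_mat \<eta> A) k v \<in> S"
        if "subfield_set S" "range \<eta> \<subseteq> S" "\<And>i. i < k \<Longrightarrow> v i \<in> S" "A \<in> carrier_mat k k" for S k v and A :: "'a mat"
        unfolding quad_def using that
        by (intro subfield_set_sum subfield_setD(4)) auto
      \<comment> \<open>The bottom of the tower is the copy of \<open>'l\<close> in its closure, and
        the zero to start from is the generic zero of the product.\<close>
      have "isotropic_family (range ?i) ?M (pfister_map (map \<eta> as) m ?p) rad (d * 2 ^ ?k)"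
      proof (rule isotropic_family_tower[OF \<eta> \<theta> two_hom[OF \<eta>] refl' quadratic_map_quad quadratic_map_quad
            _ in_S in_S base subfield_set_range[OF i] range \<rho> _ _ x(1)])
        show "(?q v, ?q' v') \<in> \<sigma>" if "specialization \<eta> \<theta> \<sigma>" "\<And>i. i < n \<Longrightarrow> (v i, v' i) \<in> \<sigma>" for \<sigma> v v'
          by (rule quad_specialization[OF \<eta> \<theta> that(1) \<psi> that(2)])
        show "?i (\<xi> l) \<in> range ?i \<and> (?i (\<xi> l), x l) \<in> \<rho>" if "l < n * 2 ^ ?k" for l
          using \<xi>x[OF that] by blast
        have "quad (map_mat \<eta> ?\<Psi>) ?N (\<lambda>l. ?i (\<xi> l)) = ?i (quad (map_mat h' ?\<Psi>) ?N \<xi>)"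
          unfolding i\<eta> using \<Psi> by (intro quad_hom[OF i]) simp
        then show "pfister_map (map \<eta> as) n ?q (\<lambda>l. ?i (\<xi> l)) = 0"
          using \<xi> by (simp add: quad_tensor_form[OF \<psi> \<eta>])
      qed (use \<phi> \<psi> in auto)
      then have "isotropic_family (range ?i) ?M (quad (map_mat ?i (map_mat h' ?\<Phi>)) ?M) rad (d * 2 ^ ?k)"
        by (simp add: quad_tensor_form[OF \<phi> \<eta>] flip: i\<eta>)
      then show ?thesis using \<Phi> by (intro isotropic_family_range[OF i]) simp_all
    qed
  qed
qed

theorem theorem4p10:
  fixes \<phi> \<psi> :: "'a::field mat" and \<pi> :: "'a list"
    and h :: "'a \<Rightarrow> 'k::field" and h' :: "'a \<Rightarrow> 'l::field"
  assumes "CHAR('a) = 2"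
    and "\<phi> \<in> carrier_mat m m" and "m \<ge> 2"
    and "\<psi> \<in> carrier_mat n n" and "n \<ge> 2"
    and "bilinear_pfister \<pi>"
    and "is_function_field \<psi> h"
    and "is_function_field (\<pi> \<otimes>\<^sub>q \<psi>) h'"
  shows "defect (map_mat h' (\<pi> \<otimes>\<^sub>q \<phi>)) \<ge> length \<pi> * defect (map_mat h \<phi>) \<and>
    (nonsingular \<phi> \<and> \<not> totally_singular \<psi> \<longrightarrow>
       witt_index (map_mat h' (\<pi> \<otimes>\<^sub>q \<phi>)) \<ge> length \<pi> * witt_index (map_mat h \<phi>))"
proof -
  obtain as where as: "0 \<notin> set as" and \<pi>: "\<pi> = pfister as"
    using assms(6) unfolding bilinear_pfister_def by blast
  let ?M = "m * 2 ^ length as" and ?\<Phi> = "map_mat h' (pfister as \<otimes>\<^sub>q \<phi>)"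
  have h': "field_hom h'" using assms(8) unfolding is_function_field_def by blast
  interpret h': field_hom h' by fact
  have K: "map_mat h \<phi> \<in> carrier_mat m m" and \<Phi>: "?\<Phi> \<in> carrier_mat ?M ?M"
    using assms(2) tensor_form_carrier[OF assms(2), of as] by auto
  note family = function_field_family[OF assms(1,2,4,5,7) assms(8)[unfolded \<pi>]]
  have i: "defect (map_mat h \<phi>) * 2 ^ length as \<le> defect ?\<Phi>"
    by (rule radical_family_le_defect[OF \<Phi> family[OF split_radical_family_defect[OF K]]])
  \<comment> \<open>This bounds the dimension of a maximal totally isotropic subspace. It yields the
    claim on the Witt index because the defect of the target vanishes for nonsingular
    \<phi>.\<close>
  have ii: "(witt_index (map_mat h \<phi>) + defect (map_mat h \<phi>)) * 2 ^ length as \<le> witt_index ?\<Phi> + defect ?\<Phi>"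
    by (rule isotropic_family_le[OF \<Phi> family[OF split_isotropic_family_index[OF K]]])
  have "defect ?\<Phi> = 0" if ns: "nonsingular \<phi>"
  proof -
    have "(2::'a) = 0" using of_nat_CHAR[where 'a = 'a] assms(1) by simp
    from nondegenerate_hom[OF h' assms(2) nonsingular_nondegenerate[OF this assms(2) ns]]
    moreover have "0 \<notin> set (map h' as)" using as by (auto simp flip: h'.hom_0_iff)
    ultimately have "nondegenerate ?M (pfister_map (map h' as) m (quad (map_mat h' \<phi>) m))"
      using nondegenerate_pfister_map[OF quadratic_map_quad, of m "map_mat h' \<phi>" "map h' as"] by simp
    then have "nondegenerate ?M (quad ?\<Phi> ?M)" by (simp add: quad_tensor_form[OF assms(2) h'])
    then show ?thesis by (rule nondegenerate_defect[OF \<Phi>])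
  qed
  then show ?thesis using i ii unfolding \<pi> length_pfister by (auto simp: algebra_simps)
qed

end
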